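(* Let $M$ be a smooth connected complex quasi-projective surface, $S$ a smooth connected complex algebraic curve, $f:M\to S$ a surjective morphism with connected generic fiber $F$, and let $\tilde\rho:T(f)\to\mathbb{C}^*$ be a character. Then the support $\operatorname{supp}(\tilde\rho)$ is empty if and only if the character $\tilde\rho$ is trivial.
   Context: Homology is with $\mathbb{Z}$-coefficients. The generic fiber $F$ is a fiber over a point of a nonempty Zariski open subset of $S$ over which $f$ is a topologically locally trivial fibration; $i:F\to M$ is the inclusion. Put $T(f)=\ker(f_*:H_1(M)\to H_1(S))/\operatorname{im}(i_*:H_1(F)\to H_1(M))$. $\mathbb{T}(M)=\operatorname{Hom}(H_1(M),\mathbb{C}^* )$ parametrizes rank one local systems $\mathcal{L}_\rho$ on $M$, $\mathbb{T}(S)=\operatorname{Hom}(H_1(S),\mathbb{C}^* )$, and $\mathbb{T}(M)_F=\{\rho\in\mathbb{T}(M)\mid\rho\circ i_*=1\}$, i.e. those $\rho$ with $\mathcal{L}_\rho|F$ trivial. Restricting characters in $\mathbb{T}(M)_F$ to $\ker f_*$ gives an exact sequence $1\to\mathbb{T}(S)\xrightarrow{f^*}\mathbb{T}(M)_F\to\operatorname{Hom}(T(f),\mathbb{C}^* )\to1$; a representative of $\tilde\rho\in\operatorname{Hom}(T(f),\mathbb{C}^* )$ is any $\rho\in\mathbb{T}(M)_F$ mapping to it. For a constructible sheaf $\mathcal{F}$ on $S$, the singular support $\Sigma(\mathcal{F})$ is the minimal finite set such that $\mathcal{F}|(S\setminus\Sigma(\mathcal{F}))$ is a local system. The support of $\tilde\rho$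 is $\operatorname{supp}(\tilde\rho)=\Sigma(R^0f_*(\mathcal{L}_\rho))$ for some representative $\rho$ of $\tilde\rho$ (it does not depend on the choice of the representative). *)

theory Defs
  imports "HOL-Analysis.Analysis" "HOL-Homology.Homology"
begin

section \<open>Complex projective space and its classical topology\<close>

text \<open>The projective space of lines in \<open>\<complex>\<^sup>n\<close> (so of dimension \<open>CARD('n) - 1\<close>), as the quotient of the
  nonzero vectors by scaling. \<open>abs_cproj v\<close> is the point \<open>[v]\<close>; it is meaningful only for \<open>v \<noteq> 0\<close>.\<close>

definition cproj_rel :: "complex ^ 'n::finite \<Rightarrow> complex ^ 'n \<Rightarrow> bool" where
  "cproj_rel v w \<longleftrightarrow> v \<noteq> 0 \<and> w \<noteq> 0 \<and> (\<exists>c. c \<noteq> 0 \<and> w = c *s v)"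

lemma part_equivp_cproj_rel: "part_equivp (cproj_rel :: complex ^ 'n::finite \<Rightarrow> _)"
proof (rule part_equivpI)
  show "\<exists>x :: complex ^ 'n. cproj_rel x x"
    by (rule exI[of _ 1]) (auto simp: cproj_rel_def intro: exI[of _ 1])
  show "symp (cproj_rel :: complex ^ 'n \<Rightarrow> _)"
  proof (rule sympI)
    fix v w :: "complex ^ 'n" assume "cproj_rel v w"
    then obtain c where "v \<noteq> 0" "w \<noteq> 0" "c \<noteq> 0" "w = c *s v" by (auto simp: cproj_rel_def)
    then show "cproj_rel w v"
      by (auto simp: cproj_rel_def intro!: exI[of _ "inverse c"])
  qed
  show "transp (cproj_rel :: complex ^ 'n \<Rightarrow> _)"
  proof (rule transpI)
    fix u v w :: "complex ^ 'n" assume "cproj_rel u v" "cproj_rel v w"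
    then obtain c d where "u \<noteq> 0" "w \<noteq> 0" "c \<noteq> 0" "d \<noteq> 0" "v = c *s u" "w = d *s v"
      by (auto simp: cproj_rel_def)
    then show "cproj_rel u w"
      by (auto simp: cproj_rel_def intro!: exI[of _ "d * c"])
  qed
qed

quotient_type 'n cproj = "complex ^ 'n::finite" / partial: "cproj_rel"
  by (rule part_equivp_cproj_rel)

instantiation cproj :: (finite) topological_space
begin

definition open_cproj :: "'a cproj set \<Rightarrow> bool" where
  "open_cproj U \<longleftrightarrow> open {v. v \<noteq> 0 \<and> abs_cproj v \<in> U}"

instance
proof
  show "open (UNIV :: 'a cproj set)"
    using open_delete[OF open_UNIV, of "0 :: complex ^ 'a"]
    by (simp add: open_cproj_def Compl_eq_Diff_UNIV[symmetric] Compl_eq)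
next
  fix S T :: "'a cproj set" assume "open S" "open T"
  moreover have "{v. v \<noteq> 0 \<and> abs_cproj v \<in> S \<inter> T} =
      {v. v \<noteq> 0 \<and> abs_cproj v \<in> S} \<inter> {v. v \<noteq> 0 \<and> abs_cproj v \<in> T}" by auto
  ultimately show "open (S \<inter> T)" by (simp only: open_cproj_def open_Int)
next
  fix K :: "'a cproj set set" assume "\<forall>S\<in>K. open S"
  moreover have "{v. v \<noteq> 0 \<and> abs_cproj v \<in> \<Union>K} = (\<Union>S\<in>K. {v. v \<noteq> 0 \<and> abs_cproj v \<in> S})" by auto
  ultimately show "open (\<Union>K)" by (auto simp: open_cproj_def)
qed

end

section \<open>Quasi-projective varieties\<close>

definition homogeneous_poly :: "nat \<Rightarrow> (complex ^ 'n::finite \<Rightarrow> complex) \<Rightarrow> bool" where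
  "homogeneous_poly d P \<longleftrightarrow>
     (\<exists>(A :: ('n \<Rightarrow> nat) set) c. finite A \<and> (\<forall>m\<in>A. (\<Sum>i\<in>UNIV. m i) = d) \<and>
        P = (\<lambda>v. \<Sum>m\<in>A. c m * (\<Prod>i\<in>UNIV. v $ i ^ m i)))"

definition zero_locus :: "(complex ^ 'n::finite \<Rightarrow> complex) set \<Rightarrow> 'n cproj set" where
  "zero_locus \<P> = {abs_cproj v |v. v \<noteq> 0 \<and> (\<forall>P\<in>\<P>. P v = 0)}"

definition zariski_closed :: "'n::finite cproj set \<Rightarrow> bool" where
  "zariski_closed Z \<longleftrightarrow> (\<exists>\<P>. (\<forall>P\<in>\<P>. \<exists>d. homogeneous_poly d P) \<and> Z = zero_locus \<P>)"

definition zariski_open :: "'n::finite cproj set \<Rightarrow> bool" where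
  "zariski_open W \<longleftrightarrow> zariski_closed (- W)"

definition zariski_openin :: "'n::finite cproj set \<Rightarrow> 'n cproj set \<Rightarrow> bool" where
  "zariski_openin M U \<longleftrightarrow> (\<exists>W. zariski_open W \<and> U = M \<inter> W)"

definition quasi_projective :: "'n::finite cproj set \<Rightarrow> bool" where
  "quasi_projective M \<longleftrightarrow> (\<exists>Z. zariski_closed Z \<and> zariski_openin Z M)"

definition complex_gradient :: "(complex ^ 'n::finite \<Rightarrow> complex) \<Rightarrow> complex ^ 'n \<Rightarrow> complex ^ 'n" where
  "complex_gradient P v = (\<chi> i. deriv (\<lambda>t. P (v + t *s axis i 1)) 0)"

text \<open>Smooth of pure dimension \<open>d\<close>: Zariski locally \<open>M\<close> is cut out in the ambient projective space,
  of dimension \<open>N = CARD('n) - 1\<close>, by \<open>N - d\<close> homogeneous equations whose differentials are linearly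
  independent at the given point.\<close>

definition smooth_of_dim :: "nat \<Rightarrow> 'n::finite cproj set \<Rightarrow> bool" where
  "smooth_of_dim d M \<longleftrightarrow>
     (\<forall>x\<in>M. \<exists>W k P. zariski_open W \<and> x \<in> W \<and> k + d + 1 = CARD('n) \<and>
        (\<forall>j<k. \<exists>e. homogeneous_poly e (P j)) \<and>
        M \<inter> W = zero_locus (P ` {..<k}) \<inter> W \<and>
        (\<forall>v. v \<noteq> 0 \<and> abs_cproj v = x \<longrightarrow>
           (\<forall>c :: nat \<Rightarrow> complex.
              (\<Sum>j<k. c j *s complex_gradient (P j) v) = 0 \<longrightarrow> (\<forall>j<k. c j = 0))))"

definition morphism :: "'n::finite cproj set \<Rightarrow> 'm::finite cproj set \<Rightarrow> ('n cproj \<Rightarrow> 'm cproj) \<Rightarrow> bool" where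
  "morphism M S f \<longleftrightarrow> f ` M \<subseteq> S \<and>
     (\<forall>x\<in>M. \<exists>W e Q. zariski_open W \<and> x \<in> W \<and> (\<forall>j. homogeneous_poly e (\<lambda>v. Q v $ j)) \<and>
        (\<forall>v. v \<noteq> 0 \<and> abs_cproj v \<in> M \<inter> W \<longrightarrow> Q v \<noteq> 0 \<and> f (abs_cproj v) = abs_cproj (Q v)))"

definition fiber :: "'a set \<Rightarrow> ('a \<Rightarrow> 'b) \<Rightarrow> 'b \<Rightarrow> 'a set" where
  "fiber M f b = M \<inter> f -` {b}"

definition locally_trivial_over ::
    "'a::topological_space set \<Rightarrow> ('a \<Rightarrow> 'b::topological_space) \<Rightarrow> 'b set \<Rightarrow> bool" where
  "locally_trivial_over M f U \<longleftrightarrow>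
     (\<forall>b\<in>U. \<exists>V h k. openin (top_of_set U) V \<and> b \<in> V \<and>
        homeomorphism (V \<times> fiber M f b) (M \<inter> f -` V) h k \<and>
        (\<forall>y\<in>V. \<forall>z\<in>fiber M f b. f (h (y, z)) = y))"

section \<open>First homology and characters\<close>

abbreviation H1 :: "'a::topological_space set \<Rightarrow> 'a chain set monoid" where
  "H1 X \<equiv> homology_group 1 (top_of_set X)"

abbreviation H1_map :: "'a::topological_space set \<Rightarrow> 'b::topological_space set \<Rightarrow> ('a \<Rightarrow> 'b)
    \<Rightarrow> 'a chain set \<Rightarrow> 'b chain set" where
  "H1_map X Y f \<equiv> hom_induced 1 (top_of_set X) {} (top_of_set Y) {} f"

definition complex_ring :: "complex ring" where
  "complex_ring = \<lparr>carrier = UNIV, mult = (*), one = 1, zero = 0, add = (+)\<rparr>"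

abbreviation complex_units :: "complex monoid" where
  "complex_units \<equiv> units_of complex_ring"

definition H1_kernel ::
    "'a::topological_space set \<Rightarrow> 'b::topological_space set \<Rightarrow> ('a \<Rightarrow> 'b) \<Rightarrow> 'a chain set set" where
  "H1_kernel M S f = kernel (H1 M) (H1 S) (H1_map M S f)"

definition H1_fiber_image ::
    "'a::topological_space set \<Rightarrow> 'a set \<Rightarrow> 'a chain set set" where
  "H1_fiber_image M F = H1_map F M id ` carrier (H1 F)"

definition T_group :: "'a::topological_space set \<Rightarrow> 'b::topological_space set \<Rightarrow> ('a \<Rightarrow> 'b) \<Rightarrow> 'a set
    \<Rightarrow> 'a chain set set monoid" where
  "T_group M S f F = (H1 M)\<lparr>carrier := H1_kernel M S f\<rparr> Mod H1_fiber_image M F"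

definition characters_trivial_on_fiber ::
    "'a::topological_space set \<Rightarrow> 'a set \<Rightarrow> ('a chain set \<Rightarrow> complex) set" where
  "characters_trivial_on_fiber M F =
     {\<rho> \<in> hom (H1 M) complex_units. \<forall>c\<in>carrier (H1 F). \<rho> (H1_map F M id c) = 1}"

definition representative :: "'a::topological_space set \<Rightarrow> 'b::topological_space set \<Rightarrow> ('a \<Rightarrow> 'b) \<Rightarrow> 'a set
    \<Rightarrow> ('a chain set set \<Rightarrow> complex) \<Rightarrow> ('a chain set \<Rightarrow> complex) \<Rightarrow> bool" where
  "representative M S f F \<tau> \<rho> \<longleftrightarrow> \<rho> \<in> characters_trivial_on_fiber M F \<and>
     (\<forall>z\<in>H1_kernel M S f. \<rho> z = \<tau> (H1_fiber_image M F #>\<^bsub>H1 M\<^esub> z))"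

section \<open>Sheaves of complex vector spaces\<close>

text \<open>Sections are \<open>HOL-Algebra\<close> modules over \<open>complex_ring\<close>; \<open>res F U V\<close> restricts from \<open>U\<close> to
  \<open>V \<subseteq> U\<close>. Only the values on open sets matter, so the restriction of a sheaf to an open subset
  \<open>W\<close> is the same record, considered on \<open>subtopology X W\<close>.\<close>

record ('a, 's) presheaf =
  sec :: "'a set \<Rightarrow> (complex, 's) module"
  res :: "'a set \<Rightarrow> 'a set \<Rightarrow> 's \<Rightarrow> 's"

definition linear_between :: "(complex, 's) module \<Rightarrow> (complex, 't) module \<Rightarrow> ('s \<Rightarrow> 't) \<Rightarrow> bool" where
  "linear_between A B \<phi> \<longleftrightarrow> \<phi> \<in> carrier A \<rightarrow> carrier B \<and>
     (\<forall>s\<in>carrier A. \<forall>t\<in>carrier A. \<phi> (s \<oplus>\<^bsub>A\<^esub> t) = \<phi> s \<oplus>\<^bsub>B\<^esub> \<phi> t) \<and>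
     (\<forall>c. \<forall>s\<in>carrier A. \<phi> (c \<odot>\<^bsub>A\<^esub> s) = c \<odot>\<^bsub>B\<^esub> \<phi> s)"

definition sheaf :: "'a topology \<Rightarrow> ('a, 's) presheaf \<Rightarrow> bool" where
  "sheaf X F \<longleftrightarrow>
     (\<forall>U. openin X U \<longrightarrow> Module.module complex_ring (sec F U)) \<and>
     (\<forall>U V. openin X U \<and> openin X V \<and> V \<subseteq> U \<longrightarrow> linear_between (sec F U) (sec F V) (res F U V)) \<and>
     (\<forall>U. openin X U \<longrightarrow> (\<forall>s\<in>carrier (sec F U). res F U U s = s)) \<and>
     (\<forall>U V W. openin X U \<and> openin X V \<and> openin X W \<and> W \<subseteq> V \<and> V \<subseteq> U \<longrightarrow>
        (\<forall>s\<in>carrier (sec F U). res F V W (res F U V s) = res F U W s)) \<and>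
     (\<forall>\<U> s. (\<forall>U\<in>\<U>. openin X U \<and> s U \<in> carrier (sec F U)) \<and>
        (\<forall>U\<in>\<U>. \<forall>V\<in>\<U>. res F U (U \<inter> V) (s U) = res F V (U \<inter> V) (s V)) \<longrightarrow>
        (\<exists>!t. t \<in> carrier (sec F (\<Union>\<U>)) \<and> (\<forall>U\<in>\<U>. res F (\<Union>\<U>) U t = s U)))"

definition sheaf_isomorphic :: "'a topology \<Rightarrow> ('a, 's) presheaf \<Rightarrow> ('a, 't) presheaf \<Rightarrow> bool" where
  "sheaf_isomorphic X F G \<longleftrightarrow>
     (\<exists>\<phi>. (\<forall>U. openin X U \<longrightarrow> linear_between (sec F U) (sec G U) (\<phi> U) \<and>
              bij_betw (\<phi> U) (carrier (sec F U)) (carrier (sec G U))) \<and>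
          (\<forall>U V. openin X U \<and> openin X V \<and> V \<subseteq> U \<longrightarrow>
              (\<forall>s\<in>carrier (sec F U). \<phi> V (res F U V s) = res G U V (\<phi> U s))))"

text \<open>A space \<open>K\<close> of complex functions on the index set \<open>I\<close> with pointwise operations. The
  fields \<open>mult\<close> and \<open>one\<close> of the record are not used by modules.\<close>

definition function_module :: "'i set \<Rightarrow> ('i \<Rightarrow> complex) set \<Rightarrow> (complex, 'i \<Rightarrow> complex) module" where
  "function_module I K = \<lparr>carrier = K, mult = undefined, one = undefined,
     zero = (\<lambda>i\<in>I. 0), add = (\<lambda>s t. \<lambda>i\<in>I. s i + t i), smult = (\<lambda>c s. \<lambda>i\<in>I. c * s i)\<rparr>"

text \<open>The constant sheaf with stalk \<open>\<complex>\<^sup>r\<close>: locally constant functions \<open>U \<rightarrow> \<complex>\<^sup>r\<close>, uncurried.\<close>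

definition constant_sheaf :: "'a topology \<Rightarrow> nat \<Rightarrow> ('a, 'a \<times> nat \<Rightarrow> complex) presheaf" where
  "constant_sheaf X r = \<lparr>
     sec = (\<lambda>U. function_module (U \<times> {..<r})
        {s \<in> extensional (U \<times> {..<r}).
           \<forall>x\<in>U. \<exists>V. openin X V \<and> x \<in> V \<and> V \<subseteq> U \<and> (\<forall>y\<in>V. \<forall>j<r. s (y, j) = s (x, j))}),
     res = (\<lambda>U V s. restrict s (V \<times> {..<r}))\<rparr>"

definition local_system :: "'a topology \<Rightarrow> ('a, 's) presheaf \<Rightarrow> bool" where
  "local_system X F \<longleftrightarrow> sheaf X F \<and>
     (\<forall>x\<in>topspace X. \<exists>W r. openin X W \<and> x \<in> W \<and>
        sheaf_isomorphic (subtopology X W) F (constant_sheaf (subtopology X W) r))"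

definition singular_support :: "'a topology \<Rightarrow> ('a, 's) presheaf \<Rightarrow> 'a set" where
  "singular_support X F =
     (LEAST A. finite A \<and> A \<subseteq> topspace X \<and> local_system (subtopology X (topspace X - A)) F)"

text \<open>\<open>R\<^sup>0f\<^sub>*\<close> for \<open>f\<close> continuous on \<open>M\<close>, i.e. the sheaf direct image.\<close>

definition direct_image :: "'a set \<Rightarrow> ('a \<Rightarrow> 'b) \<Rightarrow> ('a, 's) presheaf \<Rightarrow> ('b, 's) presheaf" where
  "direct_image M f F = \<lparr>
     sec = (\<lambda>V. sec F (M \<inter> f -` V)),
     res = (\<lambda>V W. res F (M \<inter> f -` V) (M \<inter> f -` W))\<rparr>"

section \<open>The rank one local system of a character\<close>

definition loop_class :: "'a::topological_space set \<Rightarrow> (real \<Rightarrow> 'a) \<Rightarrow> 'a chain set" where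
  "loop_class M \<gamma> = homologous_rel_set 1 (top_of_set M) {}
     (frag_of (\<lambda>x\<in>standard_simplex 1. \<gamma> (x 1)))"

definition paths_into :: "'a::topological_space set \<Rightarrow> 'a \<Rightarrow> 'a set \<Rightarrow> (real \<Rightarrow> 'a) set" where
  "paths_into M p U = {\<gamma>. path \<gamma> \<and> path_image \<gamma> \<subseteq> M \<and> pathstart \<gamma> = p \<and> pathfinish \<gamma> \<in> U}"

text \<open>The sheaf of flat sections of the line bundle on \<open>M\<close> with monodromy \<open>\<rho>\<close>, obtained as the quotient
  of the universal cover (homotopy classes of paths from the base point \<open>p\<close>) times \<open>\<complex>\<close>: a section over \<open>U\<close>
  is a \<open>\<rho>\<close>-equivariant complex function on the paths from \<open>p\<close> into \<open>U\<close> which does not change when a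
  path is prolonged inside \<open>U\<close>. Equivariance forces dependence on the homotopy class only.\<close>

definition rank_one_system :: "'a::topological_space set \<Rightarrow> 'a \<Rightarrow> ('a chain set \<Rightarrow> complex)
    \<Rightarrow> ('a, (real \<Rightarrow> 'a) \<Rightarrow> complex) presheaf" where
  "rank_one_system M p \<rho> = \<lparr>
     sec = (\<lambda>U. function_module (paths_into M p U)
        {s \<in> extensional (paths_into M p U).
           (\<forall>\<gamma>\<in>paths_into M p U. \<forall>\<gamma>'\<in>paths_into M p U. pathfinish \<gamma> = pathfinish \<gamma>' \<longrightarrow>
              s \<gamma> = \<rho> (loop_class M (\<gamma> +++ reversepath \<gamma>')) * s \<gamma>') \<and>
           (\<forall>\<gamma>\<in>paths_into M p U. \<forall>\<delta>. path \<delta> \<and> path_image \<delta> \<subseteq> U \<and> pathstart \<delta> = pathfinish \<gamma> \<longrightarrow>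
              s (\<gamma> +++ \<delta>) = s \<gamma>)}),
     res = (\<lambda>U V s. restrict s (paths_into M p V))\<rparr>"

text \<open>The support does not depend on the representative, nor on the base point \<open>p\<close>.\<close>

definition character_support :: "'a::topological_space set \<Rightarrow> 'b::topological_space set \<Rightarrow> ('a \<Rightarrow> 'b) \<Rightarrow> 'a set
    \<Rightarrow> 'a \<Rightarrow> ('a chain set set \<Rightarrow> complex) \<Rightarrow> 'b set" where
  "character_support M S f F p \<tau> =
     singular_support (top_of_set S)
       (direct_image M f (rank_one_system M p (SOME \<rho>. representative M S f F \<tau> \<rho>)))"

end

theory Submission
  imports Defs "HOL-Complex_Analysis.Complex_Analysis" "HOL-Computational_Algebra.Fundamental_Theorem_Algebra"
begin

text \<open>Let \<open>\<rho>\<close> represent \<open>\<tau>\<close>; the claim is that \<open>f\<^sub>*L\<^sub>\<rho>\<close> is locally constant on all of \<open>S\<close> if and only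
  if \<open>\<rho>\<close> is trivial on \<open>ker f\<^sub>*\<close>.

  The complement of \<open>U\<close> in the curve \<open>S\<close> is finite: by the identity theorem it is discrete, hence
  countable, and a countable constructible set is finite. Together with the connectedness of the
  generic fibre this makes the part of \<open>M\<close> over a connected open \<open>V\<close> connected. A section of \<open>f\<^sub>*L\<^sub>\<rho>\<close> over
  \<open>V\<close> is an equivariant function on the paths that start at the base point and end over \<open>V\<close>, so a
  nonzero one exists for connected \<open>V\<close> exactly when \<open>\<rho>\<close> is trivial on the cycles over \<open>V\<close>, and then it
  spans. Hence the points near which \<open>f\<^sub>*L\<^sub>\<rho>\<close> is locally constant are those with a neighbourhood over
  which \<open>\<rho>\<close> is trivial; they include \<open>U\<close>, and the remaining ones form the singular support.

  If \<open>\<rho>\<close> is trivial over a neighbourhood of every point of \<open>S\<close>, then it is trivial on \<open>ker f\<^sub>*\<close>: the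
  simplices of a fine subdivision of a 2-chain bounding \<open>f\<^sub>*c\<close> can be lifted edge by edge, and the lift
  of each boundary is a cycle over a small set. Conversely, a cycle over a disc in \<open>S\<close> lies in \<open>ker f\<^sub>*\<close>.

  A representative \<open>\<rho>\<close> exists because the group of nonzero complex numbers is divisible.\<close>

text \<open>The fibre over a point outside \<open>U\<close> may be multiple, so \<open>f\<close>
  need not have local sections there and a 2-simplex of \<open>S\<close> need not lift. This is why
  only edges are lifted, between points of \<open>M\<close> fixed once and for all over the
  vertices, and why chains are compared modulo cycles on which \<rho> is 1. A lifted edge exists
  because the part of \<open>M\<close> over a connected open set is path connected; its choice is
  immaterial over a set where \<rho> is trivial.

  In the other direction, a local system of rank 0 would say nothing about \<rho>. It is excluded
  because every nonempty open subset of the curve meets \<open>U\<close>, where nowhere vanishing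
  sections exist.

  The curve need not be compact, so a discrete subset could be infinite, and analysis alone does not
  give the finiteness of \<open>S - U\<close>. This is the reason for the elimination of
  quantifiers.

  Apart from this finiteness, topology needs only small neighbourhoods that are contractible and
  stay connected when finitely many points are removed, and the fact that fibres have no
  interior.\<close>

hide_const (open) up_ring.coeff up_ring.monom

section \<open>Polynomial functions and the basis theorem\<close>

text \<open>Polynomials are taken as functions, since only their zeros matter. The set
  \<open>A\<close> bounds the variables that may occur, so that an induction on the number of
  variables does not change the type.\<close>

inductive_set polyfuns :: "'i set \<Rightarrow> (('i \<Rightarrow> complex) \<Rightarrow> complex) set" for A where
  const: "(\<lambda>_. c) \<in> polyfuns A"
| var: "i \<in> A \<Longrightarrow> (\<lambda>v. v i) \<in> polyfuns A"
| add: "p \<in> polyfuns A \<Longrightarrow> q \<in> polyfuns A \<Longrightarrow> (\<lambda>v. p v + q v) \<in> polyfuns A"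
| mult: "p \<in> polyfuns A \<Longrightarrow> q \<in> polyfuns A \<Longrightarrow> (\<lambda>v. p v * q v) \<in> polyfuns A"

lemma polyfuns_mono: "p \<in> polyfuns A \<Longrightarrow> A \<subseteq> B \<Longrightarrow> p \<in> polyfuns B"
  by (induction rule: polyfuns.induct) (auto intro: polyfuns.intros)

lemma polyfuns_cong:
  "p \<in> polyfuns A \<Longrightarrow> (\<And>j. j \<in> A \<Longrightarrow> v j = w j) \<Longrightarrow> p v = p w"
  by (induction rule: polyfuns.induct) auto

lemma polyfuns_sum:
  "(\<And>x. x \<in> X \<Longrightarrow> p x \<in> polyfuns A) \<Longrightarrow> (\<lambda>v. \<Sum>x\<in>X. p x v) \<in> polyfuns A"
  by (induction X rule: infinite_finite_induct) (auto intro: polyfuns.intros)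

lemma polyfuns_prod:
  "(\<And>x. x \<in> X \<Longrightarrow> p x \<in> polyfuns A) \<Longrightarrow> (\<lambda>v. \<Prod>x\<in>X. p x v) \<in> polyfuns A"
  by (induction X rule: infinite_finite_induct) (auto intro: polyfuns.intros)

lemma polyfuns_power: "p \<in> polyfuns A \<Longrightarrow> (\<lambda>v. p v ^ n) \<in> polyfuns A"
  by (induction n) (auto intro: polyfuns.intros)

lemma polyfuns_minus: "p \<in> polyfuns A \<Longrightarrow> (\<lambda>v. - p v) \<in> polyfuns A"
  using polyfuns.mult[OF polyfuns.const[of "-1"], of p A] by simp

lemma polyfuns_diff:
  "p \<in> polyfuns A \<Longrightarrow> q \<in> polyfuns A \<Longrightarrow> (\<lambda>v. p v - q v) \<in> polyfuns A"
  using polyfuns.add[of p A "\<lambda>v. - q v"] polyfuns_minus[of q A] by simp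

text \<open>\<open>n\<close> is a formal length: the top coefficients may vanish at some parameters.\<close>

definition poly_family :: "'i set \<Rightarrow> nat \<Rightarrow> (('i \<Rightarrow> complex) \<Rightarrow> complex poly) \<Rightarrow> bool" where
  "poly_family A n P \<longleftrightarrow> (\<forall>v. \<forall>k\<ge>n. coeff (P v) k = 0) \<and> (\<forall>k. (\<lambda>v. coeff (P v) k) \<in> polyfuns A)"

lemma poly_family_coeff: "poly_family A n P \<Longrightarrow> (\<lambda>v. coeff (P v) k) \<in> polyfuns A"
  and poly_family_zero: "poly_family A n P \<Longrightarrow> n \<le> k \<Longrightarrow> coeff (P v) k = 0"
  by (auto simp: poly_family_def)

lemma poly_family_const:
  assumes "p \<in> polyfuns A"
  shows "poly_family A (Suc 0) (\<lambda>v. [:p v:])"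
proof -
  have "(\<lambda>v. coeff [:p v:] k) \<in> polyfuns A" for k
    using assms by (cases k) (auto intro: polyfuns.const)
  then show ?thesis by (auto simp: poly_family_def coeff_pCons split: nat.splits)
qed

lemma poly_family_add:
  assumes "poly_family A n P" "poly_family A m Q"
  shows "poly_family A (max n m) (\<lambda>v. P v + Q v)"
  using assms by (auto simp: poly_family_def intro: polyfuns.intros)

lemma poly_family_diff:
  assumes "poly_family A n P" "poly_family A m Q"
  shows "poly_family A (max n m) (\<lambda>v. P v - Q v)"
  using assms by (auto simp: poly_family_def intro: polyfuns_diff)

lemma poly_family_smult:
  assumes "p \<in> polyfuns A" "poly_family A m Q"
  shows "poly_family A m (\<lambda>v. Polynomial.smult (p v) (Q v))"
  using assms by (auto simp: poly_family_def intro: polyfuns.intros)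

lemma poly_family_mult:
  assumes "poly_family A n P" "poly_family A m Q"
  shows "poly_family A (n + m) (\<lambda>v. P v * Q v)"
proof -
  have "coeff (P v * Q v) k = 0" if "n + m \<le> k" for v k
    unfolding coeff_mult
  proof (intro sum.neutral ballI)
    fix i assume "i \<in> {..k}"
    show "coeff (P v) i * coeff (Q v) (k - i) = 0"
    proof (cases "n \<le> i")
      case True then show ?thesis using assms by (simp add: poly_family_def)
    next
      case False
      then have "m \<le> k - i" using that by simp
      then show ?thesis using assms by (simp add: poly_family_def)
    qed
  qed
  then show ?thesis
    using assms unfolding poly_family_def coeff_mult
    by (auto intro!: polyfuns_sum polyfuns.mult)
qed

lemma poly_family_power:
  assumes "poly_family A n P"
  shows "\<exists>m. poly_family A m (\<lambda>v. P v ^ k)"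
proof (induction k)
  case 0
  show ?case using poly_family_const[OF polyfuns.const[of 1 A]] by (auto simp: one_pCons)
next
  case (Suc k)
  then show ?case using poly_family_mult[OF assms] by auto
qed

lemma poly_family_shift:
  assumes "poly_family A n P"
  shows "poly_family A (n + d) (\<lambda>v. monom 1 d * P v)"
proof -
  have "coeff (monom 1 d * P v) k = (if k < d then 0 else coeff (P v) (k - d))" for v k
    by (simp add: coeff_monom_mult)
  with assms show ?thesis by (auto simp: poly_family_def intro: polyfuns.const)
      (case_tac "k < d"; auto intro: polyfuns.const)
qed

text \<open>For two situations in which the top term is known to vanish: identically, in the basis
  theorem, or on the locus under consideration, in the elimination of quantifiers.\<close>

lemma poly_family_truncate:
  assumes "poly_family A (Suc n) P"
  shows "poly_family A n (\<lambda>v. P v - monom (coeff (P v) n) n)"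
proof -
  have "(\<lambda>v. coeff (P v) k - (if n = k then coeff (P v) n else 0)) \<in> polyfuns A" for k
    using assms by (cases "n = k") (auto simp: poly_family_def intro: polyfuns_diff polyfuns.const)
  then show ?thesis using assms by (auto simp: poly_family_def)
qed

text \<open>One step of pseudo-division: the top coefficients cancel.\<close>

lemma poly_family_pseudo_reduce:
  assumes P: "poly_family A (Suc n) P" and Q: "poly_family A (Suc m) Q" and le: "n \<le> m"
  shows "poly_family A m (\<lambda>v. Polynomial.smult (coeff (P v) n) (Q v)
           - Polynomial.smult (coeff (Q v) m) (monom 1 (m - n) * P v))"
    (is "poly_family A m ?R")
proof -
  have "poly_family A (Suc m) (\<lambda>v. monom 1 (m - n) * P v)"
    using poly_family_shift[OF P, of "m - n"] le by simp
  then have R: "poly_family A (Suc m) ?R"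
    using poly_family_diff[OF poly_family_smult[OF poly_family_coeff[OF P] Q]
        poly_family_smult[OF poly_family_coeff[OF Q]], of "Suc m"] by simp
  moreover have "coeff (?R v) m = 0" for v
    using le by (simp add: coeff_monom_mult)
  ultimately have "coeff (?R v) k = 0" if "m \<le> k" for v k
    using that poly_family_zero[OF R, of k v] by (cases "k = m") auto
  then show ?thesis using poly_family_coeff[OF R] unfolding poly_family_def by blast
qed

text \<open>One variable becomes the unknown and the others become parameters. Both the basis
  theorem and the elimination of a quantifier start from this view.\<close>

lemma polyfuns_insert_imp_family:
  assumes "p \<in> polyfuns (insert i A)"
  shows "\<exists>n P. poly_family A n P \<and> (\<forall>v. p v = poly (P v) (v i))"
  using assms
proof (induction rule: polyfuns.induct)
  case (const c)
  show ?case by (intro exI conjI, rule poly_family_const[OF polyfuns.const[of c]]) auto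
next
  case (var j)
  show ?case
  proof (cases "j = i")
    case True
    have "poly_family A 2 (\<lambda>v. [:0, 1:])"
      by (auto simp: poly_family_def coeff_pCons split: nat.splits intro: polyfuns.intros)
    then show ?thesis using True by force
  next
    case False
    then have "j \<in> A" using var by auto
    then show ?thesis
      by (intro exI conjI, rule_tac poly_family_const[OF polyfuns.var]) auto
  qed
next
  case (add p q)
  then obtain n P m Q where "poly_family A n P" "\<forall>v. p v = poly (P v) (v i)"
     "poly_family A m Q" "\<forall>v. q v = poly (Q v) (v i)" by blast
  then show ?case by (intro exI[of _ "max n m"] exI[of _ "\<lambda>v. P v + Q v"]) (auto intro: poly_family_add)
next
  case (mult p q)
  then obtain n P m Q where "poly_family A n P" "\<forall>v. p v = poly (P v) (v i)"
     "poly_family A m Q" "\<forall>v. q v = poly (Q v) (v i)" by blast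
  then show ?case by (intro exI[of _ "n + m"] exI[of _ "\<lambda>v. P v * Q v"]) (auto intro: poly_family_mult)
qed

section \<open>Ideals of polynomial functions and Hilbert's basis theorem\<close>

definition polyfuns_ideal :: "'i set \<Rightarrow> (('i \<Rightarrow> complex) \<Rightarrow> complex) set \<Rightarrow> bool" where
  "polyfuns_ideal A I \<longleftrightarrow> I \<subseteq> polyfuns A \<and> (\<lambda>_. 0) \<in> I \<and>
     (\<forall>p\<in>I. \<forall>q\<in>I. (\<lambda>v. p v + q v) \<in> I) \<and> (\<forall>r\<in>polyfuns A. \<forall>p\<in>I. (\<lambda>v. r v * p v) \<in> I)"

definition ideal_span where
  "ideal_span A B = {p. \<exists>c. (\<forall>b\<in>B. c b \<in> polyfuns A) \<and> p = (\<lambda>v. \<Sum>b\<in>B. c b v * b v)}"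

lemma ideal_zero: "polyfuns_ideal A I \<Longrightarrow> (\<lambda>_. 0) \<in> I"
  and ideal_add: "polyfuns_ideal A I \<Longrightarrow> p \<in> I \<Longrightarrow> q \<in> I \<Longrightarrow> (\<lambda>v. p v + q v) \<in> I"
  and ideal_mult: "polyfuns_ideal A I \<Longrightarrow> r \<in> polyfuns A \<Longrightarrow> p \<in> I \<Longrightarrow> (\<lambda>v. r v * p v) \<in> I"
  by (auto simp: polyfuns_ideal_def)

lemma ideal_sum:
  assumes "polyfuns_ideal A I" "\<And>x. x \<in> X \<Longrightarrow> p x \<in> I"
  shows "(\<lambda>v. \<Sum>x\<in>X. p x v) \<in> I"
  using assms(2)
  by (induction X rule: infinite_finite_induct) (use assms(1) in \<open>auto simp: polyfuns_ideal_def\<close>)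

lemma ideal_diff:
  assumes I: "polyfuns_ideal A I" and "p \<in> I" "q \<in> I"
  shows "(\<lambda>v. p v - q v) \<in> I"
proof -
  have "(\<lambda>v. p v + (-1) * q v) \<in> I"
    by (rule ideal_add[OF I \<open>p \<in> I\<close> ideal_mult[OF I polyfuns.const \<open>q \<in> I\<close>]])
  then show ?thesis by simp
qed

lemma ideal_span_contains: 
  assumes "finite B" "b \<in> B" 
  shows "b \<in> ideal_span A B"
proof -
  have "b = (\<lambda>v. \<Sum>x\<in>B. (if x = b then 1 else 0) * x v)"
    using assms by (simp add: if_distrib[of "\<lambda>x. x * _"] cong: if_cong)
  then show ?thesis unfolding ideal_span_def mem_Collect_eq
    by (intro exI[of _ "\<lambda>x v. if x = b then 1 else 0"]) (auto intro: polyfuns.const)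
qed

lemma ideal_span_ideal:
  assumes "B \<subseteq> polyfuns A"
  shows "polyfuns_ideal A (ideal_span A B)"
  unfolding polyfuns_ideal_def
proof (intro conjI ballI subsetI)
  fix p assume "p \<in> ideal_span A B"
  then show "p \<in> polyfuns A" using assms
    by (auto simp: ideal_span_def intro!: polyfuns_sum polyfuns.mult)
next
  show "(\<lambda>_. 0) \<in> ideal_span A B"
    unfolding ideal_span_def mem_Collect_eq by (rule exI[of _ "\<lambda>_ _. 0"]) (auto intro: polyfuns.const)
next
  fix p q assume "p \<in> ideal_span A B" "q \<in> ideal_span A B"
  then obtain c d where "\<forall>b\<in>B. c b \<in> polyfuns A" "p = (\<lambda>v. \<Sum>b\<in>B. c b v * b v)"
      "\<forall>b\<in>B. d b \<in> polyfuns A" "q = (\<lambda>v. \<Sum>b\<in>B. d b v * b v)"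
    unfolding ideal_span_def by blast
  then show "(\<lambda>v. p v + q v) \<in> ideal_span A B"
    unfolding ideal_span_def mem_Collect_eq
    by (intro exI[of _ "\<lambda>b v. c b v + d b v"]) (auto simp: sum.distrib algebra_simps intro: polyfuns.add)
next
  fix r p assume "r \<in> polyfuns A" "p \<in> ideal_span A B"
  then obtain c where "\<forall>b\<in>B. c b \<in> polyfuns A" "p = (\<lambda>v. \<Sum>b\<in>B. c b v * b v)"
    unfolding ideal_span_def by blast
  then show "(\<lambda>v. r v * p v) \<in> ideal_span A B" using \<open>r \<in> _\<close>
    unfolding ideal_span_def mem_Collect_eq
    by (intro exI[of _ "\<lambda>b v. r v * c b v"]) (auto simp: sum_distrib_left algebra_simps intro: polyfuns.mult)
qed

text \<open>Without variables the functions are constants, and a field has only the two trivial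
  ideals.\<close>

lemma ideal_polyfuns_empty:
  assumes "polyfuns_ideal {} I"
  shows "\<exists>B. finite B \<and> B \<subseteq> I \<and> I \<subseteq> ideal_span {} B"
proof (cases "\<exists>p\<in>I. \<exists>v. p v \<noteq> 0")
  case False
  then have "I \<subseteq> {\<lambda>_. 0}" by auto
  then have "I \<subseteq> ideal_span {} {}" by (auto simp: ideal_span_def)
  then show ?thesis by blast
next
  case True
  then obtain p v where p: "p \<in> I" "p v \<noteq> 0" by blast
  then have pc: "p w = p v" for w
    using polyfuns_cong[of p "{}" w v] assms by (auto simp: polyfuns_ideal_def)
  have "q \<in> ideal_span {} {p}" if "q \<in> I" for q
  proof -
    have qc: "q w = q v" for w
      using polyfuns_cong[of q "{}" w v] assms that by (auto simp: polyfuns_ideal_def)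
    then have "q = (\<lambda>w. \<Sum>b\<in>{p}. (q v / p v) * b w)"
      using p(2) by (auto simp: fun_eq_iff) (metis pc qc nonzero_mult_div_cancel_right)
    then show ?thesis unfolding ideal_span_def mem_Collect_eq
      by (intro exI[of _ "\<lambda>_ _. q v / p v"]) (auto intro: polyfuns.const)
  qed
  then show ?thesis using p by (intro exI[of _ "{p}"]) auto
qed

text \<open>Lengths being formal, members of lower degree contribute the coefficient 0. This makes
  the set closed under addition; multiplication by the variable \<open>v i\<close> makes it grow
  with \<open>n\<close>.\<close>

definition leading_ideal where
  "leading_ideal A i I n = {a. \<exists>P. poly_family A (Suc n) P \<and> (\<lambda>v. poly (P v) (v i)) \<in> I \<and> a = (\<lambda>v. coeff (P v) n)}"

lemma leading_ideal_ideal: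
  assumes I: "polyfuns_ideal (insert i A) I"
  shows "polyfuns_ideal A (leading_ideal A i I n)"
  unfolding polyfuns_ideal_def
proof (intro conjI ballI subsetI)
  fix p assume "p \<in> leading_ideal A i I n"
  then show "p \<in> polyfuns A" by (auto simp: leading_ideal_def intro: poly_family_coeff)
next
  have "poly_family A (Suc n) (\<lambda>v. 0)" by (auto simp: poly_family_def intro: polyfuns.const)
  then show "(\<lambda>_. 0) \<in> leading_ideal A i I n"
    unfolding leading_ideal_def using I by (auto intro!: exI[of _ "\<lambda>v. 0"] simp: polyfuns_ideal_def)
next
  fix a b assume "a \<in> leading_ideal A i I n" "b \<in> leading_ideal A i I n"
  then obtain P Q where P: "poly_family A (Suc n) P" "(\<lambda>v. poly (P v) (v i)) \<in> I" "a = (\<lambda>v. coeff (P v) n)"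
     and Q: "poly_family A (Suc n) Q" "(\<lambda>v. poly (Q v) (v i)) \<in> I" "b = (\<lambda>v. coeff (Q v) n)"
    by (auto simp: leading_ideal_def)
  have "(\<lambda>v. poly (P v + Q v) (v i)) \<in> I" using P Q I unfolding polyfuns_ideal_def by simp
  then show "(\<lambda>v. a v + b v) \<in> leading_ideal A i I n"
    using poly_family_add[OF P(1) Q(1)] P Q by (auto simp: leading_ideal_def intro!: exI[of _ "\<lambda>v. P v + Q v"])
next
  fix r a assume r: "r \<in> polyfuns A" and "a \<in> leading_ideal A i I n"
  then obtain P where P: "poly_family A (Suc n) P" "(\<lambda>v. poly (P v) (v i)) \<in> I" "a = (\<lambda>v. coeff (P v) n)"
    by (auto simp: leading_ideal_def)
  have "r \<in> polyfuns (insert i A)" using polyfuns_mono[OF r] by auto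
  then have "(\<lambda>v. poly (Polynomial.smult (r v) (P v)) (v i)) \<in> I"
    using P I unfolding polyfuns_ideal_def by simp
  then show "(\<lambda>v. r v * a v) \<in> leading_ideal A i I n"
    using poly_family_smult[OF r P(1)] P by (auto simp: leading_ideal_def intro!: exI[of _ "\<lambda>v. Polynomial.smult (r v) (P v)"])
qed

lemma leading_ideal_mono:
  assumes I: "polyfuns_ideal (insert i A) I" and "n \<le> m"
  shows "leading_ideal A i I n \<subseteq> leading_ideal A i I m"
proof
  fix a assume "a \<in> leading_ideal A i I n"
  then obtain P where P: "poly_family A (Suc n) P" "(\<lambda>v. poly (P v) (v i)) \<in> I" "a = (\<lambda>v. coeff (P v) n)"
    by (auto simp: leading_ideal_def)
  have x: "(\<lambda>v. v i ^ (m - n)) \<in> polyfuns (insert i A)"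
    by (intro polyfuns_power polyfuns.var) auto
  then have "(\<lambda>v. v i ^ (m - n) * poly (P v) (v i)) \<in> I"
    using ideal_mult[OF I x P(2)] by simp
  moreover have "poly_family A (Suc m) (\<lambda>v. monom 1 (m - n) * P v)"
    using poly_family_shift[OF P(1), of "m - n"] \<open>n \<le> m\<close> by simp
  moreover have "a = (\<lambda>v. coeff (monom 1 (m - n) * P v) m)"
    using P(3) \<open>n \<le> m\<close> by (auto simp: coeff_monom_mult)
  ultimately show "a \<in> leading_ideal A i I m"
    unfolding leading_ideal_def mem_Collect_eq
    by (intro exI[of _ "\<lambda>v. monom 1 (m - n) * P v"]) (auto simp: poly_monom)
qed

text \<open>The classical proof by leading coefficients. The ascending chain condition is not a
  separate statement: the induction hypothesis is applied to the union of the leading ideals, and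
  its finitely many generators already lie in a single one of them.\<close>

theorem Hilbert_basis_polyfuns:
  assumes "finite A" "polyfuns_ideal A I"
  shows "\<exists>B. finite B \<and> B \<subseteq> I \<and> I \<subseteq> ideal_span A B"
  using assms
proof (induction A arbitrary: I rule: finite_induct)
  case empty
  then show ?case by (rule ideal_polyfuns_empty)
next
  case (insert i A)
  define L where "L = leading_ideal A i I"
  have L: "polyfuns_ideal A (L n)" for n
    unfolding L_def by (rule leading_ideal_ideal[OF insert.prems])
  have mono: "L n \<subseteq> L m" if "n \<le> m" for n m
    unfolding L_def by (rule leading_ideal_mono[OF insert.prems that])
  have "polyfuns_ideal A (\<Union>n. L n)"
    unfolding polyfuns_ideal_def
  proof (intro conjI ballI)
    fix p q assume "p \<in> (\<Union>n. L n)" "q \<in> (\<Union>n. L n)"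
    then obtain n m where "p \<in> L n" "q \<in> L m" by blast
    then have "p \<in> L (max n m)" "q \<in> L (max n m)"
      using mono[of n "max n m"] mono[of m "max n m"] by auto
    then show "(\<lambda>v. p v + q v) \<in> (\<Union>n. L n)" using ideal_add[OF L] by blast
  next
    fix r p assume "r \<in> polyfuns A" "p \<in> (\<Union>n. L n)"
    then show "(\<lambda>v. r v * p v) \<in> (\<Union>n. L n)" using ideal_mult[OF L] by blast
  next
    show "(\<Union>n. L n) \<subseteq> polyfuns A" using L unfolding polyfuns_ideal_def by blast
  qed (use ideal_zero[OF L] in auto)
  from insert.IH[OF this] obtain B where B: "finite B" "B \<subseteq> (\<Union>n. L n)" "(\<Union>n. L n) \<subseteq> ideal_span A B"
    by blast
  obtain N where N: "B \<subseteq> L N"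
  proof -
    have "\<exists>N. B \<subseteq> L N" using B(1,2)
    proof (induction B rule: finite_induct)
      case (insert b B)
      then obtain n m where "B \<subseteq> L n" "b \<in> L m" by auto
      then have "insert b B \<subseteq> L (max n m)" using mono[of n "max n m"] mono[of m "max n m"] by auto
      then show ?case ..
    qed auto
    then show ?thesis using that by blast
  qed
  have "\<exists>B. finite B \<and> B \<subseteq> L n \<and> L n \<subseteq> ideal_span A B" for n
    using insert.IH[OF L] .
  then obtain C where C: "\<And>n. finite (C n)" "\<And>n. C n \<subseteq> L n" "\<And>n. L n \<subseteq> ideal_span A (C n)" by metis
  have CN: "\<exists>P. poly_family A (Suc n) P \<and> (\<lambda>v. poly (P v) (v i)) \<in> I \<and> a = (\<lambda>v. coeff (P v) n)"
    if "a \<in> L n" for a n using that by (auto simp: L_def leading_ideal_def)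
  define G where "G n a = (SOME P. poly_family A (Suc n) P \<and> (\<lambda>v. poly (P v) (v i)) \<in> I \<and> a = (\<lambda>v. coeff (P v) n))" for n a
  have G: "poly_family A (Suc n) (G n a)" "(\<lambda>v. poly (G n a v) (v i)) \<in> I" "a = (\<lambda>v. coeff (G n a v) n)"
    if "a \<in> L n" for a n
    using someI_ex[OF CN[OF that]] unfolding G_def by blast+
  \<comment> \<open>From \<open>N\<close> on, the one set \<open>B\<close> generates all leading
    ideals, so finitely many lifts suffice.\<close>
  define D where "D n = (if n < N then C n else B)" for n
  have D: "finite (D n)" "D n \<subseteq> L (min n N)" "L n \<subseteq> ideal_span A (D n)" for n
    using B C N by (auto simp: D_def min_def)
  define K where "K = (\<Union>n\<le>N. (\<lambda>a v. poly (G n a v) (v i)) ` D n)"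
  have K: "finite K" "K \<subseteq> I" using D(1) by (auto simp: K_def dest!: subsetD[OF D(2)] intro!: G(2))
  have "K \<subseteq> polyfuns (insert i A)" using K insert.prems by (auto simp: polyfuns_ideal_def)
  then have spanK: "polyfuns_ideal (insert i A) (ideal_span (insert i A) K)" by (rule ideal_span_ideal)
  have main: "(\<lambda>v. poly (P v) (v i)) \<in> ideal_span (insert i A) K"
    if "poly_family A n P" "(\<lambda>v. poly (P v) (v i)) \<in> I" for n P
    using that
  proof (induction n arbitrary: P)
    case 0
    then have "P v = 0" for v by (auto simp: poly_family_def intro: poly_eqI)
    then show ?case using spanK by (simp add: polyfuns_ideal_def)
  next
    case (Suc n)
    have "(\<lambda>v. coeff (P v) n) \<in> L n" using Suc.prems by (auto simp: L_def leading_ideal_def)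
    then obtain c where c: "\<forall>b\<in>D n. c b \<in> polyfuns A" "(\<lambda>v. coeff (P v) n) = (\<lambda>v. \<Sum>b\<in>D n. c b v * b v)"
      using D(3)[of n] unfolding ideal_span_def by blast
    \<comment> \<open>The generators used in length \<open>n\<close> were lifted in length
      \<open>k\<close>; the power \<open>n - k\<close> of the variable moves their leading
      coefficients up to place \<open>n\<close>.\<close>
    define k where "k = min n N"
    have k: "k \<le> n" "k \<le> N" "D n = D k" by (auto simp: k_def D_def min_def)
    have DL: "b \<in> L k" if "b \<in> D n" for b using D(2)[of n] that by (auto simp: k_def)
    define T where "T b v = Polynomial.smult (c b v) (monom 1 (n - k) * G k b v)" for b v
    have T: "poly_family A (Suc n) (T b)" if "b \<in> D n" for b
      unfolding T_def using poly_family_smult[OF _ poly_family_shift[OF G(1)[OF DL[OF that]], of "n - k"]] c that k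
      by auto
    have topT: "coeff (T b v) n = c b v * b v" if "b \<in> D n" for b v
      using fun_cong[OF G(3)[OF DL[OF that]], of v] k by (simp add: T_def coeff_monom_mult)
    have "poly_family A (Suc n) (\<lambda>v. \<Sum>b\<in>D n. T b v)"
      using T by (auto simp: poly_family_def coeff_sum intro!: polyfuns_sum)
    then have Q': "poly_family A (Suc n) (\<lambda>v. P v - (\<Sum>b\<in>D n. T b v))"
      using poly_family_diff[OF Suc.prems(1)] by fastforce
    have "coeff (P v - (\<Sum>b\<in>D n. T b v)) n = 0" for v
      using fun_cong[OF c(2), of v] topT by (simp add: coeff_sum)
    then have Q: "poly_family A n (\<lambda>v. P v - (\<Sum>b\<in>D n. T b v))"
      using poly_family_truncate[OF Q'] by (simp only: monom_0 diff_zero) simp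
    have TK: "(\<lambda>v. poly (T b v) (v i)) \<in> ideal_span (insert i A) K" if "b \<in> D n" for b
    proof -
      have "(\<lambda>v. poly (G k b v) (v i)) \<in> K" using that k unfolding K_def by auto
      then have "(\<lambda>v. poly (G k b v) (v i)) \<in> ideal_span (insert i A) K"
        by (rule ideal_span_contains[OF K(1)])
      moreover have "(\<lambda>v. c b v * v i ^ (n - k)) \<in> polyfuns (insert i A)"
        using c(1) that by (intro polyfuns.mult polyfuns_power polyfuns.var polyfuns_mono[where B="insert i A"]) auto
      ultimately have "(\<lambda>v. (c b v * v i ^ (n - k)) * poly (G k b v) (v i)) \<in> ideal_span (insert i A) K"
        by (intro ideal_mult[OF spanK])
      then show ?thesis by (simp add: T_def poly_monom mult.assoc)
    qed
    have "ideal_span (insert i A) K \<subseteq> I"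
    proof
      fix p assume "p \<in> ideal_span (insert i A) K"
      then show "p \<in> I" unfolding ideal_span_def using K(2) insert.prems
        by (auto simp: polyfuns_ideal_def intro!: ideal_sum[OF insert.prems])
    qed
    then have sT: "(\<lambda>v. \<Sum>b\<in>D n. poly (T b v) (v i)) \<in> I"
      using TK by (intro ideal_sum[OF insert.prems]) auto
    have "(\<lambda>v. poly (P v - (\<Sum>b\<in>D n. T b v)) (v i)) \<in> I"
      using ideal_diff[OF insert.prems Suc.prems(2) sT] by (simp add: poly_sum)
    from Suc.IH[OF Q this]
    have 1: "(\<lambda>v. poly (P v - (\<Sum>b\<in>D n. T b v)) (v i)) \<in> ideal_span (insert i A) K" .
    have 2: "(\<lambda>v. \<Sum>b\<in>D n. poly (T b v) (v i)) \<in> ideal_span (insert i A) K"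
      by (intro ideal_sum[OF spanK] TK)
    have "(\<lambda>v. poly (P v - (\<Sum>b\<in>D n. T b v)) (v i) + (\<Sum>b\<in>D n. poly (T b v) (v i))) \<in> ideal_span (insert i A) K"
      by (rule ideal_add[OF spanK 1 2])
    then show ?case by (simp add: poly_sum)
  qed
  have "I \<subseteq> ideal_span (insert i A) K"
  proof
    fix p assume p: "p \<in> I"
    then have p': "p \<in> polyfuns (insert i A)" using insert.prems by (auto simp: polyfuns_ideal_def)
    obtain n P where P: "poly_family A n P" "\<forall>v. p v = poly (P v) (v i)"
      using polyfuns_insert_imp_family[OF p'] by blast
    from P(2) have "p = (\<lambda>v. poly (P v) (v i))" by auto
    with main[OF P(1)] p show "p \<in> ideal_span (insert i A) K" by simp
  qed
  with K show ?case by blast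
qed

text \<open>Zariski closed sets are given by arbitrary families of equations, constructible sets by
  finitely many operations. The functions that vanish wherever some finite subfamily does form an
  ideal, and each of its finitely many generators costs finitely many equations.\<close>

corollary finite_subfamily_same_zeros:
  fixes \<P> :: "(('i::finite \<Rightarrow> complex) \<Rightarrow> complex) set"
  assumes "\<P> \<subseteq> polyfuns UNIV"
  obtains \<Q> where "finite \<Q>" "\<Q> \<subseteq> \<P>" "\<And>v. (\<forall>p\<in>\<Q>. p v = 0) \<longleftrightarrow> (\<forall>p\<in>\<P>. p v = 0)"
proof -
  define I where "I = {p \<in> polyfuns UNIV. \<exists>\<Q>. finite \<Q> \<and> \<Q> \<subseteq> \<P> \<and> (\<forall>v. (\<forall>q\<in>\<Q>. q v = 0) \<longrightarrow> p v = 0)}"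
  have "polyfuns_ideal UNIV I"
    unfolding polyfuns_ideal_def
  proof (intro conjI ballI)
    fix p q assume "p \<in> I" "q \<in> I"
    then obtain X Y where "finite X" "X \<subseteq> \<P>" "\<forall>v. (\<forall>q\<in>X. q v = 0) \<longrightarrow> p v = 0"
      "finite Y" "Y \<subseteq> \<P>" "\<forall>v. (\<forall>q\<in>Y. q v = 0) \<longrightarrow> q v = 0" "p \<in> polyfuns UNIV" "q \<in> polyfuns UNIV"
      by (auto simp: I_def)
    then show "(\<lambda>v. p v + q v) \<in> I"
      unfolding I_def by (auto intro!: exI[of _ "X \<union> Y"] polyfuns.add)
  next
    show "(\<lambda>_. 0) \<in> I" unfolding I_def by (auto intro!: exI[of _ "{}"] polyfuns.const)
  qed (auto simp: I_def intro!: polyfuns.mult)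
  then obtain B where B: "finite B" "B \<subseteq> I" "I \<subseteq> ideal_span UNIV B"
    using Hilbert_basis_polyfuns[of UNIV I] by auto
  then have "\<forall>b\<in>B. \<exists>\<Q>. finite \<Q> \<and> \<Q> \<subseteq> \<P> \<and> (\<forall>v. (\<forall>q\<in>\<Q>. q v = 0) \<longrightarrow> b v = 0)"
    by (auto simp: I_def)
  then obtain Q where Q: "\<And>b. b \<in> B \<Longrightarrow> finite (Q b) \<and> Q b \<subseteq> \<P> \<and> (\<forall>v. (\<forall>q\<in>Q b. q v = 0) \<longrightarrow> b v = 0)" by metis
  have "\<P> \<subseteq> I" using assms by (auto simp: I_def intro!: exI[of _ "{_}"])
  show ?thesis
  proof
    show "finite (\<Union>(Q ` B))" "\<Union>(Q ` B) \<subseteq> \<P>" using B Q by auto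
    fix v show "(\<forall>p\<in>\<Union> (Q ` B). p v = 0) \<longleftrightarrow> (\<forall>p\<in>\<P>. p v = 0)"
    proof
      assume "\<forall>p\<in>\<Union> (Q ` B). p v = 0"
      then have b: "\<forall>b\<in>B. b v = 0" using Q by blast
      show "\<forall>p\<in>\<P>. p v = 0"
      proof
        fix p assume "p \<in> \<P>"
        then have "p \<in> ideal_span UNIV B" using B(3) \<open>\<P> \<subseteq> I\<close> by auto
        then show "p v = 0" using b by (auto simp: ideal_span_def intro!: sum.neutral)
      qed
    qed (use Q in blast)
  qed
qed

section \<open>Elimination of quantifiers\<close>

inductive_set constructibles :: "('i \<Rightarrow> complex) set set" where
  zeros: "p \<in> polyfuns UNIV \<Longrightarrow> {v. p v = 0} \<in> constructibles"
| compl: "D \<in> constructibles \<Longrightarrow> - D \<in> constructibles"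
| Int: "D \<in> constructibles \<Longrightarrow> E \<in> constructibles \<Longrightarrow> D \<inter> E \<in> constructibles"

lemma constructibles_Un:
  assumes "D \<in> constructibles" "E \<in> constructibles" shows "D \<union> E \<in> constructibles"
proof -
  have "D \<union> E = - (- D \<inter> - E)" by auto
  then show ?thesis using constructibles.compl constructibles.Int assms by metis
qed

lemma constructibles_UNIV: "UNIV \<in> constructibles"
  using constructibles.zeros[OF polyfuns.const[of 0]] by simp

lemma constructibles_empty: "{} \<in> constructibles"
  using constructibles.compl[OF constructibles_UNIV] by simp

lemma constructibles_INT:
  "finite X \<Longrightarrow> (\<And>x. x \<in> X \<Longrightarrow> D x \<in> constructibles) \<Longrightarrow> (\<Inter>x\<in>X. D x) \<in> constructibles"
  by (induction X rule: finite_induct) (auto intro: constructibles.intros constructibles_UNIV)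

lemma constructibles_UN:
  "finite X \<Longrightarrow> (\<And>x. x \<in> X \<Longrightarrow> D x \<in> constructibles) \<Longrightarrow> (\<Union>x\<in>X. D x) \<in> constructibles"
  by (induction X rule: finite_induct) (auto intro: constructibles_Un constructibles_empty)

lemma constructibles_family_zero:
  assumes "poly_family UNIV n P"
  shows "{v. P v = 0} \<in> constructibles"
proof -
  have "{v. P v = 0} = (\<Inter>k<n. {v. coeff (P v) k = 0})"
    using poly_family_zero[OF assms] by (auto simp: poly_eq_iff) (metis lessThan_iff not_le)
  also have "\<dots> \<in> constructibles"
    by (intro constructibles_INT constructibles.zeros poly_family_coeff[OF assms]) auto
  finally show ?thesis .
qed

text \<open>Where the coefficient of index \<open>n\<close> is nonzero, \<open>P v\<close> has
  degree exactly \<open>n\<close>. A pseudo-division step then shortens \<open>Q\<close> without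
  affecting divisibility; once \<open>Q\<close> is too short, divisibility means that it
  vanishes.\<close>

lemma constructibles_family_not_dvd:
  assumes P: "poly_family UNIV (Suc n) P" and Q: "poly_family UNIV m Q"
  shows "{v. coeff (P v) n \<noteq> 0 \<and> \<not> P v dvd Q v} \<in> constructibles"
  using Q
proof (induction m arbitrary: Q)
  case 0
  then have "Q v = 0" for v by (auto simp: poly_family_def intro: poly_eqI)
  then show ?case by (simp add: constructibles_empty)
next
  case (Suc m)
  have lead: "{v. coeff (P v) n \<noteq> 0} \<in> constructibles"
    using constructibles.compl[OF constructibles.zeros[OF poly_family_coeff[OF P, of n]]]
    by (simp add: Collect_neg_eq)
  have deg: "degree (P v) = n" if "coeff (P v) n \<noteq> 0" for v
    using that P by (intro antisym degree_le le_degree) (auto simp: poly_family_def)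
  show ?case
  proof (cases "n \<le> m")
    case True
    define R where "R v = Polynomial.smult (coeff (P v) n) (Q v) - Polynomial.smult (coeff (Q v) m) (monom 1 (m - n) * P v)" for v
    have "poly_family UNIV m R"
      unfolding R_def by (rule poly_family_pseudo_reduce[OF P Suc.prems True])
    moreover have "P v dvd R v \<longleftrightarrow> P v dvd Q v" if "coeff (P v) n \<noteq> 0" for v
    proof -
      have "P v dvd Polynomial.smult (coeff (Q v) m) (monom 1 (m - n) * P v)" by (simp add: dvd_smult)
      then have "P v dvd R v \<longleftrightarrow> P v dvd Polynomial.smult (coeff (P v) n) (Q v)"
        unfolding R_def by (metis diff_add_cancel dvd_add dvd_diff)
      then show ?thesis using that by (simp add: dvd_smult_iff)
    qed
    ultimately show ?thesis using Suc.IH[of R] by (auto cong: conj_cong)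
  next
    case False
    have "P v dvd Q v \<longleftrightarrow> Q v = 0" if "coeff (P v) n \<noteq> 0" for v
    proof
      assume "P v dvd Q v"
      show "Q v = 0"
      proof (rule ccontr)
        assume "Q v \<noteq> 0"
        then have "n \<le> degree (Q v)" using dvd_imp_degree_le[OF \<open>P v dvd Q v\<close>] deg that by simp
        moreover have "coeff (Q v) (degree (Q v)) = 0"
          using poly_family_zero[OF Suc.prems, of "degree (Q v)"] \<open>n \<le> degree _\<close> False by simp
        ultimately show False using \<open>Q v \<noteq> 0\<close> by simp
      qed
    qed auto
    then have "{v. coeff (P v) n \<noteq> 0 \<and> \<not> P v dvd Q v} = {v. coeff (P v) n \<noteq> 0} \<inter> - {v. Q v = 0}" by auto
    then show ?thesis
      using lead constructibles_family_zero[OF Suc.prems] by (auto intro: constructibles.intros)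
  qed
qed

section \<open>Systems with parameters in one unknown\<close>

definition solvable :: "(('i \<Rightarrow> complex) \<Rightarrow> complex poly) set \<Rightarrow> (('i \<Rightarrow> complex) \<Rightarrow> complex poly) \<Rightarrow> ('i \<Rightarrow> complex) set" where
  "solvable \<P> Q = {v. \<exists>x. (\<forall>P\<in>\<P>. poly (P v) x = 0) \<and> poly (Q v) x \<noteq> 0}"

text \<open>Over the complex numbers, each root of a polynomial of degree \<open>n\<close> is a root
  of a second one exactly when the first divides the \<open>n\<close>-th power of the second.
  Solvability is the negation of this.\<close>

lemma solvable_single:
  assumes P: "poly_family UNIV (Suc n) P" and Q: "poly_family UNIV m Q"
  shows "{v. coeff (P v) n \<noteq> 0} \<inter> solvable {P} Q \<in> constructibles"
proof -
  obtain k where k: "poly_family UNIV k (\<lambda>v. Q v ^ n)" using poly_family_power[OF Q] by blast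
  have "v \<in> solvable {P} Q \<longleftrightarrow> \<not> P v dvd Q v ^ n" if "coeff (P v) n \<noteq> 0" for v
  proof -
    have "degree (P v) = n"
      using that P by (intro antisym degree_le le_degree) (auto simp: poly_family_def)
    then show ?thesis using that nullstellensatz_univariate[of "P v" "Q v"]
      by (auto simp: solvable_def)
  qed
  then have "{v. coeff (P v) n \<noteq> 0} \<inter> solvable {P} Q = {v. coeff (P v) n \<noteq> 0 \<and> \<not> P v dvd Q v ^ n}"
    by auto
  then show ?thesis using constructibles_family_not_dvd[OF P k] by simp
qed

text \<open>Euclid's algorithm with a case distinction on the leading coefficient at every step.
  Where it vanishes, the equation is truncated; where it does not, a shorter equation reduces a
  longer one without changing the common zeros. A single remaining equation is settled by
  \<open>solvable_single\<close>.\<close>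

lemma solvable_constructible:
  assumes "\<And>n P. (n, P) \<in> set ps \<Longrightarrow> poly_family UNIV n P" "poly_family UNIV m Q"
  shows "solvable (snd ` set ps) Q \<in> constructibles"
  using assms(1)
\<comment> \<open>The \<open>Suc\<close> makes the removal of an equation of length 0 count as
  progress.\<close>
proof (induction "\<Sum>p\<leftarrow>ps. Suc (fst p)" arbitrary: ps rule: less_induct)
  case less
  have split: "solvable (insert P \<P>) Q =
      ({v. coeff (P v) n \<noteq> 0} \<inter> solvable (insert P \<P>) Q) \<union>
      ({v. coeff (P v) n = 0} \<inter> solvable (insert (\<lambda>v. P v - monom (coeff (P v) n) n) \<P>) Q)" for P \<P> n
    by (auto simp: solvable_def)
  show ?case
  proof (cases "\<exists>P. (0, P) \<in> set ps")
    case True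
    then obtain P as bs where ps: "ps = as @ (0, P) # bs" by (meson split_list)
    have "solvable (snd ` set (as @ bs)) Q \<in> constructibles"
      by (rule less.hyps) (use ps less.prems in auto)
    moreover have "P v = 0" for v
      using less.prems[of 0 P] ps by (auto simp: poly_family_def intro: poly_eqI)
    ultimately show ?thesis by (simp add: ps solvable_def)
  next
    case nz: False
    show ?thesis
    proof (cases ps)
      case Nil
      have "solvable {} Q = - {v. Q v = 0}"
        by (auto simp: solvable_def) (metis poly_all_0_iff_0)
      then show ?thesis using constructibles_family_zero[OF assms(2)] Nil
        by (auto intro: constructibles.intros)
    next
      case (Cons a rest)
      obtain n P where a: "a = (Suc n, P)" using nz Cons by (cases a; case_tac "fst a") auto
      have P: "poly_family UNIV (Suc n) P" using less.prems Cons a by auto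
      \<comment> \<open>The branch of the vanishing coefficient. Comparing multisets allows any
        equation of the list to be the truncated one.\<close>
      have drop: "{v. coeff (P' v) k = 0} \<inter> solvable (insert (\<lambda>v. P' v - monom (coeff (P' v) k) k) (snd ` set qs)) Q \<in> constructibles"
        if "mset ps = mset ((Suc k, P') # qs)" for k P' qs
      proof -
        have st: "set ps = insert (Suc k, P') (set qs)" using that by (metis list.simps(15) set_mset_mset)
        have P': "poly_family UNIV (Suc k) P'" using less.prems st by auto
        have "(\<Sum>p\<leftarrow>ps. Suc (fst p)) = sum_mset (image_mset (\<lambda>p. Suc (fst p)) (mset ps))"
          by (metis mset_map sum_mset_sum_list)
        also have "\<dots> = Suc (Suc k) + (\<Sum>p\<leftarrow>qs. Suc (fst p))"
          unfolding that by simp (metis mset_map sum_mset_sum_list)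
        finally have sm: "(\<Sum>p\<leftarrow>ps. Suc (fst p)) = Suc (Suc k) + (\<Sum>p\<leftarrow>qs. Suc (fst p))" .
        have "solvable (snd ` set ((k, \<lambda>v. P' v - monom (coeff (P' v) k) k) # qs)) Q \<in> constructibles"
          by (rule less.hyps) (use sm less.prems st poly_family_truncate[OF P'] in auto)
        then show ?thesis
          using constructibles.zeros[OF poly_family_coeff[OF P', of k]] by (auto intro: constructibles.Int)
      qed
      show ?thesis
      proof (cases rest)
        case Nil
        have "snd ` set ps = insert P {}" using Cons a Nil by simp
        moreover have "solvable {P} Q \<in> constructibles"
          using drop[of n P "[]"] Cons a Nil
          by (subst split[of P "{}" n], intro constructibles_Un solvable_single[OF P assms(2)]) simp
        ultimately show ?thesis by simp
      next
        case (Cons b rest')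
        obtain m' R where b: "b = (Suc m', R)" using nz Cons \<open>ps = a # rest\<close> by (cases b; case_tac "fst b") auto
        have ps: "ps = (Suc n, P) # (Suc m', R) # rest'" using \<open>ps = a # rest\<close> a b Cons by simp
        have reduce: "solvable (insert P1 (insert R1 (snd ` set rest'))) Q \<in> constructibles"
          if le: "k \<le> l" and ms: "mset ps = mset ((Suc k, P1) # (Suc l, R1) # rest')" for k l P1 R1
        proof -
          have st: "set ps = insert (Suc k, P1) (insert (Suc l, R1) (set rest'))"
            using ms by (metis list.simps(15) set_mset_mset)
          have P1: "poly_family UNIV (Suc k) P1" and R1: "poly_family UNIV (Suc l) R1" using less.prems st by auto
          define T where "T v = Polynomial.smult (coeff (P1 v) k) (R1 v) - Polynomial.smult (coeff (R1 v) l) (monom 1 (l - k) * P1 v)" for v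
          have T: "poly_family UNIV l T"
            unfolding T_def by (rule poly_family_pseudo_reduce[OF P1 R1 le])
          have "(\<Sum>p\<leftarrow>ps. Suc (fst p)) = sum_mset (image_mset (\<lambda>p. Suc (fst p)) (mset ps))"
            by (metis mset_map sum_mset_sum_list)
          also have "\<dots> = Suc (Suc k) + Suc (Suc l) + (\<Sum>p\<leftarrow>rest'. Suc (fst p))"
            unfolding ms by simp (metis mset_map sum_mset_sum_list)
          finally have sm: "(\<Sum>p\<leftarrow>ps. Suc (fst p)) = Suc (Suc k) + Suc (Suc l) + (\<Sum>p\<leftarrow>rest'. Suc (fst p))" .
          have 1: "solvable (snd ` set ((Suc k, P1) # (l, T) # rest')) Q \<in> constructibles"
            by (rule less.hyps) (use sm less.prems st T in auto)
          have "{v. coeff (P1 v) k \<noteq> 0} \<inter> solvable (insert P1 (insert R1 (snd ` set rest'))) Q =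
             {v. coeff (P1 v) k \<noteq> 0} \<inter> solvable (snd ` set ((Suc k, P1) # (l, T) # rest')) Q"
            by (auto simp: solvable_def T_def)
          also have "\<dots> \<in> constructibles"
            using constructibles.compl[OF constructibles.zeros[OF poly_family_coeff[OF P1, of k]]] 1
            by (auto simp: Collect_neg_eq intro: constructibles.Int)
          finally show ?thesis
            using drop[of k P1 "(Suc l, R1) # rest'"] ms
            by (subst split[of P1 "insert R1 (snd ` set rest')" k], intro constructibles_Un) simp_all
        qed
        show ?thesis
        proof (cases "n \<le> m'")
          case True
          then show ?thesis using reduce[of n m' P R] ps by simp
        next
          case False
          then show ?thesis using reduce[of m' n R P] ps by (simp add: insert_commute add_mset_commute)
        qed
      qed
    qed
  qed
qed

text \<open>A single inequation is general enough, as several are combined by multiplying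
  them.\<close>

definition basic_constructible :: "('i \<Rightarrow> complex) set \<Rightarrow> bool" where
  "basic_constructible D \<longleftrightarrow> (\<exists>\<P> q. finite \<P> \<and> \<P> \<subseteq> polyfuns UNIV \<and> q \<in> polyfuns UNIV \<and>
     D = {v. (\<forall>p\<in>\<P>. p v = 0) \<and> q v \<noteq> 0})"

definition basic_union :: "('i \<Rightarrow> complex) set \<Rightarrow> bool" where
  "basic_union D \<longleftrightarrow> (\<exists>\<D>. finite \<D> \<and> (\<forall>E\<in>\<D>. basic_constructible E) \<and> D = \<Union>\<D>)"

lemma basic_constructible_Int:
  assumes "basic_constructible D" "basic_constructible E" shows "basic_constructible (D \<inter> E)"
proof -
  obtain \<P> q \<R> r where "finite \<P>" "\<P> \<subseteq> polyfuns UNIV" "q \<in> polyfuns UNIV" "D = {v. (\<forall>p\<in>\<P>. p v = 0) \<and> q v \<noteq> 0}"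
    "finite \<R>" "\<R> \<subseteq> polyfuns UNIV" "r \<in> polyfuns UNIV" "E = {v. (\<forall>p\<in>\<R>. p v = 0) \<and> r v \<noteq> 0}"
    using assms unfolding basic_constructible_def by blast
  then show ?thesis unfolding basic_constructible_def
    by (intro exI[of _ "\<P> \<union> \<R>"] exI[of _ "\<lambda>v. q v * r v"]) (auto intro: polyfuns.mult)
qed

lemma basic_union_Un: "basic_union D \<Longrightarrow> basic_union E \<Longrightarrow> basic_union (D \<union> E)"
  unfolding basic_union_def by (elim exE, rename_tac X Y, rule_tac x="X \<union> Y" in exI) auto

lemma basic_union_Int:
  assumes "basic_union D" "basic_union E" shows "basic_union (D \<inter> E)"
proof -
  obtain X Y where "finite X" "\<forall>E\<in>X. basic_constructible E" "D = \<Union>X"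
     "finite Y" "\<forall>E\<in>Y. basic_constructible E" "E = \<Union>Y"
    using assms unfolding basic_union_def by blast
  then show ?thesis unfolding basic_union_def
    by (intro exI[of _ "(\<lambda>(a, b). a \<inter> b) ` (X \<times> Y)"]) (auto intro: basic_constructible_Int)
qed

lemma basic_constructible_imp_union: "basic_constructible D \<Longrightarrow> basic_union D"
  unfolding basic_union_def by (rule exI[of _ "{D}"]) auto

text \<open>The complement is carried along because complementation is one of the generating
  operations and a union of basic sets gives no direct access to it.\<close>

lemma constructible_imp_basic_union:
  assumes "D \<in> constructibles" shows "basic_union D \<and> basic_union (- D)"
  using assms
proof induction
  case (zeros p)
  have "basic_constructible {v. p v = 0}"
    using zeros unfolding basic_constructible_def
    by (intro exI[of _ "{p}"] exI[of _ "\<lambda>_. 1"]) (auto intro: polyfuns.const)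
  moreover have "basic_constructible (- {v. p v = 0})"
    using zeros unfolding basic_constructible_def
    by (intro exI[of _ "{}"] exI[of _ p]) auto
  ultimately show ?case by (auto intro: basic_constructible_imp_union)
qed (auto simp: Compl_Int intro: basic_union_Un basic_union_Int)

text \<open>The quantifier commutes with unions, so it is enough to treat a basic set, which is a
  system in the unknown \<open>t\<close>. The projection is kept as a cylinder in direction
  \<open>i\<close>; the index type stays the same.\<close>

lemma constructibles_ex:
  assumes "D \<in> constructibles"
  shows "{v. \<exists>t. v(i := t) \<in> D} \<in> constructibles"
proof -
  obtain \<D> where \<D>: "finite \<D>" "\<forall>E\<in>\<D>. basic_constructible E" "D = \<Union>\<D>"
    using constructible_imp_basic_union[OF assms] unfolding basic_union_def by blast
  have "{v. \<exists>t. v(i := t) \<in> E} \<in> constructibles" if "E \<in> \<D>" for E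
  proof -
    have "basic_constructible E" using \<D>(2) that by blast
    then obtain \<P> q where E: "finite \<P>" "\<P> \<subseteq> polyfuns UNIV" "q \<in> polyfuns UNIV"
       "E = {v. (\<forall>p\<in>\<P>. p v = 0) \<and> q v \<noteq> 0}"
      unfolding basic_constructible_def by blast
    have "\<exists>n P. poly_family UNIV n P \<and> (\<forall>v t. p (v(i := t)) = poly (P v) t)" if "p \<in> polyfuns UNIV" for p
    proof -
      have "p \<in> polyfuns (insert i (UNIV - {i}))" using that by (simp add: insert_UNIV)
      from polyfuns_insert_imp_family[OF this] obtain n P where P: "poly_family (UNIV - {i}) n P" "\<forall>v. p v = poly (P v) (v i)"
        by blast
      have "P (v(i := t)) = P v" for v t
        by (rule poly_eqI) (rule polyfuns_cong[OF poly_family_coeff[OF P(1)]], auto)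
      then have "p (v(i := t)) = poly (P v) t" for v t using P(2) by simp
      moreover have "poly_family UNIV n P"
        using P(1) unfolding poly_family_def by (auto intro: polyfuns_mono)
      ultimately show ?thesis by blast
    qed
    then obtain n P where P: "\<And>p. p \<in> polyfuns UNIV \<Longrightarrow> poly_family UNIV (n p) (P p)"
       "\<And>p v t. p \<in> polyfuns UNIV \<Longrightarrow> p (v(i := t)) = poly (P p v) t" by metis
    obtain ps where ps: "set ps = \<P>" using E(1) finite_list by blast
    have "{v. \<exists>t. v(i := t) \<in> E} = solvable (snd ` set (map (\<lambda>p. (n p, P p)) ps)) (P q)"
      using E P(2) ps by (auto simp: solvable_def subset_iff)
    also have "\<dots> \<in> constructibles"
      by (rule solvable_constructible[OF _ P(1)[OF E(3)]]) (use ps E P in auto)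
    finally show ?thesis .
  qed
  then have "(\<Union>E\<in>\<D>. {v. \<exists>t. v(i := t) \<in> E}) \<in> constructibles"
    using \<D>(1) by (intro constructibles_UN) auto
  also have "(\<Union>E\<in>\<D>. {v. \<exists>t. v(i := t) \<in> E}) = {v. \<exists>t. v(i := t) \<in> D}" using \<D>(3) by auto
  finally show ?thesis .
qed

lemma constructibles_ex_set:
  assumes "finite A" "D \<in> constructibles"
  shows "{v. \<exists>w\<in>D. \<forall>j. j \<notin> A \<longrightarrow> v j = w j} \<in> constructibles"
  using assms(1)
proof (induction A rule: finite_induct)
  case empty
  have "{v. \<exists>w\<in>D. \<forall>j. j \<notin> {} \<longrightarrow> v j = w j} = D" by (auto simp: fun_eq_iff[symmetric])
  then show ?case using assms by simp
next
  case (insert i A)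
  have "{v. \<exists>w\<in>D. \<forall>j. j \<notin> insert i A \<longrightarrow> v j = w j} = {v. \<exists>t. v(i := t) \<in> {v. \<exists>w\<in>D. \<forall>j. j \<notin> A \<longrightarrow> v j = w j}}"
    (is "?L = ?R")
  proof (rule Set.set_eqI)
    fix v
    have "v \<in> ?L" if "v \<in> ?R"
      using that by (auto split: if_splits)
    moreover have "v \<in> ?R" if L: "v \<in> ?L"
    proof -
      obtain w where "w \<in> D" "\<forall>j. j \<notin> insert i A \<longrightarrow> v j = w j" using L by blast
      then have "v(i := w i) \<in> {v. \<exists>w\<in>D. \<forall>j. j \<notin> A \<longrightarrow> v j = w j}" by (auto intro!: bexI[of _ w])
      then show ?thesis by blast
    qed
    ultimately show "v \<in> ?L \<longleftrightarrow> v \<in> ?R" by blast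
  qed
  then show ?case using constructibles_ex[OF insert.IH] by simp
qed

lemma polyfuns_line:
  assumes "p \<in> polyfuns UNIV" shows "\<exists>P. \<forall>t. p (v(i := t)) = poly P t"
proof -
  have "p \<in> polyfuns (insert i (UNIV - {i}))" using assms by (simp add: insert_UNIV)
  from polyfuns_insert_imp_family[OF this] obtain n P where P: "poly_family (UNIV - {i}) n P" "\<forall>v. p v = poly (P v) (v i)"
    by blast
  have "P (v(i := t)) = P v" for t
    by (rule poly_eqI) (rule polyfuns_cong[OF poly_family_coeff[OF P(1)]], auto)
  then show ?thesis using P(2) by auto
qed

text \<open>On a line a polynomial vanishes identically or has finitely many zeros, and being finite
  or cofinite survives the Boolean operations.\<close>

lemma constructible_line:
  assumes "D \<in> constructibles"
  shows "finite {t. v(i := t) \<in> D} \<or> finite (- {t. v(i := t) \<in> D})"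
  using assms
proof induction
  case (zeros p)
  obtain P where P: "\<forall>t. p (v(i := t)) = poly P t" using polyfuns_line[OF zeros] by blast
  show ?case using poly_roots_finite[of P] by (cases "P = 0") (auto simp: P simp del: fun_upd_apply)
next
  case (compl D)
  then show ?case by (auto simp: Compl_eq)
next
  case (Int D E)
  have "{t. v(i := t) \<in> D \<inter> E} = {t. v(i := t) \<in> D} \<inter> {t. v(i := t) \<in> E}" by blast
  then show ?case using Int.IH by (metis Compl_Int finite_Int finite_UnI)
qed

text \<open>Each coordinate projection is a constructible subset of the line, hence finite or cofinite, and
  the complement of a countable set of complex numbers is infinite.\<close>

theorem countable_constructible_finite:
  fixes D :: "('i::finite \<Rightarrow> complex) set"
  assumes "D \<in> constructibles" "countable D"
  shows "finite D"
proof -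
  have "finite ((\<lambda>w. w i) ` D)" for i
  proof -
    let ?P = "{v. \<exists>w\<in>D. \<forall>j. j \<notin> UNIV - {i} \<longrightarrow> v j = w j}"
    have "?P \<in> constructibles" by (rule constructibles_ex_set[OF _ assms(1)]) auto
    from constructible_line[OF this, of "\<lambda>_. 0" i]
    have "finite {t. (\<lambda>_. 0)(i := t) \<in> ?P} \<or> finite (- {t. (\<lambda>_. 0)(i := t) \<in> ?P})" .
    moreover have "{t. (\<lambda>_. 0)(i := t) \<in> ?P} = (\<lambda>w. w i) ` D" by auto
    moreover have "infinite (- ((\<lambda>w. w i) ` D))"
    proof
      assume "finite (- ((\<lambda>w. w i) ` D))"
      then have "countable (- ((\<lambda>w. w i) ` D) \<union> (\<lambda>w. w i) ` D)"
        using assms(2) by (intro countable_Un) (auto intro: countable_finite)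
      then show False using uncountable_UNIV_complex by simp
    qed
    ultimately show ?thesis by simp
  qed
  then have "finite (PiE UNIV (\<lambda>i. (\<lambda>w. w i) ` D))" by (intro finite_PiE) auto
  moreover have "D \<subseteq> PiE UNIV (\<lambda>i. (\<lambda>w. w i) ` D)" by auto
  ultimately show ?thesis by (rule finite_subset[rotated])
qed

section \<open>Projective space\<close>

unbundle no Formal_Power_Series.fps_syntax

text \<open>The vanishing of the 2 by 2 minors is a system of polynomial equations. From it follow
  the closedness of points and the local equations of the fibres of a morphism.\<close>

lemma cproj_rel_iff_minors:
  "v \<noteq> 0 \<Longrightarrow> w \<noteq> 0 \<Longrightarrow> cproj_rel v w \<longleftrightarrow> (\<forall>i j. v $ i * w $ j = v $ j * w $ i)"
proof
  assume "v \<noteq> 0" "w \<noteq> 0" and m: "\<forall>i j. v $ i * w $ j = v $ j * w $ i"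
  then obtain i where i: "v $ i \<noteq> 0" by (auto simp: vec_eq_iff)
  have eq: "w = (w $ i / v $ i) *s v"
    using i m by (auto simp: vec_eq_iff field_simps)
  moreover have "w $ i / v $ i \<noteq> 0" using \<open>w \<noteq> 0\<close> eq by auto
  ultimately show "cproj_rel v w" using \<open>v \<noteq> 0\<close> \<open>w \<noteq> 0\<close> unfolding cproj_rel_def by blast
qed (auto simp: cproj_rel_def)

lemma abs_cproj_eq_iff: "v \<noteq> 0 \<Longrightarrow> w \<noteq> 0 \<Longrightarrow> abs_cproj v = abs_cproj w \<longleftrightarrow> cproj_rel v w"
  using Quotient_rel[OF Quotient_cproj, of v w]
  by (auto simp: cproj_rel_def intro: exI[of _ 1])

lemma cproj_rel_refl: "v \<noteq> 0 \<Longrightarrow> cproj_rel v v"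
  by (auto simp: cproj_rel_def intro: exI[of _ 1])

lemma abs_cproj_scale: "v \<noteq> 0 \<Longrightarrow> c \<noteq> 0 \<Longrightarrow> abs_cproj (c *s v) = abs_cproj v"
  by (subst eq_commute, subst abs_cproj_eq_iff) (auto simp: cproj_rel_def)

lemma cproj_cases: obtains v where "v \<noteq> 0" "x = abs_cproj v"
proof -
  have "cproj_rel (rep_cproj x) (rep_cproj x)" by (rule Quotient_rep_reflp[OF Quotient_cproj])
  then have "rep_cproj x \<noteq> 0" by (auto simp: cproj_rel_def)
  moreover have "x = abs_cproj (rep_cproj x)" using Quotient_abs_rep[OF Quotient_cproj] by metis
  ultimately show ?thesis using that by blast
qed

lemma open_cproj_iff: "open Y \<longleftrightarrow> open {v. v \<noteq> 0 \<and> abs_cproj v \<in> Y}"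
  by (rule open_cproj_def)

lemma continuous_on_abs_cproj: "continuous_on (- {0}) abs_cproj"
proof (subst continuous_on_open_vimage)
  show "\<forall>B. open B \<longrightarrow> open (abs_cproj -` B \<inter> - {0})"
    by (simp add: open_cproj_iff vimage_def Int_def conj_commute)
qed auto

lemma continuous_on_cproj:
  assumes "open Y" and "continuous_on {v. v \<noteq> 0 \<and> abs_cproj v \<in> Y} (f \<circ> abs_cproj)"
  shows "continuous_on Y f"
proof (subst continuous_on_open_vimage[OF assms(1)], intro allI impI)
  fix B :: "'b set" assume "open B"
  have "open ((f \<circ> abs_cproj) -` B \<inter> {v. v \<noteq> 0 \<and> abs_cproj v \<in> Y})"
    using assms(2) \<open>open B\<close> continuous_on_open_vimage[OF assms(1)[unfolded open_cproj_iff], of "f \<circ> abs_cproj"]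
    by simp
  moreover have "(f \<circ> abs_cproj) -` B \<inter> {v. v \<noteq> 0 \<and> abs_cproj v \<in> Y} = {v. v \<noteq> 0 \<and> abs_cproj v \<in> f -` B \<inter> Y}"
    by auto
  ultimately show "open (f -` B \<inter> Y)" by (simp add: open_cproj_iff)
qed

text \<open>Points are closed, so that the curve without finitely many points is an open
  subset.\<close>

instance cproj :: (finite) t1_space
proof
  fix x y :: "'a cproj" assume "x \<noteq> y"
  obtain w where w: "w \<noteq> 0" "y = abs_cproj w" by (rule cproj_cases)
  have "{v. v \<noteq> 0 \<and> abs_cproj v \<in> - {y}} = (\<Union>i j. {v. v $ i * w $ j \<noteq> v $ j * w $ i}) \<inter> - {0}"
    using w by (auto simp: abs_cproj_eq_iff cproj_rel_iff_minors)
  moreover have "open {v :: complex ^ 'a. v $ i * w $ j \<noteq> v $ j * w $ i}" for i j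
    by (intro open_Collect_neq continuous_intros)
  ultimately have "open (- {y})" unfolding open_cproj_iff by (auto intro!: open_Int open_UN)
  then show "\<exists>U. open U \<and> x \<in> U \<and> y \<notin> U" using \<open>x \<noteq> y\<close> by blast
qed

lemma homogeneous_polyfun:
  assumes "homogeneous_poly d P"
  shows "(\<lambda>x. P (vec_lambda x)) \<in> polyfuns UNIV"
proof -
  obtain A c where A: "finite A" "P = (\<lambda>v. \<Sum>m\<in>A. c m * (\<Prod>i\<in>UNIV. v $ i ^ m i))"
    using assms unfolding homogeneous_poly_def by blast
  have "(\<lambda>x. \<Sum>m\<in>A. c m * (\<Prod>i\<in>UNIV. x i ^ m i)) \<in> polyfuns UNIV"
    by (intro polyfuns_sum polyfuns.mult polyfuns.const polyfuns_prod polyfuns_power polyfuns.var) auto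
  then show ?thesis using A(2) by simp
qed

lemma homogeneous_scale:
  assumes "homogeneous_poly d P" shows "P (c *s v) = c ^ d * P v"
proof -
  obtain A a where A: "\<forall>m\<in>A. (\<Sum>i\<in>UNIV. m i) = d" "P = (\<lambda>v. \<Sum>m\<in>A. a m * (\<Prod>i\<in>UNIV. v $ i ^ m i))"
    using assms unfolding homogeneous_poly_def by blast
  have "(\<Prod>i\<in>UNIV. (c *s v) $ i ^ m i) = c ^ d * (\<Prod>i\<in>UNIV. v $ i ^ m i)" if "m \<in> A" for m
    using A(1) that by (auto simp: power_mult_distrib prod.distrib simp flip: power_sum)
  then show ?thesis by (simp add: A(2) sum_distrib_left mult.left_commute)
qed

lemma homogeneous_zero_iff:
  assumes "homogeneous_poly d P" "v \<noteq> 0" "w \<noteq> 0" "abs_cproj v = abs_cproj w"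
  shows "P v = 0 \<longleftrightarrow> P w = 0"
  using assms homogeneous_scale[OF assms(1)] by (auto simp: abs_cproj_eq_iff cproj_rel_def)

lemma in_zero_locus:
  assumes "\<forall>P\<in>\<P>. \<exists>d. homogeneous_poly d P" "v \<noteq> 0"
  shows "abs_cproj v \<in> zero_locus \<P> \<longleftrightarrow> (\<forall>P\<in>\<P>. P v = 0)"
  using assms unfolding zero_locus_def by (auto) (metis homogeneous_zero_iff)

text \<open>\<open>has_derivative\<close> speaks of real linear maps. The explicit form with
  polynomial coefficients records that the derivative is complex linear and depends continuously on
  the point, as holomorphy and the inverse function theorem require.\<close>

lemma polyfun_differentiable:
  assumes "p \<in> polyfuns (UNIV :: 'n::finite set)"
  shows "\<exists>g. (\<forall>i. g i \<in> polyfuns UNIV) \<and>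
    (\<forall>v :: complex ^ 'n. ((\<lambda>v. p (($) v)) has_derivative (\<lambda>h. \<Sum>i\<in>UNIV. g i (($) v) * h $ i)) (at v))"
  using assms
proof induction
  case (const c)
  then show ?case by (intro exI[of _ "\<lambda>_ _. 0"]) (auto intro: polyfuns.const)
next
  case (var i)
  have "((\<lambda>v. v $ i) has_derivative (\<lambda>h. \<Sum>j\<in>UNIV. (if j = i then 1 else 0) * h $ j)) (at v)" for v :: "complex ^ 'n"
    by (auto simp: if_distrib[of "\<lambda>x. x * _"] cong: if_cong
        intro!: bounded_linear_imp_has_derivative bounded_linear_vec_nth)
  then show ?case
    by (intro exI[of _ "\<lambda>j _. if j = i then 1 else 0"]) (auto intro: polyfuns.const)
next
  case (add p q)
  from add.IH(1) obtain g where g1: "\<forall>i. g i \<in> polyfuns UNIV"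
    "\<forall>v :: complex ^ 'n. ((\<lambda>v. p (($) v)) has_derivative (\<lambda>k. \<Sum>i\<in>UNIV. g i (($) v) * k $ i)) (at v)" by blast
  from add.IH(2) obtain h where h1: "\<forall>i. h i \<in> polyfuns UNIV"
    "\<forall>v :: complex ^ 'n. ((\<lambda>v. q (($) v)) has_derivative (\<lambda>k. \<Sum>i\<in>UNIV. h i (($) v) * k $ i)) (at v)" by blast
  note g = g1(1) h1(1) spec[OF g1(2)] spec[OF h1(2)]
  show ?case
  proof (intro exI[of _ "\<lambda>i v. g i v + h i v"] conjI allI)
    fix v :: "complex ^ 'n"
    show "((\<lambda>v. p (($) v) + q (($) v)) has_derivative (\<lambda>k. \<Sum>i\<in>UNIV. (g i (($) v) + h i (($) v)) * k $ i)) (at v)"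
      using has_derivative_add[OF g(3,4)] by (simp add: sum.distrib distrib_right)
  qed (use g in \<open>auto intro: polyfuns.add\<close>)
next
  case (mult p q)
  from mult.IH(1) obtain g where g1: "\<forall>i. g i \<in> polyfuns UNIV"
    "\<forall>v :: complex ^ 'n. ((\<lambda>v. p (($) v)) has_derivative (\<lambda>k. \<Sum>i\<in>UNIV. g i (($) v) * k $ i)) (at v)" by blast
  from mult.IH(2) obtain h where h1: "\<forall>i. h i \<in> polyfuns UNIV"
    "\<forall>v :: complex ^ 'n. ((\<lambda>v. q (($) v)) has_derivative (\<lambda>k. \<Sum>i\<in>UNIV. h i (($) v) * k $ i)) (at v)" by blast
  note g = g1(1) h1(1) spec[OF g1(2)] spec[OF h1(2)]
  show ?case
  proof (intro exI[of _ "\<lambda>i v. p v * h i v + g i v * q v"] conjI allI)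
    fix v :: "complex ^ 'n"
    have "((\<lambda>v. p (($) v) * q (($) v)) has_derivative
        (\<lambda>k. p (($) v) * (\<Sum>i\<in>UNIV. h i (($) v) * k $ i) + (\<Sum>i\<in>UNIV. g i (($) v) * k $ i) * q (($) v))) (at v)"
      by (rule has_derivative_mult[OF g(3,4)])
    then show "((\<lambda>v. p (($) v) * q (($) v)) has_derivative
        (\<lambda>k. \<Sum>i\<in>UNIV. (p (($) v) * h i (($) v) + g i (($) v) * q (($) v)) * k $ i)) (at v)"
      by (simp add: sum.distrib distrib_left distrib_right sum_distrib_left sum_distrib_right ac_simps)
    show "(\<lambda>v. p v * h i v + g i v * q v) \<in> polyfuns UNIV" for i
      using g(1,2) mult.hyps by (intro polyfuns.add polyfuns.mult) auto
  qed
qed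

lemma polyfun_continuous_on: "p \<in> polyfuns (UNIV :: 'n::finite set) \<Longrightarrow> continuous_on X (\<lambda>v :: complex ^ 'n. p (($) v))"
  using polyfun_differentiable[of p]
  by (auto intro!: continuous_at_imp_continuous_on dest!: spec intro: has_derivative_continuous)

lemma homogeneous_continuous_on: "homogeneous_poly d P \<Longrightarrow> continuous_on X P"
  using polyfun_continuous_on[OF homogeneous_polyfun] by simp

lemma zariski_open_imp_open:
  assumes "zariski_open W" shows "open W"
proof -
  obtain \<P> where \<P>: "\<forall>P\<in>\<P>. \<exists>d. homogeneous_poly d P" "- W = zero_locus \<P>"
    using assms unfolding zariski_open_def zariski_closed_def by blast
  have "abs_cproj v \<in> W \<longleftrightarrow> \<not> (\<forall>P\<in>\<P>. P v = 0)" if "v \<noteq> 0" for v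
    using in_zero_locus[OF \<P>(1) that] \<P>(2) by blast
  then have "{v. v \<noteq> 0 \<and> abs_cproj v \<in> W} = (\<Union>P\<in>\<P>. {v. P v \<noteq> 0}) \<inter> - {0}" by auto
  moreover have "open {v. P v \<noteq> 0}" if "P \<in> \<P>" for P
    using \<P>(1) that by (intro open_Collect_neq continuous_on_const) (auto intro: homogeneous_continuous_on)
  ultimately show ?thesis unfolding open_cproj_iff by (auto intro!: open_Int open_UN)
qed

text \<open>The bilinear pairing, without the conjugation of an inner product, so that
  \<open>dot a\<close> is complex linear.\<close>

definition dot :: "complex ^ 'n::finite \<Rightarrow> complex ^ 'n \<Rightarrow> complex" where
  "dot a h = (\<Sum>i\<in>UNIV. a $ i * h $ i)"

lemma bounded_linear_vector_smult: "bounded_linear (\<lambda>z :: complex. z *s (w :: complex ^ 'n::finite))"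
  by (rule linear_conv_bounded_linear[THEN iffD1], rule linearI) (auto simp: vec_eq_iff algebra_simps)

lemma has_derivative_line:
  fixes v w :: "complex ^ 'n::finite"
  assumes "(F has_derivative D) (at (v + t *s w))"
  shows "((\<lambda>t. F (v + t *s w)) has_derivative (\<lambda>s. D (s *s w))) (at t)"
proof -
  have "((\<lambda>t. v + t *s w) has_derivative (\<lambda>s. s *s w)) (at t)"
    by (auto intro!: derivative_eq_intros bounded_linear_imp_has_derivative bounded_linear_vector_smult)
  from has_derivative_compose[OF this assms] show ?thesis .
qed

lemma has_field_derivative_line:
  fixes F :: "complex ^ 'n::finite \<Rightarrow> complex"
  assumes "(F has_derivative dot a) (at (v + t *s w))"
  shows "((\<lambda>t. F (v + t *s w)) has_field_derivative dot a w) (at t)"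
proof -
  have "(\<lambda>s. dot a (s *s w)) = (*) (dot a w)"
    by (auto simp: dot_def sum_distrib_right sum_distrib_left ac_simps)
  then show ?thesis using has_derivative_line[OF assms] by (simp add: has_field_derivative_def)
qed

lemma gradient_has_derivative:
  assumes "homogeneous_poly d P"
  shows "(P has_derivative dot (complex_gradient P v)) (at v)"
    and "continuous_on X (complex_gradient P)"
proof -
  obtain g where g: "\<forall>i. g i \<in> polyfuns UNIV" "\<And>v. (P has_derivative (\<lambda>h. \<Sum>i\<in>UNIV. g i (($) v) * h $ i)) (at v)"
    using polyfun_differentiable[OF homogeneous_polyfun[OF assms]] by auto
  have "complex_gradient P v $ i = g i (($) v)" for i v
  proof -
    have "(P has_derivative dot (\<chi> i. g i (($) v))) (at (v + 0 *s axis i 1))"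
      using g(2)[of v] by (simp add: dot_def[abs_def])
    from has_field_derivative_line[OF this] show ?thesis
      by (simp add: complex_gradient_def DERIV_imp_deriv dot_def axis_def if_distrib cong: if_cong)
  qed
  then have grad: "complex_gradient P v = (\<chi> i. g i (($) v))" for v by (simp add: vec_eq_iff)
  then show "(P has_derivative dot (complex_gradient P v)) (at v)"
    using g(2) by (simp add: dot_def[abs_def])
  show "continuous_on X (complex_gradient P)"
    unfolding grad[abs_def] using g(1) by (intro continuous_on_vec_lambda polyfun_continuous_on) auto
qed

text \<open>Euler's identity, in the only case needed.\<close>

lemma gradient_orthogonal:
  assumes "homogeneous_poly d P" "P v = 0" shows "dot (complex_gradient P v) v = 0"
proof -
  have "((\<lambda>t. P (v + t *s v)) has_field_derivative dot (complex_gradient P v) v) (at 0)"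
    using gradient_has_derivative(1)[OF assms(1), of v] by (intro has_field_derivative_line) simp
  moreover have "P (v + t *s v) = 0" for t
    using homogeneous_scale[OF assms(1), of "1 + t" v] assms(2)
    by (simp add: vec.scale_left_distrib)
  ultimately have "((\<lambda>t :: complex. 0) has_field_derivative dot (complex_gradient P v) v) (at 0)" by simp
  then show ?thesis using DERIV_unique DERIV_const by blast
qed

section \<open>Holomorphic charts\<close>

lemma dot_add_left: "dot (a + b) h = dot a h + dot b h"
  and dot_smult_left: "dot (c *s a) h = c * dot a h"
  and dot_zero_left: "dot 0 h = 0"
  by (simp_all add: dot_def sum.distrib distrib_right sum_distrib_left mult.assoc)

lemma dot_sum_left: "dot (\<Sum>i\<in>X. a i) h = (\<Sum>i\<in>X. dot (a i) h)"
  by (induction X rule: infinite_finite_induct) (auto simp: dot_add_left dot_zero_left)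

lemma dot_axis_left: "dot (axis j 1) h = h $ j"
  by (simp add: dot_def axis_def if_distrib[of "\<lambda>x. x * _"] cong: if_cong)

lemma matrix_vector_mult_dot: "(A *v h) $ i = dot (A $ i) h"
  by (simp add: matrix_vector_mult_def dot_def)

lemma bounded_linear_dot: "bounded_linear (dot a)"
proof -
  have "dot a = (\<lambda>h. \<Sum>i\<in>UNIV. a $ i * h $ i)" by (auto simp: dot_def)
  then show ?thesis
    by (auto intro!: bounded_linear_sum bounded_linear_compose[OF bounded_linear_mult_right] bounded_linear_vec_nth)
qed

lemma has_derivative_vec:
  fixes F :: "'a::real_normed_vector \<Rightarrow> complex ^ 'n::finite"
  assumes "\<And>i. ((\<lambda>v. F v $ i) has_derivative (\<lambda>h. F' h $ i)) (at v)"
  shows "(F has_derivative F') (at v)"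
proof -
  have eq: "w = (\<Sum>i\<in>UNIV. (w $ i) *s axis i 1)" for w :: "complex ^ 'n"
    by (simp add: vec_eq_iff axis_def if_distrib cong: if_cong)
  have "((\<lambda>v. \<Sum>i\<in>UNIV. (F v $ i) *s axis i 1) has_derivative (\<lambda>h. \<Sum>i\<in>UNIV. (F' h $ i) *s (axis i 1 :: complex ^ 'n))) (at v)"
    by (intro has_derivative_sum bounded_linear.has_derivative[OF bounded_linear_vector_smult] assms)
  then show ?thesis by (simp only: eq[symmetric])
qed

lemma card_Compl: "card (- A) = CARD('a) - card A" for A :: "'a::finite set"
  by (simp add: Compl_eq_Diff_UNIV card_Diff_subset)

text \<open>The rows outside \<open>J\<close> will be the differentials of equations; the rows in
  \<open>J\<close>, taken from an extension to a basis, supply the coordinates along the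
  variety.\<close>

lemma complete_to_invertible:
  fixes r :: "'n::finite \<Rightarrow> complex ^ 'n"
  assumes indep: "\<And>c. (\<Sum>i\<in>-J. c i *s r i) = 0 \<Longrightarrow> \<forall>i\<in>-J. c i = 0"
  obtains A :: "complex ^ 'n ^ 'n" where "\<And>i. i \<in> -J \<Longrightarrow> A $ i = r i" "invertible A"
proof -
  have inj: "inj_on r (- J)"
  proof (rule inj_onI, rule ccontr)
    fix i j assume ij: "i \<in> -J" "j \<in> -J" "r i = r j" "i \<noteq> j"
    let ?c = "\<lambda>k. if k = i then 1 else if k = j then -1 else (0 :: complex)"
    have "(\<Sum>k\<in>-J. ?c k *s r k) = (\<Sum>k\<in>{i, j}. ?c k *s r k)"
      by (rule sum.mono_neutral_right) (use ij in auto)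
    also have "\<dots> = 0" using ij by (simp add: vec_eq_iff)
    finally have "\<forall>k\<in>-J. ?c k = 0" by (rule indep)
    then have "?c i = 0" using ij by blast
    then show False by simp
  qed
  let ?R = "r ` (- J)"
  have "vec.independent ?R"
  proof (rule ccontr)
    assume "\<not> vec.independent ?R"
    then obtain u where u: "\<exists>v\<in>?R. u v \<noteq> 0" "(\<Sum>v\<in>?R. u v *s v) = 0"
      by (subst (asm) vec.dependent_finite) auto
    then have "(\<Sum>i\<in>-J. u (r i) *s r i) = 0" by (simp add: sum.reindex[OF inj] o_def)
    then show False using indep[of "\<lambda>i. u (r i)"] u(1) by auto
  qed
  define B where "B = vec.extend_basis ?R"
  have B: "?R \<subseteq> B" "vec.independent B" "vec.span B = UNIV"
    unfolding B_def
    by (rule vec.extend_basis_superset vec.independent_extend_basis vec.span_extend_basis, fact \<open>vec.independent ?R\<close>)+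
  have cB: "card B = CARD('n)" using vec.dim_span_eq_card_independent[OF B(2)] B(3) vec_dim_card[where 'a = complex and 'n = 'n] by metis
  then have fB: "finite B" using card_gt_0_iff by fastforce
  have "card (B - ?R) = card J"
    using cB card_Diff_subset[OF _ B(1)] card_image[OF inj] card_Compl[of J] card_mono[of UNIV J] by simp
  then obtain h where h: "bij_betw h J (B - ?R)"
    using finite_same_card_bij[of J "B - ?R"] fB by auto
  define m where "m i = (if i \<in> J then h i else r i)" for i
  have "bij_betw m (J \<union> - J) ((B - ?R) \<union> ?R)"
  proof (rule bij_betw_combine)
    show "bij_betw m J (B - ?R)" using h by (simp add: m_def cong: bij_betw_cong)
    have "bij_betw r (- J) ?R" using inj by (simp add: bij_betw_def)
    moreover have "r i = m i" if "i \<in> -J" for i using that by (simp add: m_def)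
    ultimately show "bij_betw m (- J) ?R" using bij_betw_cong[of "-J" r m] by blast
  qed auto
  then have m: "bij_betw m UNIV B" using B(1) by (simp add: Un_absorb2 Compl_partition)
  define A :: "complex ^ 'n ^ 'n" where "A = (\<chi> i. m i)"
  have "\<forall>c. (\<Sum>i\<in>UNIV. c i *s row i A) = 0 \<longrightarrow> (\<forall>i. c i = 0)"
  proof (intro allI impI)
    fix c i assume 0: "(\<Sum>i\<in>UNIV. c i *s row i A) = 0"
    let ?u = "\<lambda>v. c (inv_into UNIV m v)"
    have injm: "inj m" using m by (simp add: bij_betw_def)
    have "(\<Sum>v\<in>B. ?u v *s v) = (\<Sum>i\<in>UNIV. c i *s m i)"
      using sum.reindex_bij_betw[OF m, of "\<lambda>v. ?u v *s v"] injm by simp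
    also have "\<dots> = 0" using 0 by (simp add: A_def row_def vec_lambda_eta)
    finally have "(\<Sum>v\<in>B. ?u v *s v) = 0" .
    moreover have "\<forall>u. (\<Sum>v\<in>B. u v *s v) = 0 \<longrightarrow> (\<forall>v\<in>B. u v = 0)"
      using B(2) vec.dependent_finite[OF fB] by auto
    note this[rule_format, of ?u]
    ultimately have "\<forall>v\<in>B. ?u v = 0" by simp
    moreover have "m i \<in> B" using m by (auto simp: bij_betw_def)
    ultimately have "c (inv_into UNIV m (m i)) = 0" by blast
    then show "c i = 0" by (simp only: inv_f_f[OF injm])
  qed
  then have "\<exists>A'. A ** A' = mat 1" using matrix_right_invertible_independent_rows[of A] by blast
  then have "invertible A" using invertible_right_inverse by blast
  moreover have "A $ i = r i" if "i \<in> - J" for i using that by (simp add: A_def m_def)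
  ultimately show ?thesis using that by blast
qed

text \<open>A ball in the coordinate subspace that belongs to \<open>J\<close>, the local model of a
  variety of dimension \<open>card J\<close>. Inside the fixed space \<open>complex ^ 'n\<close> the
  dimension can be a number rather than a type.\<close>

definition slab :: "'n set \<Rightarrow> complex ^ 'n::finite \<Rightarrow> real \<Rightarrow> (complex ^ 'n) set" where
  "slab J u \<epsilon> = {w \<in> ball u \<epsilon>. \<forall>i\<in>-J. w $ i = 0}"

text \<open>The equations of \<open>X\<close> together with the normalisation of one homogeneous
  coordinate to 1 are completed to local coordinates by the inverse function theorem; in these
  \<open>X\<close> is a coordinate subspace. The derivative of \<psi> is taken in the whole space
  and is complex linear, hence polynomials become holomorphic along complex lines of the
  chart.\<close>

lemma smooth_chart:
  fixes X :: "'n::finite cproj set"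
  assumes X: "smooth_of_dim d X" and x: "x \<in> X" and Y: "open Y" "x \<in> Y"
  obtains J u \<epsilon> \<psi> \<kappa> V where "card (J :: 'n set) = d" "\<epsilon> > 0" "\<And>i. i \<in> -J \<Longrightarrow> u $ i = 0"
    "openin (top_of_set X) V" "V \<subseteq> Y" "homeomorphism (slab J u \<epsilon>) V (\<lambda>w. abs_cproj (\<psi> w)) \<kappa>"
    "abs_cproj (\<psi> u) = x" "\<And>w. w \<in> slab J u \<epsilon> \<Longrightarrow> \<psi> w \<noteq> 0"
    "\<And>w. w \<in> slab J u \<epsilon> \<Longrightarrow> \<exists>D. (\<psi> has_derivative D) (at w) \<and> (\<forall>c h. D (c *s h) = c *s D h)"
proof -
  obtain W k P where W: "zariski_open W" "x \<in> W" and k: "k + d + 1 = CARD('n)"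
    and P: "\<forall>j<k. \<exists>e. homogeneous_poly e (P j)" "X \<inter> W = zero_locus (P ` {..<k}) \<inter> W"
    and grad': "\<forall>v. v \<noteq> 0 \<and> abs_cproj v = x \<longrightarrow>
       (\<forall>c :: nat \<Rightarrow> complex. (\<Sum>j<k. c j *s complex_gradient (P j) v) = 0 \<longrightarrow> (\<forall>j<k. c j = 0))"
    using bspec[OF X[unfolded smooth_of_dim_def] x] by blast
  have grad: "\<forall>j<k. c j = 0"
    if "v \<noteq> 0" "abs_cproj v = x" "(\<Sum>j<k. c j *s complex_gradient (P j) v) = 0" for v c
    using grad' that by blast
  obtain w where w: "w \<noteq> 0" "x = abs_cproj w" by (rule cproj_cases)
  then obtain j where j: "w $ j \<noteq> 0" by (auto simp: vec_eq_iff)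
  define v0 where "v0 = (1 / w $ j) *s w"
  have v0: "v0 \<noteq> 0" "abs_cproj v0 = x" "v0 $ j = 1"
    using w j abs_cproj_scale[of w "1 / w $ j"] by (auto simp: v0_def vec_eq_iff)
  \<comment> \<open>\<open>idx\<close> reserves \<open>k + 1\<close> coordinates, one for each
    equation and the last for the normalisation \<open>v $ j = 1\<close>; the remaining
    \<open>d\<close> coordinates form \<open>J\<close>.\<close>
  have "\<exists>idx :: nat \<Rightarrow> 'n. inj_on idx {..k}"
    using card_le_inj[of "{..k}" "UNIV :: 'n set"] k by auto
  then obtain idx :: "nat \<Rightarrow> 'n" where idx: "inj_on idx {..k}" by blast
  define J where "J = - idx ` {..k}"
  have cJ: "card J = d" unfolding J_def using card_Compl[of "idx ` {..k}"] card_image[OF idx] k by simp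
  define m where "m = inv_into {..k} idx"
  have m: "m (idx l) = l" if "l \<le> k" for l unfolding m_def using idx that by simp
  define F where "F i v = (if m i < k then P (m i) v else v $ j - 1)" for i v
  define G where "G i v = (if m i < k then complex_gradient (P (m i)) v else axis j 1)" for i v
  have derF: "(F i has_derivative dot (G i v)) (at v)" for i v
  proof (cases "m i < k")
    case True
    then obtain e where "homogeneous_poly e (P (m i))" using P(1) by blast
    then show ?thesis using True gradient_has_derivative(1) by (auto simp: F_def[abs_def] G_def)
  next
    case False
    have "((\<lambda>v. v $ j - 1) has_derivative (\<lambda>h. h $ j - 0)) (at v)"
      by (intro has_derivative_diff bounded_linear_imp_has_derivative bounded_linear_vec_nth has_derivative_const)
    moreover have "dot (axis j 1) = (\<lambda>h. h $ j)" by (auto simp: dot_axis_left)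
    ultimately show ?thesis using False by (simp add: F_def[abs_def] G_def)
  qed
  have contG: "continuous_on UNIV (G i)" for i
  proof (cases "m i < k")
    case True
    then obtain e where "homogeneous_poly e (P (m i))" using P(1) by blast
    then show ?thesis using True by (auto simp: G_def[abs_def] intro: gradient_has_derivative(2))
  qed (auto simp: G_def[abs_def])
  have indep: "\<forall>i\<in>-J. c i = 0" if "(\<Sum>i\<in>-J. c i *s G i v0) = 0" for c
  proof -
    have 0: "0 = (\<Sum>l\<le>k. c (idx l) *s G (idx l) v0)"
      using that by (simp add: J_def sum.reindex[OF idx])
    also have "\<dots> = (\<Sum>l<k. c (idx l) *s complex_gradient (P l) v0) + c (idx k) *s axis j 1"
      by (simp add: lessThan_Suc_atMost[symmetric] m G_def)
    finally have s: "(\<Sum>l<k. c (idx l) *s complex_gradient (P l) v0) + c (idx k) *s axis j 1 = 0" by simp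
    have zero: "P l v0 = 0" if "l < k" for l
    proof -
      have "abs_cproj v0 \<in> zero_locus (P ` {..<k})" using P(2) x W v0 by auto
      then show ?thesis using in_zero_locus[of "P ` {..<k}" v0] P(1) v0 that by auto
    qed
    \<comment> \<open>By Euler's identity the gradients of the equations annihilate
      \<open>v0\<close>, whereas \<open>axis j 1\<close> pairs with it to 1. Pairing a linear
      relation with \<open>v0\<close> therefore isolates the coefficient of the
      normalisation.\<close>
    have "dot (complex_gradient (P l) v0) v0 = 0" if "l < k" for l
      using gradient_orthogonal zero P(1) that by blast
    then have "dot ((\<Sum>l<k. c (idx l) *s complex_gradient (P l) v0) + c (idx k) *s axis j 1) v0 = c (idx k)"
      using v0(3) by (simp add: dot_add_left dot_sum_left dot_smult_left dot_axis_left)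
    then have ck: "c (idx k) = 0" using s by (simp add: dot_zero_left)
    then have "\<forall>l<k. c (idx l) = 0" using grad[OF v0(1,2), of "\<lambda>l. c (idx l)"] s by simp
    then show ?thesis using ck by (auto simp: J_def) (metis le_neq_implies_less)
  qed
  obtain A where A: "\<And>i. i \<in> -J \<Longrightarrow> A $ i = G i v0" "invertible A"
    by (rule complete_to_invertible[where J = J and r = "\<lambda>i. G i v0"]) (use indep in auto)
  define \<Phi> where "\<Phi> v = (\<chi> i. if i \<in> -J then F i v else dot (A $ i) v)" for v
  define Mat where "Mat v = (\<chi> i. if i \<in> -J then G i v else A $ i)" for v
  define \<Phi>' where "\<Phi>' v = Blinfun ((*v) (Mat v))" for v
  have \<Phi>'_apply: "blinfun_apply (\<Phi>' v) = (*v) (Mat v)" for v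
    unfolding \<Phi>'_def by (rule bounded_linear_Blinfun_apply) auto
  have der: "(\<Phi> has_derivative blinfun_apply (\<Phi>' v)) (at v)" for v
  proof (rule has_derivative_vec)
    fix i
    have "(dot (A $ i) has_derivative dot (A $ i)) (at v)"
      by (intro bounded_linear_imp_has_derivative bounded_linear_dot)
    moreover have "(\<lambda>h. (Mat v *v h) $ i) = (if i \<in> -J then dot (G i v) else dot (A $ i))"
      by (auto simp: matrix_vector_mult_dot Mat_def)
    ultimately show "((\<lambda>v. \<Phi> v $ i) has_derivative (\<lambda>h. blinfun_apply (\<Phi>' v) h $ i)) (at v)"
      using derF[of i v] by (cases "i \<in> -J") (simp_all add: \<Phi>_def \<Phi>'_apply)
  qed
  define U where "U = {v. v \<noteq> 0 \<and> abs_cproj v \<in> W \<inter> Y}"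
  have "open U" unfolding U_def using zariski_open_imp_open[OF W(1)] Y(1) open_cproj_iff by (metis open_Int)
  have cont: "continuous_on U \<Phi>'"
  proof (rule continuous_on_blinfun_componentwise)
    fix b :: "complex ^ 'n"
    have "continuous_on U (\<lambda>v. Mat v $ i $ l)" for i l
      using continuous_on_subset[OF contG[of i], of U]
      by (cases "i \<in> -J") (auto simp: Mat_def intro!: continuous_intros)
    then show "continuous_on U (\<lambda>v. blinfun_apply (\<Phi>' v) b)"
      unfolding \<Phi>'_apply matrix_vector_mult_def
      by (intro continuous_on_vec_lambda continuous_on_sum continuous_on_mult continuous_on_const) auto
  qed
  have "v0 \<in> U" using v0 W Y by (simp add: U_def)
  have MatA: "Mat v0 = A" using A(1) by (auto simp: Mat_def vec_eq_iff)
  obtain A' where A': "A' ** A = mat 1" using A(2) unfolding invertible_def by blast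
  have inv: "Blinfun ((*v) A') o\<^sub>L \<Phi>' v0 = id_blinfun"
  proof (rule blinfun_eqI)
    fix h
    have "blinfun_apply (Blinfun ((*v) A')) = (*v) A'"
      by (rule bounded_linear_Blinfun_apply) auto
    then show "blinfun_apply (Blinfun ((*v) A') o\<^sub>L \<Phi>' v0) h = blinfun_apply id_blinfun h"
      by (simp add: \<Phi>'_apply MatA matrix_vector_mul_assoc A')
  qed
  obtain U' V' g g' where g: "open U'" "U' \<subseteq> U" "v0 \<in> U'" "open V'" "\<Phi> v0 \<in> V'" "homeomorphism U' V' \<Phi> g"
    "\<And>y. y \<in> V' \<Longrightarrow> (g has_derivative (g' y)) (at y)"
    "\<And>y. y \<in> V' \<Longrightarrow> g' y = inv_into UNIV (blinfun_apply (\<Phi>' (g y)))"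
    "\<And>y. y \<in> V' \<Longrightarrow> bij (blinfun_apply (\<Phi>' (g y)))"
    by (rule inverse_function_theorem[OF \<open>open U\<close> der cont \<open>v0 \<in> U\<close> inv]) (rule that; assumption)
  define u where "u = \<Phi> v0"
  obtain \<epsilon> where \<epsilon>: "\<epsilon> > 0" "ball u \<epsilon> \<subseteq> V'" using g(4,5) unfolding u_def openE by (meson openE)
  have F_zero: "(\<forall>i\<in>-J. F i v = 0) \<longleftrightarrow> v $ j = 1 \<and> abs_cproj v \<in> X" if "v \<in> U" for v
  proof -
    have "v \<noteq> 0" "abs_cproj v \<in> W" using that by (auto simp: U_def)
    then have "abs_cproj v \<in> X \<longleftrightarrow> (\<forall>l<k. P l v = 0)"
      using P in_zero_locus[of "P ` {..<k}" v] by auto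
    moreover have "(\<forall>i\<in>-J. F i v = 0) \<longleftrightarrow> (\<forall>l\<le>k. F (idx l) v = 0)" by (auto simp: J_def)
    moreover have "\<dots> \<longleftrightarrow> (\<forall>l<k. P l v = 0) \<and> v $ j = 1"
      by (auto simp: F_def m le_less split: if_splits)
    ultimately show ?thesis by blast
  qed
  have gV: "g y \<in> U'" "\<Phi> (g y) = y" if "y \<in> V'" for y
    using g(6) that by (auto simp: homeomorphism_def)
  have gU: "g (\<Phi> v) = v" "\<Phi> v \<in> V'" if "v \<in> U'" for v
    using g(6) that by (auto simp: homeomorphism_def)
  have slab_iff: "(\<forall>i\<in>-J. w $ i = 0) \<longleftrightarrow> g w $ j = 1 \<and> abs_cproj (g w) \<in> X" if "w \<in> V'" for w
  proof -
    have "(\<forall>i\<in>-J. w $ i = 0) \<longleftrightarrow> (\<forall>i\<in>-J. F i (g w) = 0)"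
    proof -
      have "w $ i = F i (g w)" if "i \<in> -J" for i
        using arg_cong[OF gV(2)[OF \<open>w \<in> V'\<close>], of "\<lambda>y. y $ i"] that by (simp add: \<Phi>_def)
      then show ?thesis by simp
    qed
    then show ?thesis using F_zero gV(1)[OF that] g(2) by blast
  qed
  have gu: "g u = v0" unfolding u_def using gU g(3) by blast
  have u0: "u $ i = 0" if "i \<in> -J" for i
    using slab_iff[of u] that gu v0 x g(5) by (auto simp: u_def)
  \<comment> \<open>On the points whose coordinate \<open>j\<close> is nonzero, this is the
    homogeneous vector normalised to 1 there, whatever vector \<open>rep_cproj\<close> has
    picked.\<close>
  define a where "a y = (1 / rep_cproj y $ j) *s rep_cproj y" for y :: "'n cproj"
  have a_abs: "a (abs_cproj v) = (1 / v $ j) *s v" if "v \<noteq> 0" for v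
  proof -
    have "cproj_rel v v" using that by (rule cproj_rel_refl)
    then have "cproj_rel v (rep_cproj (abs_cproj v))" using rep_abs_rsp[OF Quotient3_cproj] by metis
    then obtain c where "c \<noteq> 0" "rep_cproj (abs_cproj v) = c *s v" by (auto simp: cproj_rel_def)
    then show ?thesis by (simp add: a_def vec_eq_iff)
  qed
  define T where "T = {v \<in> U'. \<Phi> v \<in> ball u \<epsilon>}"
  have T: "open T" 
  proof -
    have "T = \<Phi> -` ball u \<epsilon> \<inter> U'" by (auto simp: T_def)
    moreover have "continuous_on U' \<Phi>" using g(6) by (simp add: homeomorphism_def)
    ultimately show ?thesis using continuous_on_open_vimage[OF g(1), of \<Phi>] by simp
  qed
  define V where "V = X \<inter> {y. rep_cproj y $ j \<noteq> 0 \<and> a y \<in> T}"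
  have opV: "open {v. v \<noteq> 0 \<and> v $ j \<noteq> 0 \<and> (1 / v $ j) *s v \<in> T}"
  proof -
    have o: "open {v :: complex ^ 'n. v \<noteq> 0 \<and> v $ j \<noteq> 0}"
      by (intro open_Collect_conj open_Collect_neq continuous_intros)
    have "continuous_on {v :: complex ^ 'n. v \<noteq> 0 \<and> v $ j \<noteq> 0} (\<lambda>v. (1 / v $ j) *s v)"
      unfolding vector_scalar_mult_def by (intro continuous_intros) auto
    then have "open ((\<lambda>v. (1 / v $ j) *s v) -` T \<inter> {v :: complex ^ 'n. v \<noteq> 0 \<and> v $ j \<noteq> 0})"
      using continuous_on_open_vimage[OF o] T by blast
    moreover have "(\<lambda>v. (1 / v $ j) *s v) -` T \<inter> {v :: complex ^ 'n. v \<noteq> 0 \<and> v $ j \<noteq> 0} =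
        {v. v \<noteq> 0 \<and> v $ j \<noteq> 0 \<and> (1 / v $ j) *s v \<in> T}" by auto
    ultimately show ?thesis by simp
  qed
  have rep_j: "rep_cproj (abs_cproj v) $ j \<noteq> 0 \<longleftrightarrow> v $ j \<noteq> 0" if "v \<noteq> 0" for v
  proof -
    have "cproj_rel v (rep_cproj (abs_cproj v))" using rep_abs_rsp[OF Quotient3_cproj cproj_rel_refl[OF that]] by metis
    then show ?thesis by (auto simp: cproj_rel_def)
  qed
  let ?C = "{y. rep_cproj y $ j \<noteq> 0 \<and> a y \<in> T}"
  have "{v. v \<noteq> 0 \<and> abs_cproj v \<in> ?C} = {v. v \<noteq> 0 \<and> v $ j \<noteq> 0 \<and> (1 / v $ j) *s v \<in> T}"
    using rep_j a_abs by auto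
  then have openC: "open ?C" using opV by (simp add: open_cproj_iff)
  then have openinV: "openin (top_of_set X) V" unfolding V_def by (rule openin_open_Int)
  define \<kappa> where "\<kappa> y = \<Phi> (a y)" for y
  have slabV: "w \<in> V'" "\<forall>i\<in>-J. w $ i = 0" "w \<in> ball u \<epsilon>" if "w \<in> slab J u \<epsilon>" for w
    using that \<epsilon>(2) by (auto simp: slab_def)
  have g_nz: "g w \<noteq> 0" if "w \<in> V'" for w using gV(1)[OF that] g(2) by (auto simp: U_def)
  have ag: "a (abs_cproj (g w)) = g w" if "w \<in> slab J u \<epsilon>" for w
    using a_abs g_nz slab_iff slabV[OF that] by auto
  have img: "abs_cproj (g w) \<in> V" "\<kappa> (abs_cproj (g w)) = w" if "w \<in> slab J u \<epsilon>" for w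
  proof -
    show "\<kappa> (abs_cproj (g w)) = w" unfolding \<kappa>_def ag[OF that] using gV(2) slabV[OF that] by blast
    have "rep_cproj (abs_cproj (g w)) $ j \<noteq> 0"
      using rep_j g_nz slab_iff slabV[OF that] by auto
    moreover have "g w \<in> T" using gV slabV[OF that] by (auto simp: T_def)
    ultimately show "abs_cproj (g w) \<in> V" unfolding V_def using slab_iff slabV[OF that] ag[OF that] by auto
  qed
  have img': "\<kappa> y \<in> slab J u \<epsilon>" "abs_cproj (g (\<kappa> y)) = y" if "y \<in> V" for y
  proof -
    obtain v where v: "v \<noteq> 0" "y = abs_cproj v" by (rule cproj_cases)
    have y: "y \<in> X" "rep_cproj y $ j \<noteq> 0" "a y \<in> T" using that by (auto simp: V_def)
    have vj: "v $ j \<noteq> 0" using rep_j v y by auto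
    have av: "a y = (1 / v $ j) *s v" using a_abs v by auto
    have absa: "abs_cproj (a y) = y" unfolding av using abs_cproj_scale[of v "1 / v $ j"] v vj by simp
    have aT: "a y \<in> U'" "\<Phi> (a y) \<in> ball u \<epsilon>" using y by (auto simp: T_def)
    have ga: "g (\<kappa> y) = a y" unfolding \<kappa>_def using gU aT by blast
    show "abs_cproj (g (\<kappa> y)) = y" using ga absa by simp
    have "a y $ j = 1" using av vj by simp
    then have "\<forall>i\<in>-J. \<kappa> y $ i = 0"
      using slab_iff[of "\<kappa> y"] ga absa y gU(2)[OF aT(1)] by (auto simp: \<kappa>_def)
    then show "\<kappa> y \<in> slab J u \<epsilon>" using aT by (auto simp: slab_def \<kappa>_def)
  qed
  have "continuous_on ?C a"
  proof (rule continuous_on_cproj[OF openC])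
    have "continuous_on {v :: complex ^ 'n. v \<noteq> 0 \<and> abs_cproj v \<in> ?C} (\<lambda>v. (1 / v $ j) *s v)"
      unfolding vector_scalar_mult_def using rep_j by (intro continuous_intros) auto
    then show "continuous_on {v. v \<noteq> 0 \<and> abs_cproj v \<in> ?C} (a \<circ> abs_cproj)"
      by (rule continuous_on_eq) (use a_abs in auto)
  qed
  moreover have "continuous_on U' \<Phi>" using g(6) by (auto simp: homeomorphism_def)
  ultimately have "continuous_on ?C (\<Phi> \<circ> a)"
    by (intro continuous_on_compose) (auto intro: continuous_on_subset simp: T_def)
  then have c1: "continuous_on V \<kappa>" unfolding V_def \<kappa>_def by (auto simp: o_def intro: continuous_on_subset)
  have "continuous_on V' g" using g(6) by (auto simp: homeomorphism_def)
  then have "continuous_on (slab J u \<epsilon>) g" by (rule continuous_on_subset) (use slabV in auto)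
  then have c2: "continuous_on (slab J u \<epsilon>) (\<lambda>w. abs_cproj (g w))"
    by (rule continuous_on_compose2[OF continuous_on_abs_cproj]) (use g_nz slabV in auto)
  have "homeomorphism (slab J u \<epsilon>) V (\<lambda>w. abs_cproj (g w)) \<kappa>"
  proof
    show "(\<lambda>w. abs_cproj (g w)) ` slab J u \<epsilon> \<subseteq> V" "\<kappa> ` V \<subseteq> slab J u \<epsilon>" using img img' by auto
  qed (use c1 c2 img img' in auto)
  moreover have "\<exists>D. (g has_derivative D) (at w) \<and> (\<forall>c h. D (c *s h) = c *s D h)" if "w \<in> slab J u \<epsilon>" for w
  proof (intro exI conjI allI)
    have wV: "w \<in> V'" using slabV[OF that] by auto
    show "(g has_derivative g' w) (at w)" by (rule g(7)[OF wV])
    fix c h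
    let ?N = "(*v) (Mat (g w))"
    have b: "bij ?N" "g' w = inv_into UNIV ?N" using g(8,9)[OF wV] by (auto simp: \<Phi>'_apply)
    have "?N (c *s inv_into UNIV ?N h) = c *s ?N (inv_into UNIV ?N h)" by (simp add: matrix_vector_mult_scaleR vector_scalar_commute)
    also have "\<dots> = c *s h" using b(1) by (simp add: bij_is_surj surj_f_inv_f)
    finally show "g' w (c *s h) = c *s g' w h" using b by (metis bij_inv_eq_iff)
  qed
  moreover have "V \<subseteq> Y"
  proof
    fix y assume "y \<in> V"
    then have "g (\<kappa> y) \<in> U" using gV(1) img'[of y] slabV g(2) by blast
    then show "y \<in> Y" using img'[OF \<open>y \<in> V\<close>] by (auto simp: U_def)
  qed
  ultimately show ?thesis
    using that[of J \<epsilon> u V g \<kappa>] cJ \<epsilon>(1) u0 openinV gu v0 g_nz slabV by auto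
qed

section \<open>Discs and the identity theorem\<close>

text \<open>The features of a disc on which the topological arguments rely. They hold for balls of
  real dimension at least 2 and thus serve for the curve and for the surface alike.\<close>

definition disc_like :: "'a::topological_space set \<Rightarrow> bool" where
  "disc_like V \<longleftrightarrow> contractible_space (top_of_set V) \<and> infinite V \<and> (\<forall>A. finite A \<longrightarrow> connected (V - A))"

definition locally_disc_like :: "'a::topological_space set \<Rightarrow> bool" where
  "locally_disc_like X \<longleftrightarrow> (\<forall>x\<in>X. \<forall>Y. open Y \<and> x \<in> Y \<longrightarrow>
     (\<exists>V. openin (top_of_set X) V \<and> x \<in> V \<and> V \<subseteq> Y \<and> disc_like V))"

lemma norm_axis_complex: "norm (axis i c :: complex ^ 'n::finite) = norm c"
  by (simp add: norm_vec_def L2_set_def axis_def if_distrib[of norm] if_distrib[of "\<lambda>x. x ^ 2"] cong: if_cong)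

lemma convex_slab: "convex (slab J u \<epsilon>)"
proof -
  have "slab J u \<epsilon> = ball u \<epsilon> \<inter> (\<Inter>i\<in>-J. {w. w $ i = 0})" by (auto simp: slab_def)
  moreover have "convex {w :: complex ^ 'n. w $ i = 0}" for i
    by (auto simp: convex_def)
  ultimately show ?thesis by (auto intro!: convex_Int convex_INT)
qed

text \<open>One complex direction contains two real ones: were both the real and the imaginary
  multiples of a unit vector on a real line, the imaginary unit would be a quotient of reals. Convex
  sets that are not collinear stay connected when countably many points are removed.\<close>

lemma not_collinear_slab:
  fixes u :: "complex ^ 'n::finite"
  assumes "i \<in> J" "\<epsilon> > 0" "\<And>i. i \<in> -J \<Longrightarrow> u $ i = 0"
  shows "\<not> collinear (slab J u \<epsilon>)"
proof
  assume "collinear (slab J u \<epsilon>)"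
  then obtain w where w: "\<And>x y. x \<in> slab J u \<epsilon> \<Longrightarrow> y \<in> slab J u \<epsilon> \<Longrightarrow> \<exists>c. x - y = c *\<^sub>R w"
    unfolding collinear_def by blast
  have in_slab: "u + axis i c \<in> slab J u \<epsilon>" if "norm c < \<epsilon>" for c
  proof -
    have "dist u (u + axis i c) < \<epsilon>" using that by (simp add: dist_norm norm_axis_complex)
    then show ?thesis using assms by (auto simp: slab_def axis_def)
  qed
  have ax: "\<exists>b. axis i c = b *\<^sub>R w" if "norm c < \<epsilon>" for c
  proof -
    have "(u + axis i c) - (u + axis i 0) = axis i c" by (simp add: vec_eq_iff axis_def)
    moreover have "\<exists>b. (u + axis i c) - (u + axis i 0) = b *\<^sub>R w"
      by (rule w[OF in_slab[OF that] in_slab]) (use \<open>\<epsilon> > 0\<close> in simp)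
    ultimately show ?thesis by metis
  qed
  have key: "\<exists>b. c = complex_of_real b * w $ i" if c: "norm c < \<epsilon>" for c
  proof -
    obtain b where "axis i c = b *\<^sub>R w" using ax[OF c] by blast
    then have "axis i c $ i = (b *\<^sub>R w) $ i" by simp
    then have "c = b *\<^sub>R (w $ i)" by (simp add: axis_def)
    then show ?thesis by (auto simp: scaleR_conv_of_real)
  qed
  obtain b where b: "complex_of_real (\<epsilon> / 2) = complex_of_real b * w $ i"
    using key[of "complex_of_real (\<epsilon> / 2)"] \<open>\<epsilon> > 0\<close> by auto
  obtain b' where b': "\<i> * complex_of_real (\<epsilon> / 2) = complex_of_real b' * w $ i"
    using key[of "\<i> * complex_of_real (\<epsilon> / 2)"] \<open>\<epsilon> > 0\<close> by (auto simp: norm_mult)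
  have "w $ i \<noteq> 0" "b \<noteq> 0" using b \<open>\<epsilon> > 0\<close> by auto
  have "complex_of_real b' * w $ i = (\<i> * complex_of_real b) * w $ i"
    using b b' by (metis mult.assoc)
  then have "complex_of_real b' = \<i> * complex_of_real b" using \<open>w $ i \<noteq> 0\<close> by simp
  then have "Im (complex_of_real b') = Im (\<i> * complex_of_real b)" by simp
  then show False using \<open>b \<noteq> 0\<close> by simp
qed

lemma disc_like_homeomorphic_image:
  fixes g :: "complex ^ 'n::finite \<Rightarrow> 'b::topological_space"
  assumes "homeomorphism B V g k" "convex B" "\<not> collinear B"
  shows "disc_like V"
  unfolding disc_like_def
proof (intro conjI allI impI)
  have "B \<noteq> {}" using assms by auto
  have "contractible B" by (rule convex_imp_contractible[OF assms(2)])
  then have "contractible_space (top_of_set B)" by (simp add: contractible_space_top_of_set)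
  moreover have "top_of_set B homeomorphic_space top_of_set V"
    using assms(1) unfolding homeomorphic_space_def homeomorphic_maps_def homeomorphism_def
    by (intro exI[of _ g] exI[of _ k]) auto
  ultimately show "contractible_space (top_of_set V)"
    using homeomorphic_space_contractibility by blast
  have "infinite B"
  proof
    assume "finite B"
    then have "B = {} \<or> (\<exists>a. B = {a})" using connected_finite_iff_sing[OF convex_connected[OF assms(2)]] by simp
    then show False using assms(3) by auto
  qed
  moreover have gk: "\<And>x. x \<in> B \<Longrightarrow> k (g x) = x" "g ` B = V" using assms(1) by (auto simp: homeomorphism_def)
  then have "inj_on g B" by (metis inj_on_inverseI)
  ultimately show "infinite V" using gk(2) finite_imageD by metis
  fix A :: "'b set" assume "finite A"
  have "g x \<notin> A" if "x \<in> B" "x \<notin> k ` (A \<inter> V)" for x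
    using that gk by (metis Int_iff image_eqI)
  moreover have "y \<in> g ` (B - k ` (A \<inter> V))" if y: "y \<in> V" "y \<notin> A" for y
  proof -
    obtain x where x: "x \<in> B" "y = g x" using y gk(2) by blast
    then have "x \<notin> k ` (A \<inter> V)" using assms(1) y unfolding homeomorphism_def by fastforce
    then show ?thesis using x by blast
  qed
  ultimately have "V - A = g ` (B - k ` (A \<inter> V))" using gk(2) by blast
  moreover have "connected (B - k ` (A \<inter> V))"
    using \<open>finite A\<close> by (intro connected_convex_diff_countable assms countable_finite) auto
  moreover have "continuous_on (B - k ` (A \<inter> V)) g"
    using assms(1) by (meson Diff_subset continuous_on_subset homeomorphism_def)
  ultimately show "connected (V - A)" by (simp add: connected_continuous_image)
qed

lemma smooth_locally_disc_like:
  fixes X :: "'n::finite cproj set"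
  assumes "smooth_of_dim d X" "d \<ge> 1"
  shows "locally_disc_like X"
  unfolding locally_disc_like_def
proof (intro ballI allI impI)
  fix x and Y :: "'n cproj set" assume x: "x \<in> X" and Y: "open Y \<and> x \<in> Y"
  obtain J u \<epsilon> \<psi> \<kappa> V where c: "card (J :: 'n set) = d" "\<epsilon> > 0" "\<And>i. i \<in> -J \<Longrightarrow> u $ i = 0"
    "openin (top_of_set X) V" "V \<subseteq> Y" "homeomorphism (slab J u \<epsilon>) V (\<lambda>w. abs_cproj (\<psi> w)) \<kappa>"
    "abs_cproj (\<psi> u) = x"
    using smooth_chart[OF assms(1) x conjunct1[OF Y] conjunct2[OF Y]] by metis
  have "u \<in> slab J u \<epsilon>" using c by (auto simp: slab_def)
  then have "x \<in> V" using c(6,7) by (auto simp: homeomorphism_def)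
  moreover obtain i where "i \<in> J" using c(1) assms(2) by (metis card.empty ex_in_conv not_one_le_zero)
  then have "disc_like V"
    by (intro disc_like_homeomorphic_image[OF c(6) convex_slab] not_collinear_slab) (use c in auto)
  ultimately show "\<exists>V. openin (top_of_set X) V \<and> x \<in> V \<and> V \<subseteq> Y \<and> disc_like V" using c by blast
qed

text \<open>Questions in several complex variables are reduced to one variable by restriction to a
  complex line of the chart. Convexity of the domain makes it connected, as analytic continuation
  requires.\<close>

lemma chart_line:
  fixes w h :: "complex ^ 'n::finite" and \<psi> :: "complex ^ 'n \<Rightarrow> complex ^ 'n"
  assumes \<psi>: "\<forall>w\<in>slab J u \<epsilon>. \<exists>D. (\<psi> has_derivative D) (at w) \<and> (\<forall>c h. D (c *s h) = c *s D h)"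
    and w: "\<forall>i\<in>-J. w $ i = 0" and h: "\<forall>i\<in>-J. h $ i = 0"
  defines "L \<equiv> {z. w + z *s h \<in> slab J u \<epsilon>}"
  shows "open L" "convex L" "p \<in> polyfuns UNIV \<Longrightarrow> (\<lambda>z. p (($) (\<psi> (w + z *s h)))) holomorphic_on L"
proof -
  have L: "L = (\<lambda>z. w + z *s h) -` ball u \<epsilon>"
    using w h by (auto simp: L_def slab_def)
  have cont: "continuous_on UNIV (\<lambda>z. w + z *s h)"
    by (intro continuous_on_add continuous_on_const linear_continuous_on bounded_linear_vector_smult)
  show "open L" unfolding L using open_vimage[OF open_ball cont] .
  show "convex L"
  proof (rule convexI)
    fix x y :: complex and a b :: real assume xy: "x \<in> L" "y \<in> L" and ab: "0 \<le> a" "0 \<le> b" "a + b = 1"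
    have "(w + (a *\<^sub>R x + b *\<^sub>R y) *s h) = a *\<^sub>R (w + x *s h) + b *\<^sub>R (w + y *s h)"
    proof -
      have "w = a *\<^sub>R w + b *\<^sub>R w" using ab by (simp add: scaleR_left_distrib[symmetric])
      moreover have "(a *\<^sub>R x + b *\<^sub>R y) *s h = a *\<^sub>R (x *s h) + b *\<^sub>R (y *s h)"
        by (simp add: vec_eq_iff algebra_simps)
      ultimately show ?thesis by (simp add: scaleR_right_distrib)
    qed
    then show "a *\<^sub>R x + b *\<^sub>R y \<in> L"
      using convexD[OF convex_slab, of "w + x *s h" J u \<epsilon> "w + y *s h" a b] xy ab by (simp add: L_def)
  qed
  assume "p \<in> polyfuns UNIV"
  then obtain g where g: "\<And>v. ((\<lambda>v. p (($) v)) has_derivative (\<lambda>h. \<Sum>i\<in>UNIV. g i (($) v) * h $ i)) (at v)"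
    using polyfun_differentiable by blast
  have "(\<lambda>z. p (($) (\<psi> (w + z *s h)))) field_differentiable at z" if z: "z \<in> L" for z
  proof -
    obtain D where D: "(\<psi> has_derivative D) (at (w + z *s h))" "\<And>c h. D (c *s h) = c *s D h"
      using \<psi> z unfolding L_def by blast
    from has_derivative_compose[OF D(1) g]
    have "((\<lambda>v. p (($) (\<psi> v))) has_derivative (\<lambda>k. \<Sum>i\<in>UNIV. g i (($) (\<psi> (w + z *s h))) * D k $ i)) (at (w + z *s h))" .
    from has_derivative_line[OF this]
    have "((\<lambda>z. p (($) (\<psi> (w + z *s h)))) has_derivative (\<lambda>s. \<Sum>i\<in>UNIV. g i (($) (\<psi> (w + z *s h))) * D (s *s h) $ i)) (at z)" .
    moreover have "(\<lambda>s. \<Sum>i\<in>UNIV. g i (($) (\<psi> (w + z *s h))) * D (s *s h) $ i) =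
        (*) (\<Sum>i\<in>UNIV. g i (($) (\<psi> (w + z *s h))) * D h $ i)"
      by (auto simp: D(2) sum_distrib_left sum_distrib_right ac_simps)
    ultimately show ?thesis unfolding field_differentiable_def has_field_derivative_def by auto
  qed
  then show "(\<lambda>z. p (($) (\<psi> (w + z *s h)))) holomorphic_on L"
    using field_differentiable_at_within holomorphic_on_def by blast
qed

text \<open>If the interior of \<open>Z\<close> meets a chart, analytic continuation along the
  complex line from a point of it to any other point of the chart shows that the chart lies in
  \<open>Z\<close>; connectedness of \<open>X\<close> does the rest. The equations of
  \<open>Z\<close> are asked for only locally, because the fibres of a morphism have no
  others.\<close>

theorem smooth_identity:
  fixes X :: "'n::finite cproj set"
  assumes X: "smooth_of_dim d X" "connected X"
    and Z: "\<And>x. x \<in> X \<Longrightarrow> \<exists>Y \<P>. open Y \<and> x \<in> Y \<and> \<P> \<subseteq> polyfuns UNIV \<and>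
       (\<forall>v. v \<noteq> 0 \<and> abs_cproj v \<in> X \<inter> Y \<longrightarrow> (abs_cproj v \<in> Z \<longleftrightarrow> (\<forall>p\<in>\<P>. p (($) v) = 0)))"
    and T: "openin (top_of_set X) T" "T \<noteq> {}" "T \<subseteq> Z"
  shows "X \<subseteq> Z"
proof
  fix b assume b: "b \<in> X"
  define intr where "intr x \<longleftrightarrow> (\<exists>T. openin (top_of_set X) T \<and> x \<in> T \<and> T \<subseteq> Z)" for x
  obtain a where a: "a \<in> T" using T by auto
  then have "a \<in> X" using T(1) openin_imp_subset by blast
  have "intr b"
  proof (rule connected_induction_simple[OF X(2) \<open>a \<in> X\<close> b])
    show "intr a" using a T unfolding intr_def by blast
    fix x assume x: "x \<in> X"
    obtain Y \<P> where Y: "open Y" "x \<in> Y" "\<P> \<subseteq> polyfuns UNIV"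
      and Z': "\<And>v. v \<noteq> 0 \<Longrightarrow> abs_cproj v \<in> X \<inter> Y \<Longrightarrow> abs_cproj v \<in> Z \<longleftrightarrow> (\<forall>p\<in>\<P>. p (($) v) = 0)"
      using Z[OF x] by blast
    obtain J u \<epsilon> \<psi> \<kappa> V where c: "card (J :: 'n set) = d" "\<epsilon> > 0" "\<And>i. i \<in> -J \<Longrightarrow> u $ i = 0"
      "openin (top_of_set X) V" "V \<subseteq> Y" "homeomorphism (slab J u \<epsilon>) V (\<lambda>w. abs_cproj (\<psi> w)) \<kappa>"
      "abs_cproj (\<psi> u) = x" "\<And>w. w \<in> slab J u \<epsilon> \<Longrightarrow> \<psi> w \<noteq> 0"
      "\<And>w. w \<in> slab J u \<epsilon> \<Longrightarrow> \<exists>D. (\<psi> has_derivative D) (at w) \<and> (\<forall>c h. D (c *s h) = c *s D h)"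
      by (rule smooth_chart[OF X(1) x Y(1,2)]) (rule that; assumption)
    have "u \<in> slab J u \<epsilon>" using c by (auto simp: slab_def)
    then have "x \<in> V" using c(6,7) by (auto simp: homeomorphism_def)
    have hom: "\<And>w. w \<in> slab J u \<epsilon> \<Longrightarrow> abs_cproj (\<psi> w) \<in> V" "\<And>y. y \<in> V \<Longrightarrow> \<kappa> y \<in> slab J u \<epsilon>"
      "\<And>y. y \<in> V \<Longrightarrow> abs_cproj (\<psi> (\<kappa> y)) = y"
      using c(6) by (auto simp: homeomorphism_def)
    have VX: "V \<subseteq> X" using c(4) openin_imp_subset by blast
    have "V \<subseteq> Z" if y1: "y1 \<in> V" "intr y1" for y1
    proof
      fix y assume y: "y \<in> V"
      obtain T1 where T1: "openin (top_of_set X) T1" "y1 \<in> T1" "T1 \<subseteq> Z" using y1 by (auto simp: intr_def)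
      then obtain O1 where O1: "open O1" "T1 = X \<inter> O1" by (auto simp: openin_open)
      \<comment> \<open>The complex line that passes through \<open>y1\<close> at parameter 0 and
        through \<open>y\<close> at parameter 1, in the coordinates of the chart.\<close>
      define h where "h = \<kappa> y - \<kappa> y1"
      define L where "L = {z. \<kappa> y1 + z *s h \<in> slab J u \<epsilon>}"
      have der: "\<forall>w\<in>slab J u \<epsilon>. \<exists>D. (\<psi> has_derivative D) (at w) \<and> (\<forall>c h. D (c *s h) = c *s D h)"
        using c(9) by blast
      have off: "\<forall>i\<in>-J. \<kappa> y1 $ i = 0" "\<forall>i\<in>-J. h $ i = 0"
        using hom(2)[OF y] hom(2)[OF y1(1)] by (auto simp: slab_def h_def)
      note line = chart_line[of J u \<epsilon> \<psi> "\<kappa> y1" h, OF der off, folded L_def]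
      have "0 \<in> L" "1 \<in> L" using hom(2)[OF y] hom(2)[OF y1(1)] by (auto simp: L_def h_def)
      define q where "q z = abs_cproj (\<psi> (\<kappa> y1 + z *s h))" for z
      have contq: "continuous_on L q"
      proof -
        have "continuous_on (slab J u \<epsilon>) (\<lambda>w. abs_cproj (\<psi> w))" using c(6) by (auto simp: homeomorphism_def)
        moreover have "continuous_on L (\<lambda>z. \<kappa> y1 + z *s h)"
          by (intro continuous_on_add continuous_on_const linear_continuous_on bounded_linear_vector_smult)
        ultimately show ?thesis unfolding q_def
          by (rule continuous_on_compose2) (auto simp: L_def)
      qed
      define E where "E = q -` O1 \<inter> L"
      have "open E" unfolding E_def using contq line(1) O1(1) continuous_on_open_vimage by blast
      have q0: "q 0 = y1" using hom(3) y1 by (simp add: q_def)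
      have "0 \<in> E" using \<open>0 \<in> L\<close> q0 T1 O1 by (auto simp: E_def)
      have "p (($) (\<psi> (\<kappa> y1 + 1 *s h))) = 0" if "p \<in> \<P>" for p
      proof (rule analytic_continuation_open[OF \<open>open E\<close> line(1) _ convex_connected[OF line(2)] _ line(3) holomorphic_on_const _ \<open>1 \<in> L\<close>])
        show "E \<noteq> {}" "E \<subseteq> L" using \<open>0 \<in> E\<close> by (auto simp: E_def)
        show "p \<in> polyfuns UNIV" using that Y by auto
        fix z assume z: "z \<in> E"
        then have s: "\<kappa> y1 + z *s h \<in> slab J u \<epsilon>" by (auto simp: E_def L_def)
        have "q z \<in> X" using hom(1)[OF s] VX by (auto simp: q_def)
        then have "q z \<in> T1" using z O1 by (auto simp: E_def)
        then have "abs_cproj (\<psi> (\<kappa> y1 + z *s h)) \<in> Z" using T1 by (auto simp: q_def)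
        moreover have "abs_cproj (\<psi> (\<kappa> y1 + z *s h)) \<in> X \<inter> Y" using hom(1)[OF s] VX c(5) by auto
        ultimately show "p (($) (\<psi> (\<kappa> y1 + z *s h))) = 0" using Z'[OF c(8)[OF s]] that by blast
      qed
      then have "\<forall>p\<in>\<P>. p (($) (\<psi> (\<kappa> y))) = 0" by (simp add: h_def)
      then have "abs_cproj (\<psi> (\<kappa> y)) \<in> Z"
        using Z'[OF c(8)[OF hom(2)[OF y]]] hom(3)[OF y] y VX c(5) by auto
      then show "y \<in> Z" using hom(3)[OF y] by simp
    qed
    then show "\<exists>V. openin (top_of_set X) V \<and> x \<in> V \<and> (\<forall>x\<in>V. \<forall>y\<in>V. intr x \<longrightarrow> intr y)"
      using c(4) \<open>x \<in> V\<close> unfolding intr_def by blast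
  qed
  then show "b \<in> Z" by (auto simp: intr_def)
qed

text \<open>In dimension 1 the chart has a single complex coordinate, of which \<open>P\<close> is a
  holomorphic function. If its zeros accumulated at the centre, \<open>P\<close> would vanish on the
  chart and, by \<open>smooth_identity\<close>, on all of \<open>X\<close>.\<close>

lemma smooth_curve_zeros_isolated:
  fixes X :: "'n::finite cproj set"
  assumes X: "smooth_of_dim 1 X" "connected X" and P: "homogeneous_poly e P"
    and nz: "\<not> X \<subseteq> zero_locus {P}" and x: "x \<in> X"
  shows "\<exists>Y. open Y \<and> x \<in> Y \<and> X \<inter> zero_locus {P} \<inter> Y \<subseteq> {x}"
proof -
  have ex: "\<forall>Q\<in>{P}. \<exists>d. homogeneous_poly d Q" using P by auto
  obtain J u \<epsilon> \<psi> \<kappa> V where c: "card (J :: 'n set) = 1" "\<epsilon> > 0" "\<And>i. i \<in> -J \<Longrightarrow> u $ i = 0"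
    "openin (top_of_set X) V" "V \<subseteq> UNIV" "homeomorphism (slab J u \<epsilon>) V (\<lambda>w. abs_cproj (\<psi> w)) \<kappa>"
    "abs_cproj (\<psi> u) = x" "\<And>w. w \<in> slab J u \<epsilon> \<Longrightarrow> \<psi> w \<noteq> 0"
    "\<And>w. w \<in> slab J u \<epsilon> \<Longrightarrow> \<exists>D. (\<psi> has_derivative D) (at w) \<and> (\<forall>c h. D (c *s h) = c *s D h)"
    by (rule smooth_chart[OF X(1) x open_UNIV UNIV_I]) (rule that; assumption)
  obtain i where J: "J = {i}" using c(1) card_1_singletonE by blast
  have us: "u \<in> slab J u \<epsilon>" using c by (auto simp: slab_def)
  then have "x \<in> V" using c(6,7) by (auto simp: homeomorphism_def)
  have hom: "\<And>w. w \<in> slab J u \<epsilon> \<Longrightarrow> abs_cproj (\<psi> w) \<in> V" "\<And>y. y \<in> V \<Longrightarrow> \<kappa> y \<in> slab J u \<epsilon>"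
    "\<And>y. y \<in> V \<Longrightarrow> abs_cproj (\<psi> (\<kappa> y)) = y" "\<And>w. w \<in> slab J u \<epsilon> \<Longrightarrow> \<kappa> (abs_cproj (\<psi> w)) = w"
    using c(6) by (auto simp: homeomorphism_def)
  define L where "L = {z. u + z *s axis i 1 \<in> slab J u \<epsilon>}"
  have der: "\<forall>w\<in>slab J u \<epsilon>. \<exists>D. (\<psi> has_derivative D) (at w) \<and> (\<forall>c h. D (c *s h) = c *s D h)"
    using c(9) by blast
  have off: "\<forall>l\<in>-J. u $ l = 0" "\<forall>l\<in>-J. axis i 1 $ l = (0 :: complex)" using c(3) by (auto simp: J axis_def)
  note line = chart_line[of J u \<epsilon> \<psi> u "axis i 1", OF der off, folded L_def]
  have "0 \<in> L" using us by (simp add: L_def)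
  define q where "q z = P (\<psi> (u + z *s axis i 1))" for z
  have holq: "q holomorphic_on L"
    using line(3)[OF homogeneous_polyfun[OF P]] by (simp add: q_def[abs_def])
  have coord: "w = u + (w $ i - u $ i) *s axis i 1" if "w \<in> slab J u \<epsilon>" for w
    using that c(3) by (auto simp: slab_def J vec_eq_iff axis_def)
  have zero_iff: "y \<in> zero_locus {P} \<longleftrightarrow> q (\<kappa> y $ i - u $ i) = 0" if "y \<in> V" for y
  proof -
    have k: "\<kappa> y \<in> slab J u \<epsilon>" using hom(2)[OF that] .
    have "abs_cproj (\<psi> (\<kappa> y)) \<in> zero_locus {P} \<longleftrightarrow> P (\<psi> (\<kappa> y)) = 0"
      using in_zero_locus[OF ex c(8)[OF k]] by simp
    then show ?thesis using hom(3)[OF that] coord[OF k] by (simp add: q_def)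
  qed
  have inL: "\<kappa> y $ i - u $ i \<in> L" if "y \<in> V" for y
    using coord[OF hom(2)[OF that]] hom(2)[OF that] by (simp add: L_def)
  have "\<not> 0 islimpt {z \<in> L. q z = 0}"
  proof
    assume lim: "0 islimpt {z \<in> L. q z = 0}"
    have "q z = 0" if "z \<in> L" for z
      by (rule analytic_continuation[OF holq line(1) convex_connected[OF line(2)] _ \<open>0 \<in> L\<close> lim _ that]) auto
    then have VZ: "V \<subseteq> zero_locus {P}" using zero_iff inL by blast
    have "X \<subseteq> zero_locus {P}"
    proof (rule smooth_identity[OF X _ c(4)])
      fix x assume "x \<in> X"
      show "\<exists>Y \<P>. open Y \<and> x \<in> Y \<and> \<P> \<subseteq> polyfuns UNIV \<and>
        (\<forall>v. v \<noteq> 0 \<and> abs_cproj v \<in> X \<inter> Y \<longrightarrow> (abs_cproj v \<in> zero_locus {P} \<longleftrightarrow> (\<forall>p\<in>\<P>. p (($) v) = 0)))"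
        by (rule exI[of _ UNIV], rule exI[of _ "{\<lambda>x. P (vec_lambda x)}"])
          (use in_zero_locus[OF ex] homogeneous_polyfun[OF P] in auto)
    qed (use \<open>x \<in> V\<close> VZ in auto)
    then show False using nz by blast
  qed
  then obtain \<delta> where \<delta>: "\<delta> > 0" "\<And>z. z \<in> L \<Longrightarrow> q z = 0 \<Longrightarrow> dist z 0 < \<delta> \<Longrightarrow> z = 0"
    unfolding islimpt_approachable by fastforce
  have "continuous_on V (\<lambda>y. \<kappa> y $ i - u $ i)"
    using c(6) by (auto simp: homeomorphism_def intro!: continuous_intros)
  then have "openin (top_of_set V) (V \<inter> (\<lambda>y. \<kappa> y $ i - u $ i) -` ball 0 \<delta>)"
    by (rule continuous_openin_preimage_gen) auto
  then have "openin (top_of_set X) (V \<inter> (\<lambda>y. \<kappa> y $ i - u $ i) -` ball 0 \<delta>)"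
    using c(4) openin_trans by blast
  then obtain Y where Y: "open Y" "V \<inter> (\<lambda>y. \<kappa> y $ i - u $ i) -` ball 0 \<delta> = X \<inter> Y" by (auto simp: openin_open)
  have kx: "\<kappa> x = u" using hom(4)[OF us] c(7) by simp
  have "x \<in> Y" using Y(2) \<open>x \<in> V\<close> kx \<delta>(1) x by auto
  moreover have "y = x" if "y \<in> X \<inter> zero_locus {P} \<inter> Y" for y
  proof -
    have y: "y \<in> V" "dist (\<kappa> y $ i - u $ i) 0 < \<delta>" using Y(2) that by (auto simp: dist_commute)
    then have "\<kappa> y $ i - u $ i = 0" using \<delta>(2)[OF inL[OF y(1)]] zero_iff[OF y(1)] that by auto
    then have "\<kappa> y = u" using coord[OF hom(2)[OF y(1)]] by simp
    then show ?thesis using hom(3)[OF y(1)] c(7) by simp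
  qed
  ultimately show ?thesis using Y(1) by blast
qed

section \<open>Nonempty Zariski open subsets of the curve are cofinite\<close>

lemma discrete_countable:
  fixes C :: "'a::second_countable_topology set"
  assumes "\<And>x. x \<in> C \<Longrightarrow> \<exists>Y. open Y \<and> x \<in> Y \<and> C \<inter> Y \<subseteq> {x}"
  shows "countable C"
proof -
  obtain \<B> :: "'a set set" where B: "countable \<B>" "topological_basis \<B>" using ex_countable_basis by blast
  have "\<exists>b\<in>\<B>. C \<inter> b = {x}" if "x \<in> C" for x
  proof -
    obtain Y where Y: "open Y" "x \<in> Y" "C \<inter> Y \<subseteq> {x}" using assms \<open>x \<in> C\<close> by blast
    obtain b where "b \<in> \<B>" "x \<in> b" "b \<subseteq> Y" using topological_basisE[OF B(2) Y(1,2)] by blast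
    then show ?thesis using Y \<open>x \<in> C\<close> by blast
  qed
  then obtain b where b: "\<And>x. x \<in> C \<Longrightarrow> b x \<in> \<B>" "\<And>x. x \<in> C \<Longrightarrow> C \<inter> b x = {x}" by metis
  have "inj_on b C" by (rule inj_onI) (metis b(2) singleton_inject)
  moreover have "countable (b ` C)" using B(1) b(1) by (metis countable_subset image_subsetI)
  ultimately show ?thesis using countable_image_inj_on by blast
qed

text \<open>One form \<open>P1\<close> out of the equations of the complement, nonzero at some point
  of \<open>U\<close>, has isolated zeros on \<open>S\<close>, and they include
  \<open>S - U\<close>. Constructible sets live in affine space; therefore the zeros are cut into
  the finitely many pieces \<open>C j\<close> on which coordinate \<open>j\<close> can be normalised
  to 1.\<close>

theorem curve_zariski_open_cofinite:
  fixes S :: "'n::finite cproj set"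
  assumes S: "quasi_projective S" "smooth_of_dim 1 S" "connected S" and U: "zariski_openin S U" "U \<noteq> {}"
  shows "finite (S - U)"
proof -
  obtain Z W where ZW: "zariski_closed Z" "zariski_open W" "S = Z \<inter> W"
    using S(1) unfolding quasi_projective_def zariski_openin_def by blast
  obtain W' where W': "zariski_open W'" "U = S \<inter> W'" using U(1) unfolding zariski_openin_def by blast
  obtain \<Q> where Q: "\<forall>P\<in>\<Q>. \<exists>d. homogeneous_poly d P" "Z = zero_locus \<Q>"
    using ZW(1) unfolding zariski_closed_def by blast
  obtain \<R> where R: "\<forall>P\<in>\<R>. \<exists>d. homogeneous_poly d P" "- W = zero_locus \<R>"
    using ZW(2) unfolding zariski_open_def zariski_closed_def by blast
  obtain \<P> where P: "\<forall>P\<in>\<P>. \<exists>d. homogeneous_poly d P" "- W' = zero_locus \<P>"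
    using W'(1) unfolding zariski_open_def zariski_closed_def by blast
  obtain y where y: "y \<in> U" using U(2) by blast
  obtain v where v: "v \<noteq> 0" "y = abs_cproj v" by (rule cproj_cases)
  have "y \<notin> zero_locus \<P>" using y W' P(2) by auto
  then obtain P1 where P1: "P1 \<in> \<P>" "P1 v \<noteq> 0" using in_zero_locus[OF P(1) v(1)] v by auto
  obtain e where e: "homogeneous_poly e P1" using P(1) P1 by blast
  then have e': "\<forall>P\<in>{P1}. \<exists>d. homogeneous_poly d P" by auto
  define T where "T = S \<inter> zero_locus {P1}"
  have "y \<notin> zero_locus {P1}" using in_zero_locus[OF e' v(1)] v P1 by auto
  then have nz: "\<not> S \<subseteq> zero_locus {P1}" using y W' by auto
  have iso: "\<exists>Y. open Y \<and> x \<in> Y \<and> T \<inter> Y \<subseteq> {x}" if "x \<in> T" for x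
    using smooth_curve_zeros_isolated[OF S(2,3) e nz, of x] that by (auto simp: T_def)
  have sub: "S - U \<subseteq> T"
  proof
    fix x assume x: "x \<in> S - U"
    obtain w where w: "w \<noteq> 0" "x = abs_cproj w" by (rule cproj_cases)
    have "x \<in> zero_locus \<P>" using x W' P(2) by auto
    then have "P1 w = 0" using in_zero_locus[OF P(1) w(1)] w P1 by auto
    then show "x \<in> T" using in_zero_locus[OF e' w(1)] w x by (auto simp: T_def)
  qed
  define fl where "fl P = (\<lambda>x. P (vec_lambda x))" for P :: "complex ^ 'n \<Rightarrow> complex"
  have "fl ` \<Q> \<subseteq> polyfuns UNIV" using Q(1) homogeneous_polyfun by (auto simp: fl_def)
  then obtain \<Q>' where Q': "finite \<Q>'" "\<Q>' \<subseteq> fl ` \<Q>" "\<And>v. (\<forall>p\<in>\<Q>'. p v = 0) \<longleftrightarrow> (\<forall>p\<in>fl ` \<Q>. p v = 0)"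
    by (rule finite_subfamily_same_zeros) (rule that; assumption)
  have "fl ` \<R> \<subseteq> polyfuns UNIV" using R(1) homogeneous_polyfun by (auto simp: fl_def)
  then obtain \<R>' where R': "finite \<R>'" "\<R>' \<subseteq> fl ` \<R>" "\<And>v. (\<forall>p\<in>\<R>'. p v = 0) \<longleftrightarrow> (\<forall>p\<in>fl ` \<R>. p v = 0)"
    by (rule finite_subfamily_same_zeros) (rule that; assumption)
  define C where "C j = {x :: 'n \<Rightarrow> complex. x j = 1 \<and> abs_cproj (vec_lambda x) \<in> T}" for j
  have finC: "finite (C j)" for j
  proof (rule countable_constructible_finite)
    have nz: "vec_lambda x \<noteq> 0" if "x j = 1" for x :: "'n \<Rightarrow> complex"
      using that by (auto simp: vec_eq_iff intro!: exI[of _ j])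
    have "C j = {x. x j - 1 = 0} \<inter> (\<Inter>p\<in>\<Q>'. {x. p x = 0}) \<inter> - (\<Inter>p\<in>\<R>'. {x. p x = 0}) \<inter> {x. fl P1 x = 0}"
    proof (rule Set.set_eqI)
      fix x :: "'n \<Rightarrow> complex"
      show "x \<in> C j \<longleftrightarrow> x \<in> {x. x j - 1 = 0} \<inter> (\<Inter>p\<in>\<Q>'. {x. p x = 0}) \<inter> - (\<Inter>p\<in>\<R>'. {x. p x = 0}) \<inter> {x. fl P1 x = 0}"
      proof (cases "x j = 1")
        case True
        note n = nz[of x, OF True]
        have "abs_cproj (vec_lambda x) \<in> Z \<longleftrightarrow> (\<forall>p\<in>\<Q>'. p x = 0)"
          unfolding Q(2) in_zero_locus[OF Q(1) n] Q'(3) by (auto simp: fl_def)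
        moreover have "abs_cproj (vec_lambda x) \<in> W \<longleftrightarrow> \<not> (\<forall>p\<in>\<R>'. p x = 0)"
          using R(2) in_zero_locus[OF R(1) n] R'(3)[of x] by (auto simp: fl_def)
        moreover have "abs_cproj (vec_lambda x) \<in> zero_locus {P1} \<longleftrightarrow> fl P1 x = 0"
          using in_zero_locus[OF e' n] by (simp add: fl_def)
        ultimately show ?thesis using True ZW(3) by (auto simp: C_def T_def)
      qed (auto simp: C_def)
    qed
    also have "\<dots> \<in> constructibles"
    proof (intro constructibles.Int constructibles.compl constructibles_INT constructibles.zeros)
      show "(\<lambda>x. x j - 1) \<in> polyfuns UNIV" by (intro polyfuns_diff polyfuns.intros) auto
      show "p \<in> polyfuns UNIV" if "p \<in> \<Q>'" for p using Q'(2) \<open>fl ` \<Q> \<subseteq> _\<close> that by auto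
      show "p \<in> polyfuns UNIV" if "p \<in> \<R>'" for p using R'(2) \<open>fl ` \<R> \<subseteq> _\<close> that by auto
      show "fl P1 \<in> polyfuns UNIV" using homogeneous_polyfun[OF e] by (simp add: fl_def)
    qed (use Q' R' in auto)
    finally show "C j \<in> constructibles" .
    have "countable (vec_lambda ` C j)"
    proof (rule discrete_countable)
      fix w assume "w \<in> vec_lambda ` C j"
      then have w: "w $ j = 1" "abs_cproj w \<in> T" by (auto simp: C_def)
      then have "w \<noteq> 0" by auto
      obtain Y where Y: "open Y" "abs_cproj w \<in> Y" "T \<inter> Y \<subseteq> {abs_cproj w}" using iso[OF w(2)] by blast
      \<comment> \<open>\<open>abs_cproj\<close> is injective on the vectors with coordinate
        \<open>j\<close> equal to 1, so isolation passes from the projective set to the affine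
        one.\<close>
      show "\<exists>Y. open Y \<and> w \<in> Y \<and> vec_lambda ` C j \<inter> Y \<subseteq> {w}"
      proof (intro exI conjI subsetI)
        show "open {v. v \<noteq> 0 \<and> abs_cproj v \<in> Y}" using Y(1) open_cproj_iff by blast
        show "w \<in> {v. v \<noteq> 0 \<and> abs_cproj v \<in> Y}" using \<open>w \<noteq> 0\<close> Y by simp
        fix z assume z: "z \<in> vec_lambda ` C j \<inter> {v. v \<noteq> 0 \<and> abs_cproj v \<in> Y}"
        then have z': "z $ j = 1" "z \<noteq> 0" "abs_cproj z = abs_cproj w" using Y(3) by (auto simp: C_def)
        then obtain c where "w = c *s z" using abs_cproj_eq_iff[OF z'(2) \<open>w \<noteq> 0\<close>] by (auto simp: cproj_rel_def)
        then show "z \<in> {w}" using w(1) z'(1) by auto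
      qed
    qed
    moreover have "inj_on (vec_lambda :: ('n \<Rightarrow> complex) \<Rightarrow> _) (C j)" by (rule inj_onI) (metis vec_lambda_beta ext)
    ultimately show "countable (C j)" using countable_image_inj_on by blast
  qed
  have "T \<subseteq> (\<Union>j. (\<lambda>x. abs_cproj (vec_lambda x)) ` C j)"
  proof
    fix x assume x: "x \<in> T"
    obtain w where w: "w \<noteq> 0" "x = abs_cproj w" by (rule cproj_cases)
    obtain j where j: "w $ j \<noteq> 0" using w by (auto simp: vec_eq_iff)
    define u where "u = (1 / w $ j) *s w"
    have "abs_cproj u = x" "u $ j = 1"
      using abs_cproj_scale[of w "1 / w $ j"] w j by (simp_all add: u_def)
    then have "($) u \<in> C j" "x = abs_cproj (vec_lambda (($) u))"
      using x by (simp_all add: C_def)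
    then show "x \<in> (\<Union>j. (\<lambda>x. abs_cproj (vec_lambda x)) ` C j)" by blast
  qed
  then have "finite T" by (rule finite_subset) (simp add: finC)
  then show ?thesis using sub finite_subset by blast
qed

section \<open>Morphisms\<close>

text \<open>\<open>rep_cproj\<close> is an arbitrary choice, but after normalisation it becomes a
  continuous local section of the quotient map. Through it the local formula of a morphism, given on
  vectors, descends to points.\<close>

lemma continuous_on_normalize:
  fixes j :: "'n::finite"
  defines "C \<equiv> {y :: 'n cproj. rep_cproj y $ j \<noteq> 0}"
  shows "open C" "continuous_on C (\<lambda>y. (1 / rep_cproj y $ j) *s rep_cproj y)"
proof -
  have rep: "\<exists>c. c \<noteq> 0 \<and> rep_cproj (abs_cproj v) = c *s v" if "v \<noteq> 0" for v :: "complex ^ 'n"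
  proof -
    have "cproj_rel v (rep_cproj (abs_cproj v))"
      using rep_abs_rsp[OF Quotient3_cproj cproj_rel_refl[OF that]] by metis
    then show ?thesis by (auto simp: cproj_rel_def)
  qed
  have memC: "abs_cproj v \<in> C \<longleftrightarrow> v $ j \<noteq> 0" if "v \<noteq> 0" for v
    using rep[OF that] by (auto simp: C_def)
  then have "{v. v \<noteq> 0 \<and> abs_cproj v \<in> C} = {v. v \<noteq> 0 \<and> v $ j \<noteq> 0}" by auto
  moreover have "open {v :: complex ^ 'n. v \<noteq> 0 \<and> v $ j \<noteq> 0}"
    by (intro open_Collect_conj open_Collect_neq continuous_intros)
  ultimately show op: "open C" by (simp add: open_cproj_iff)
  show "continuous_on C (\<lambda>y. (1 / rep_cproj y $ j) *s rep_cproj y)"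
  proof (rule continuous_on_cproj[OF op])
    have "continuous_on {v. v \<noteq> 0 \<and> abs_cproj v \<in> C} (\<lambda>v. (1 / v $ j) *s v)"
      unfolding vector_scalar_mult_def using memC by (intro continuous_intros) auto
    then show "continuous_on {v. v \<noteq> 0 \<and> abs_cproj v \<in> C} ((\<lambda>y. (1 / rep_cproj y $ j) *s rep_cproj y) \<circ> abs_cproj)"
    proof (rule continuous_on_eq)
      fix v assume "v \<in> {v. v \<noteq> 0 \<and> abs_cproj v \<in> C}"
      then obtain c where "c \<noteq> 0" "rep_cproj (abs_cproj v) = c *s v" using rep by auto
      then show "(1 / v $ j) *s v = ((\<lambda>y. (1 / rep_cproj y $ j) *s rep_cproj y) \<circ> abs_cproj) v"
        by (simp add: vec_eq_iff)
    qed
  qed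
qed

lemma continuous_on_openin_cover:
  assumes "\<And>x. x \<in> X \<Longrightarrow> \<exists>V. openin (top_of_set X) V \<and> x \<in> V \<and> continuous_on V f"
  shows "continuous_on X f"
  unfolding continuous_on_def
proof
  fix x assume "x \<in> X"
  then obtain V where V: "openin (top_of_set X) V" "x \<in> V" "continuous_on V f" using assms by blast
  then obtain Y where Y: "open Y" "V = X \<inter> Y" by (auto simp: openin_open)
  have "(f \<longlongrightarrow> f x) (at x within V)" using V by (simp add: continuous_on_def)
  moreover have "at x within X = at x within V"
    by (rule at_within_nhd[of x Y]) (use V Y in auto)
  ultimately show "(f \<longlongrightarrow> f x) (at x within X)" by simp
qed

lemma morphism_continuous_on:
  assumes "morphism M S f"
  shows "continuous_on M f"
proof (rule continuous_on_openin_cover)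
  fix x assume x: "x \<in> M"
  obtain W e Q where W: "zariski_open W" "x \<in> W" "\<forall>j. homogeneous_poly e (\<lambda>v. Q v $ j)"
    "\<And>v. v \<noteq> 0 \<Longrightarrow> abs_cproj v \<in> M \<inter> W \<Longrightarrow> Q v \<noteq> 0 \<and> f (abs_cproj v) = abs_cproj (Q v)"
    using assms x unfolding morphism_def by metis
  have rep: "rep_cproj y \<noteq> 0" "abs_cproj (rep_cproj y) = y" for y :: "'a cproj"
    using Quotient_rep_reflp[OF Quotient_cproj, of y] Quotient_abs_rep[OF Quotient_cproj, of y]
    by (auto simp: cproj_rel_def)
  obtain j where j: "rep_cproj x $ j \<noteq> 0" using rep(1)[of x] by (auto simp: vec_eq_iff)
  let ?C = "{y. rep_cproj y $ j \<noteq> 0}" and ?a = "\<lambda>y. (1 / rep_cproj y $ j) *s rep_cproj y"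
  let ?V = "M \<inter> (W \<inter> ?C)"
  have "openin (top_of_set M) ?V"
    using zariski_open_imp_open[OF W(1)] continuous_on_normalize(1)[of j] by (auto intro!: openin_open_Int)
  moreover have "continuous_on ?V f"
  proof -
    have a: "?a y \<noteq> 0" "abs_cproj (?a y) = y" if "y \<in> ?C" for y
      using that rep abs_cproj_scale[OF rep(1)[of y], of "1 / rep_cproj y $ j"] by auto
    have "continuous_on X Q" for X
    proof -
      have ci: "continuous_on X (\<lambda>v. Q v $ i)" for i using W(3) homogeneous_continuous_on by blast
      have "continuous_on X (\<lambda>v. \<chi> i. Q v $ i)" by (rule continuous_on_vec_lambda) (rule ci)
      then show ?thesis by (simp add: vec_lambda_eta)
    qed
    then have "continuous_on ?V (\<lambda>y. Q (?a y))"
      by (rule continuous_on_compose2[OF _ continuous_on_subset[OF continuous_on_normalize(2)[of j]]]) auto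
    then have "continuous_on ?V (\<lambda>y. abs_cproj (Q (?a y)))"
    proof (rule continuous_on_compose2[OF continuous_on_abs_cproj], intro image_subsetI)
      fix y assume "y \<in> ?V"
      then show "Q (?a y) \<in> - {0}" using W(4)[of "?a y"] a[of y] by auto
    qed
    then show ?thesis
    proof (rule continuous_on_eq)
      fix y assume "y \<in> ?V"
      then show "abs_cproj (Q (?a y)) = f y" using W(4)[of "?a y"] a[of y] by auto
    qed
  qed
  ultimately show "\<exists>V. openin (top_of_set M) V \<and> x \<in> V \<and> continuous_on V f" using x W(2) j by blast
qed

text \<open>Locally a point lies in the fibre if its image vector is proportional to
  \<open>w\<close>, that is, if polynomial minors vanish. By the identity theorem a fibre with
  interior is all of \<open>M\<close>, and then \<open>S\<close> is a single point.\<close>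

theorem morphism_fiber_no_interior:
  fixes M :: "'n::finite cproj set" and S :: "'m::finite cproj set"
  assumes M: "smooth_of_dim d M" "connected M" and f: "morphism M S f" "f ` M = S"
    and S: "infinite S" and T: "openin (top_of_set M) T" "T \<subseteq> f -` {s}"
  shows "T = {}"
proof (rule ccontr)
  assume "T \<noteq> {}"
  obtain w where w: "w \<noteq> 0" "s = abs_cproj w" by (rule cproj_cases)
  have "M \<subseteq> f -` {s}"
  proof (rule smooth_identity[OF M _ T(1) \<open>T \<noteq> {}\<close> T(2)])
    fix x assume x: "x \<in> M"
    obtain W e Q where W: "zariski_open W" "x \<in> W" "\<forall>j. homogeneous_poly e (\<lambda>v. Q v $ j)"
      "\<And>v. v \<noteq> 0 \<Longrightarrow> abs_cproj v \<in> M \<inter> W \<Longrightarrow> Q v \<noteq> 0 \<and> f (abs_cproj v) = abs_cproj (Q v)"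
      using f(1) x unfolding morphism_def by metis
    let ?p = "\<lambda>(i, j) x. Q (vec_lambda x) $ i * w $ j - Q (vec_lambda x) $ j * w $ i"
    have "abs_cproj v \<in> f -` {s} \<longleftrightarrow> (\<forall>p\<in>range ?p. p (($) v) = 0)"
      if "v \<noteq> 0" "abs_cproj v \<in> M \<inter> W" for v
    proof -
      have Q: "Q v \<noteq> 0" "f (abs_cproj v) = abs_cproj (Q v)" using W(4)[OF that] by auto
      then have "abs_cproj v \<in> f -` {s} \<longleftrightarrow> cproj_rel (Q v) w" using abs_cproj_eq_iff[OF Q(1) w(1)] w by simp
      also have "\<dots> \<longleftrightarrow> (\<forall>i j. Q v $ i * w $ j = Q v $ j * w $ i)" by (rule cproj_rel_iff_minors[OF Q(1) w(1)])
      finally show ?thesis by (auto simp: vec_lambda_eta)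
    qed
    moreover have "range ?p \<subseteq> polyfuns UNIV"
    proof (clarsimp)
      fix i j
      show "(\<lambda>x. Q (vec_lambda x) $ i * w $ j - Q (vec_lambda x) $ j * w $ i) \<in> polyfuns UNIV"
        using homogeneous_polyfun W(3) by (intro polyfuns_diff polyfuns.mult polyfuns.const) auto
    qed
    ultimately show "\<exists>Y \<P>. open Y \<and> x \<in> Y \<and> \<P> \<subseteq> polyfuns UNIV \<and>
       (\<forall>v. v \<noteq> 0 \<and> abs_cproj v \<in> M \<inter> Y \<longrightarrow> (abs_cproj v \<in> f -` {s} \<longleftrightarrow> (\<forall>p\<in>\<P>. p (($) v) = 0)))"
      using zariski_open_imp_open[OF W(1)] W(2) by (intro exI[of _ W] exI[of _ "range ?p"]) blast
  qed
  then have "S \<subseteq> {s}" using f(2) by auto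
  then show False using S finite_subset by auto
qed

section \<open>Cycles and paths\<close>

declare One_nat_def [simp del]

abbreviation is_cycle :: "'a::topological_space set \<Rightarrow> 'a chain \<Rightarrow> bool" where
  "is_cycle X c \<equiv> singular_relcycle 1 (top_of_set X) {} c"

text \<open>The barycentric coordinate \<open>x 1\<close> is the parameter, as in
  \<open>loop_class\<close>, which is thus the class of this chain.\<close>

definition path_chain :: "(real \<Rightarrow> 'a) \<Rightarrow> 'a chain" where
  "path_chain \<gamma> = frag_of (\<lambda>x\<in>standard_simplex 1. \<gamma> (x 1))"

definition point_chain :: "'a \<Rightarrow> 'a chain" where
  "point_chain x = frag_of (\<lambda>y\<in>standard_simplex 0. x)"

lemma sum_atMost_1: "(\<Sum>i\<le>1. f i) = f 0 + f (1 :: nat)"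
  by (simp add: One_nat_def)

lemma standard_simplex_1: "x \<in> standard_simplex 1 \<Longrightarrow> 0 \<le> x 1 \<and> x 1 \<le> 1 \<and> x 0 = 1 - x 1"
  by (auto simp: standard_simplex_def sum_atMost_1)

lemma path_chain_cong:
  assumes "\<And>t. 0 \<le> t \<Longrightarrow> t \<le> 1 \<Longrightarrow> \<gamma> t = \<delta> t"
  shows "path_chain \<gamma> = path_chain \<delta>"
  unfolding path_chain_def using assms standard_simplex_1 by (metis (no_types, lifting) restrict_ext)

lemma singular_simplex_path:
  assumes "path \<gamma>" "path_image \<gamma> \<subseteq> X"
  shows "singular_simplex 1 (top_of_set X) (\<lambda>x\<in>standard_simplex 1. \<gamma> (x 1))"
  unfolding singular_simplex_def
proof
  let ?S = "subtopology (powertop_real UNIV) (standard_simplex 1)"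
  have "continuous_map ?S euclideanreal (\<lambda>x. x 1)"
    by (intro continuous_map_from_subtopology continuous_map_product_projection) auto
  then have "continuous_map ?S (top_of_set {0..1}) (\<lambda>x. x 1)"
    using standard_simplex_1 by (auto simp: continuous_map_in_subtopology)
  moreover have "continuous_map (top_of_set {0..1}) (top_of_set X) \<gamma>"
    using assms by (auto simp: path_def path_image_def)
  ultimately have "continuous_map ?S (top_of_set X) (\<gamma> \<circ> (\<lambda>x. x 1))" by (rule continuous_map_compose)
  then show "continuous_map ?S (top_of_set X) (\<lambda>x\<in>standard_simplex 1. \<gamma> (x 1))"
    by (rule continuous_map_eq) (auto simp: restrict_def)
qed auto

lemma singular_chain_path:
  "path \<gamma> \<Longrightarrow> path_image \<gamma> \<subseteq> X \<Longrightarrow> singular_chain 1 (top_of_set X) (path_chain \<gamma>)"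
  unfolding path_chain_def singular_chain_of by (rule singular_simplex_path)

text \<open>Face 0 omits vertex 0 and is therefore the end point, face 1 the starting point.\<close>

lemma singular_face_1:
  "singular_face 1 0 \<sigma> = (\<lambda>y\<in>standard_simplex 0. \<sigma> (\<lambda>i. if i = 1 then 1 else 0))"
  "singular_face 1 1 \<sigma> = (\<lambda>y\<in>standard_simplex 0. \<sigma> (\<lambda>i. if i = 0 then 1 else 0))"
proof -
  have f: "simplical_face 0 (\<lambda>j. if j = 0 then 1 else 0) = (\<lambda>i. if i = 1 then 1 else (0::real))"
       "simplical_face 1 (\<lambda>j. if j = 0 then 1 else 0) = (\<lambda>i. if i = 0 then 1 else (0::real))"
    by (auto simp: simplical_face_def fun_eq_iff)
  show "singular_face 1 0 \<sigma> = (\<lambda>y\<in>standard_simplex 0. \<sigma> (\<lambda>i. if i = 1 then 1 else 0))"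
    "singular_face 1 1 \<sigma> = (\<lambda>y\<in>standard_simplex 0. \<sigma> (\<lambda>i. if i = 0 then 1 else 0))"
    unfolding singular_face_def by (rule ext, simp add: standard_simplex_0 f restrict_def One_nat_def[symmetric])+
qed

abbreviation simplex_start where "simplex_start \<sigma> \<equiv> \<sigma> (\<lambda>i::nat. if i = 0 then 1 else (0::real))"
abbreviation simplex_end where "simplex_end \<sigma> \<equiv> \<sigma> (\<lambda>i::nat. if i = 1 then 1 else (0::real))"

lemma chain_boundary_1:
  "chain_boundary 1 (frag_of \<sigma>) = point_chain (simplex_end \<sigma>) - point_chain (simplex_start \<sigma>)"
  unfolding point_chain_def singular_face_1[symmetric]
  by (simp add: chain_boundary_of sum_atMost_1)

lemma vertices_in_simplex_1:
  "(\<lambda>i. if i = 1 then 1 else 0) \<in> standard_simplex 1" "(\<lambda>i. if i = 0 then 1 else 0) \<in> standard_simplex 1"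
  by auto

lemma chain_boundary_path:
  "chain_boundary 1 (path_chain \<gamma>) = point_chain (pathfinish \<gamma>) - point_chain (pathstart \<gamma>)"
  unfolding path_chain_def chain_boundary_1 using vertices_in_simplex_1
  by (simp add: pathfinish_def pathstart_def del: basis_in_standard_simplex)

lemma simplex_as_path:
  assumes "singular_simplex 1 (top_of_set X) \<sigma>"
  obtains \<gamma> where "path \<gamma>" "path_image \<gamma> = \<sigma> ` standard_simplex 1" "path_image \<gamma> \<subseteq> X" "frag_of \<sigma> = path_chain \<gamma>"
    "pathstart \<gamma> = simplex_start \<sigma>" "pathfinish \<gamma> = simplex_end \<sigma>"
proof -
  define v where "v t = (\<lambda>i::nat. if i = 0 then 1 - t else if i = 1 then t else (0::real))" for t
  have v: "v t \<in> standard_simplex 1" if "0 \<le> t" "t \<le> 1" for t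
    using that by (auto simp: v_def standard_simplex_def sum_atMost_1)
  have v1: "v (x 1) = x" if "x \<in> standard_simplex 1" for x
    using that by (auto simp: v_def standard_simplex_def sum_atMost_1 fun_eq_iff)
  let ?S = "subtopology (powertop_real UNIV) (standard_simplex 1)"
  have "continuous_map (top_of_set {0..1}) (powertop_real UNIV) v"
    unfolding continuous_map_componentwise_UNIV
  proof
    fix k :: nat
    show "continuous_map (top_of_set {0..1}) euclideanreal (\<lambda>x. v x k)"
      by (cases "k = 0"; cases "k = 1") (auto simp: v_def intro!: continuous_intros)
  qed
  then have "continuous_map (top_of_set {0..1}) ?S v" using v by (auto simp: continuous_map_in_subtopology)
  moreover have s: "continuous_map ?S (top_of_set X) \<sigma>" "\<sigma> \<in> extensional (standard_simplex 1)"
    using assms by (auto simp: singular_simplex_def)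
  ultimately have "continuous_map (top_of_set {0..1}) (top_of_set X) (\<sigma> \<circ> v)" by (blast intro: continuous_map_compose)
  then have "path (\<sigma> \<circ> v)" "path_image (\<sigma> \<circ> v) \<subseteq> X" by (auto simp: path_def path_image_def)
  moreover have "path_image (\<sigma> \<circ> v) = \<sigma> ` standard_simplex 1"
  proof -
    have "v ` {0..1} = standard_simplex 1"
      using v v1 standard_simplex_1 by (auto simp: image_iff) (metis atLeastAtMost_iff)
    then show ?thesis by (metis image_comp path_image_def)
  qed
  moreover have "frag_of \<sigma> = path_chain (\<sigma> \<circ> v)"
    unfolding path_chain_def
  proof (rule arg_cong[where f = frag_of], rule ext)
    fix x show "\<sigma> x = (\<lambda>x\<in>standard_simplex 1. (\<sigma> \<circ> v) (x 1)) x"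
      using s(2) v1[of x] by (cases "x \<in> standard_simplex 1") (simp_all add: extensional_def)
  qed
  moreover have "v 0 = (\<lambda>i. if i = 0 then 1 else 0)" "v 1 = (\<lambda>i. if i = 1 then 1 else 0)"
    by (auto simp: v_def fun_eq_iff)
  ultimately show ?thesis using that[of "\<sigma> \<circ> v"] by (simp add: pathstart_def pathfinish_def)
qed

lemma chain_map_path: "chain_map 1 g (path_chain \<alpha>) = path_chain (g \<circ> \<alpha>)"
  by (auto simp: path_chain_def simplex_map_def intro!: arg_cong[where f = frag_of])

text \<open>The identity is homotopic to a constant map, and in a one-point space every 1-cycle
  bounds.\<close>

lemma contractible_cycle_boundary:
  assumes "contractible_space X" "singular_relcycle 1 X {} c"
  shows "singular_relboundary 1 X {} c"
proof (cases "topspace X = {}")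
  case True
  then have "c = 0" using assms(2) by (simp add: singular_relcycle_def singular_chain_empty)
  then show ?thesis by simp
next
  case False
  then obtain a where a: "a \<in> topspace X" by blast
  have h: "homotopic_with (\<lambda>x. True) X X id (\<lambda>x. a)" using iffD1[OF contractible_space_alt assms(1)] a by blast
  have "homologous_rel 1 X {} (chain_map 1 id c) (chain_map 1 (\<lambda>x. a) c)"
    by (rule homotopic_imp_homologous_rel_chain_maps[where T = "{}" and S = X]) (use h assms(2) in auto)
  moreover have "chain_map 1 id c = c"
    using assms(2) chain_map_id_gen[of 1 X c id] by (auto simp: singular_relcycle_def)
  moreover have "singular_relboundary 1 X {} (chain_map 1 (\<lambda>x. a) c)"
  proof -
    have "singular_relcycle 1 (subtopology X {a}) {} (chain_map 1 (\<lambda>x. a) c)"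
      by (rule singular_relcycle_chain_map[OF assms(2)]) (use a in auto)
    then have "singular_relboundary 1 (subtopology X {a}) {} (chain_map 1 (\<lambda>x. a) c)"
      using singular_boundary_eq_cycle_singleton[of "subtopology X {a}" a 1] a by auto
    then show ?thesis by (metis singular_boundary_mono subset_UNIV subtopology_UNIV)
  qed
  ultimately show ?thesis
    unfolding homologous_rel_def using singular_relboundary_add by fastforce
qed

text \<open>The source of all relations between reparametrised paths: it remains to check, by
  looking at end points, that a chain in the unit interval is a cycle. No 2-simplices have to be
  written down.\<close>

lemma interval_cycle_push:
  fixes c :: "real chain"
  assumes "path \<gamma>" "path_image \<gamma> \<subseteq> X" "is_cycle {0..1} c"
  shows "singular_relboundary 1 (top_of_set X) {} (chain_map 1 \<gamma> c)"
proof -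
  have "contractible ({0..1} :: real set)" by (rule convex_imp_contractible) simp
  then have "singular_relboundary 1 (top_of_set {0..1}) {} c"
    using contractible_cycle_boundary[of "top_of_set {0..1 :: real}"] assms(3) by simp
  then show ?thesis
    by (rule singular_relboundary_chain_map) (use assms in \<open>auto simp: path_def path_image_def\<close>)
qed

lemma is_cycle_iff: "is_cycle X c \<longleftrightarrow> singular_chain 1 (top_of_set X) c \<and> chain_boundary 1 c = 0"
  by (rule singular_cycle)

lemma path_chain_join:
  assumes "path \<gamma>" "path \<delta>" "pathfinish \<gamma> = pathstart \<delta>" "path_image \<gamma> \<subseteq> X" "path_image \<delta> \<subseteq> X"
  shows "singular_relboundary 1 (top_of_set X) {} (path_chain \<gamma> + path_chain \<delta> - path_chain (\<gamma> +++ \<delta>))"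
proof -
  define a b c where "a = (\<lambda>t::real. t / 2)" and "b = (\<lambda>t::real. (1 + t) / 2)" and "c = (\<lambda>t::real. t)"
  have p: "path a" "path b" "path c" "path_image a \<subseteq> {0..1}" "path_image b \<subseteq> {0..1}" "path_image c \<subseteq> {0..1}"
    by (auto simp: a_def b_def c_def path_def path_image_def intro!: continuous_intros)
  have cyc: "is_cycle {0..1} (path_chain a + path_chain b - path_chain c)"
    unfolding is_cycle_iff
    using p by (auto simp: chain_boundary_add chain_boundary_diff chain_boundary_path
        intro!: singular_chain_add singular_chain_diff singular_chain_path)
      (auto simp: a_def b_def c_def pathstart_def pathfinish_def)
  have "path (\<gamma> +++ \<delta>)" "path_image (\<gamma> +++ \<delta>) \<subseteq> X"
    using assms by (auto simp: path_image_join)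
  from interval_cycle_push[OF this cyc]
  have "singular_relboundary 1 (top_of_set X) {}
     (path_chain ((\<gamma> +++ \<delta>) \<circ> a) + path_chain ((\<gamma> +++ \<delta>) \<circ> b) - path_chain ((\<gamma> +++ \<delta>) \<circ> c))"
    by (simp add: chain_map_add chain_map_diff chain_map_path)
  moreover have "path_chain ((\<gamma> +++ \<delta>) \<circ> a) = path_chain \<gamma>"
    by (rule path_chain_cong) (auto simp: a_def joinpaths_def)
  moreover have "path_chain ((\<gamma> +++ \<delta>) \<circ> b) = path_chain \<delta>"
    by (rule path_chain_cong)
      (use assms(3) in \<open>auto simp: b_def joinpaths_def pathstart_def pathfinish_def field_simps\<close>)
  moreover have "(\<gamma> +++ \<delta>) \<circ> c = \<gamma> +++ \<delta>" by (auto simp: c_def)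
  ultimately show ?thesis by simp
qed

lemma path_chain_reverse:
  assumes "path \<gamma>" "path_image \<gamma> \<subseteq> X"
  shows "singular_relboundary 1 (top_of_set X) {} (path_chain \<gamma> + path_chain (reversepath \<gamma>))"
proof -
  define b c where "b = (\<lambda>t::real. 1 - t)" and "c = (\<lambda>t::real. t)"
  have p: "path b" "path c" "path_image b \<subseteq> {0..1}" "path_image c \<subseteq> {0..1}"
    by (auto simp: b_def c_def path_def path_image_def intro!: continuous_intros)
  have cyc: "is_cycle {0..1} (path_chain c + path_chain b)"
    unfolding is_cycle_iff
    using p by (auto simp: chain_boundary_add chain_boundary_path intro!: singular_chain_add singular_chain_path)
      (auto simp: b_def c_def pathstart_def pathfinish_def)
  have "\<gamma> \<circ> c = \<gamma>" "\<gamma> \<circ> b = reversepath \<gamma>" by (auto simp: c_def b_def reversepath_def)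
  with interval_cycle_push[OF assms cyc] show ?thesis
    by (simp add: chain_map_add chain_map_path)
qed

text \<open>Used below with \<open>Ker\<close> for \<open>K\<close>, to reduce a claim about chains
  to single simplices. Differences instead of sums match \<open>frag_induction\<close>.\<close>

lemma chain_induct_mod:
  assumes "0 \<in> K" "\<And>a b. a \<in> K \<Longrightarrow> b \<in> K \<Longrightarrow> a - b \<in> K"
    and "\<Phi> 0 = 0" "\<And>a b. \<Phi> (a - b) = \<Phi> a - \<Phi> b"
    and "\<And>\<sigma>. \<sigma> \<in> Poly_Mapping.keys c \<Longrightarrow> \<Phi> (frag_of \<sigma>) \<in> K"
  shows "\<Phi> c \<in> K"
proof -
  have "\<Phi> d \<in> K" if "Poly_Mapping.keys d \<subseteq> Poly_Mapping.keys c" for d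
    using that by (induction d rule: frag_induction) (use assms in auto)
  then show ?thesis by simp
qed

section \<open>Values of a character on cycles\<close>

definition cycle_value :: "'a::topological_space set \<Rightarrow> ('a chain set \<Rightarrow> complex) \<Rightarrow> 'a chain \<Rightarrow> complex" where
  "cycle_value M \<rho> c = \<rho> (homologous_rel_set 1 (top_of_set M) {} c)"

lemma carrier_complex_units: "carrier complex_units = {z. z \<noteq> 0}"
proof -
  show ?thesis
    by (auto simp: units_of_def Units_def complex_ring_def intro: exI[of _ "inverse _"])
      (metis left_inverse mult.commute)
qed

lemma mult_complex_units: "x \<otimes>\<^bsub>complex_units\<^esub> y = x * y"
  by (simp add: units_of_def complex_ring_def)

locale homology_character =
  fixes M :: "'a::topological_space set" and \<rho> :: "'a chain set \<Rightarrow> complex"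
  assumes rho: "\<rho> \<in> hom (H1 M) complex_units"
begin

abbreviation ev where "ev \<equiv> cycle_value M \<rho>"

lemma class_carrier: "is_cycle M c \<Longrightarrow> homologous_rel_set 1 (top_of_set M) {} c \<in> carrier (H1 M)"
  using carrier_relative_homology_group[of 1 "top_of_set M" "{}"] by auto

lemma ev_nonzero: "is_cycle M c \<Longrightarrow> ev c \<noteq> 0"
  using rho class_carrier carrier_complex_units by (auto simp: cycle_value_def hom_def Pi_iff)

lemma class_mult:
  assumes "is_cycle M c" "is_cycle M d"
  shows "homologous_rel_set 1 (top_of_set M) {} c \<otimes>\<^bsub>H1 M\<^esub> homologous_rel_set 1 (top_of_set M) {} d
     = homologous_rel_set 1 (top_of_set M) {} (c + d)"
proof -
  have "{a + b |a b. homologous_rel 1 (top_of_set M) {} c a \<and> homologous_rel 1 (top_of_set M) {} d b}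
    = homologous_rel_set 1 (top_of_set M) {} (c + d)"
  proof (intro Set.set_eqI iffI)
    fix x assume x: "x \<in> homologous_rel_set 1 (top_of_set M) {} (c + d)"
    have "homologous_rel 1 (top_of_set M) {} d (x - c)"
      using x by (simp add: homologous_rel_def algebra_simps)
    then show "x \<in> {a + b |a b. homologous_rel 1 (top_of_set M) {} c a \<and> homologous_rel 1 (top_of_set M) {} d b}"
      by (rule_tac CollectI, rule_tac exI[of _ c], rule_tac exI[of _ "x - c"]) simp
  qed (auto intro: homologous_rel_add)
  then show ?thesis
    using mult_relative_homology_group[of 1 "top_of_set M" "{}"] by (simp, blast)
qed

lemma ev_add: "is_cycle M c \<Longrightarrow> is_cycle M d \<Longrightarrow> ev (c + d) = ev c * ev d"
  using hom_mult[OF rho class_carrier[of c] class_carrier[of d]] class_mult[of c d]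
  by (simp add: cycle_value_def mult_complex_units)

lemma ev_boundary:
  assumes "singular_relboundary 1 (top_of_set M) {} c" shows "ev c = 1"
proof -
  have cyc: "is_cycle M c" using assms by (rule singular_relboundary_imp_relcycle)
  have "homologous_rel_set 1 (top_of_set M) {} (c + c) = homologous_rel_set 1 (top_of_set M) {} c"
    using assms by (simp add: homologous_rel_set_eq) (simp add: homologous_rel_def)
  then have "ev c * ev c = ev c" using ev_add[OF cyc cyc] by (simp add: cycle_value_def)
  then show ?thesis using ev_nonzero[OF cyc] by simp
qed

lemma ev_diff:
  assumes "is_cycle M c" "is_cycle M d" shows "ev (c - d) = ev c / ev d"
proof -
  have "is_cycle M (c - d)" using assms by (rule singular_relcycle_diff)
  then have "ev (c - d) * ev d = ev c" using ev_add[of "c - d" d] assms by simp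
  then show ?thesis using ev_nonzero[OF assms(2)] by (simp add: field_simps)
qed

text \<open>A set of cycles instead of homology classes: it contains the boundaries and is closed
  under sums and differences, so path identities can be checked by chain arithmetic modulo
  \<open>Ker\<close>, even where the single paths are not closed.\<close>

definition Ker :: "'a chain set" where "Ker = {c. is_cycle M c \<and> ev c = 1}"

lemma Ker_zero: "0 \<in> Ker"
  and Ker_diff: "a \<in> Ker \<Longrightarrow> b \<in> Ker \<Longrightarrow> a - b \<in> Ker"
  and Ker_add: "a \<in> Ker \<Longrightarrow> b \<in> Ker \<Longrightarrow> a + b \<in> Ker"
  and Ker_boundary: "singular_relboundary 1 (top_of_set M) {} a \<Longrightarrow> a \<in> Ker"
  using ev_boundary ev_diff ev_add
  by (auto simp: Ker_def singular_relcycle_diff singular_relcycle_add dest: singular_relboundary_imp_relcycle)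

lemma ev_cong: "is_cycle M c \<Longrightarrow> c - d \<in> Ker \<Longrightarrow> ev c = ev d"
  using ev_diff[of c "c - d"] singular_relcycle_diff[of 1 "top_of_set M" "{}" c "c - d"] by (auto simp: Ker_def)

definition trivial_over :: "'a set \<Rightarrow> bool" where
  "trivial_over X \<longleftrightarrow> X \<subseteq> M \<and> (\<forall>c. is_cycle X c \<longrightarrow> ev c = 1)"

lemma cycle_mono: "is_cycle X c \<Longrightarrow> X \<subseteq> Y \<Longrightarrow> is_cycle Y c"
  by (rule singular_cycle_mono)

lemma trivial_over_Ker: "trivial_over X \<Longrightarrow> is_cycle X c \<Longrightarrow> c \<in> Ker"
  using cycle_mono[of X c M] by (auto simp: trivial_over_def Ker_def)

lemma trivial_over_mono: "trivial_over X \<Longrightarrow> Y \<subseteq> X \<Longrightarrow> trivial_over Y"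
  using cycle_mono[of Y _ X] by (auto simp: trivial_over_def)

lemma trivial_over_paths:
  assumes "trivial_over X" "path \<gamma>" "path_image \<gamma> \<subseteq> X" "path \<delta>" "path_image \<delta> \<subseteq> X"
    "pathstart \<gamma> = pathstart \<delta>" "pathfinish \<gamma> = pathfinish \<delta>"
  shows "path_chain \<gamma> - path_chain \<delta> \<in> Ker"
  using assms
  by (intro trivial_over_Ker[OF assms(1)])
    (auto simp: is_cycle_iff chain_boundary_diff chain_boundary_path intro: singular_chain_diff singular_chain_path)

text \<open>A cycle in a path-connected set is a sum of loops, obtained by joining the ends of its
  simplices to a base point.\<close>

lemma trivial_over_loops:
  assumes X: "path_connected X" "X \<subseteq> M"
    and loops: "\<And>\<gamma>. path \<gamma> \<Longrightarrow> path_image \<gamma> \<subseteq> X \<Longrightarrow> pathstart \<gamma> = pathfinish \<gamma> \<Longrightarrow> ev (path_chain \<gamma>) = 1"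
  shows "trivial_over X"
  unfolding trivial_over_def
proof (intro conjI allI impI)
  fix c assume c: "is_cycle X c"
  show "ev c = 1"
  proof (cases "X = {}")
    case True
    then have "c = 0" using c by (simp add: singular_relcycle_def singular_chain_empty)
    then show ?thesis using Ker_zero by (simp add: Ker_def)
  next
    case False
    then obtain x0 where x0: "x0 \<in> X" by blast
    have "\<forall>x\<in>X. \<exists>g. path g \<and> path_image g \<subseteq> X \<and> pathstart g = x0 \<and> pathfinish g = x"
      using X(1) x0 unfolding path_connected_def by blast
    then obtain k where k: "\<And>x. x \<in> X \<Longrightarrow> path (k x) \<and> path_image (k x) \<subseteq> X \<and> pathstart (k x) = x0 \<and> pathfinish (k x) = x"
      by metis
    \<comment> \<open>A vertex is replaced by the chosen path from \<open>x0\<close> to it; the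
      argument of \<open>v\<close> is the point of the 0-simplex. Subtracting \<kappa> of the
      boundary closes each simplex to a loop and changes nothing for a cycle.\<close>
    define \<kappa> where "\<kappa> = frag_extend (\<lambda>v. path_chain (k (v (\<lambda>i::nat. if i = 0 then 1 else (0::real)))))"
    have \<kappa>_point: "\<kappa> (point_chain x) = path_chain (k x)" for x
      by (simp add: \<kappa>_def point_chain_def)
    have "c - \<kappa> (chain_boundary 1 c) \<in> Ker"
    proof (rule chain_induct_mod[where \<Phi> = "\<lambda>c. c - \<kappa> (chain_boundary 1 c)"])
      fix a b :: "'a chain" 
      show "a - b - \<kappa> (chain_boundary 1 (a - b)) = a - \<kappa> (chain_boundary 1 a) - (b - \<kappa> (chain_boundary 1 b))"
        by (simp add: chain_boundary_diff \<kappa>_def frag_extend_diff)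
    next
      fix \<sigma> assume "\<sigma> \<in> Poly_Mapping.keys c"
      then have "singular_simplex 1 (top_of_set X) \<sigma>" using c by (auto simp: singular_relcycle_def singular_chain_def)
      then obtain \<gamma> where g: "path \<gamma>" "path_image \<gamma> \<subseteq> X" "frag_of \<sigma> = path_chain \<gamma>" using simplex_as_path by metis
      let ?x = "pathstart \<gamma>" and ?y = "pathfinish \<gamma>"
      have xy: "?x \<in> X" "?y \<in> X" using g by (auto simp: path_image_def pathstart_def pathfinish_def)
      let ?l = "(k ?x +++ \<gamma>) +++ reversepath (k ?y)"
      have l: "path ?l" "path_image ?l \<subseteq> X" "pathstart ?l = pathfinish ?l"
        using g xy k by (auto simp: path_image_join)
      have "path_chain ?l \<in> Ker"
        using loops[OF l] l singular_chain_path[OF l(1,2)] cycle_mono[OF _ X(2)]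
        by (auto simp: Ker_def is_cycle_iff[of X] chain_boundary_path)
      moreover have "path_image \<gamma> \<subseteq> M" "path_image (k ?x) \<subseteq> M" "path_image (k ?y) \<subseteq> M"
        using g k[OF xy(1)] k[OF xy(2)] X(2) by blast+
      then have "path_chain (k ?x) + path_chain \<gamma> - path_chain (k ?x +++ \<gamma>) \<in> Ker"
        "path_chain (k ?x +++ \<gamma>) + path_chain (reversepath (k ?y)) - path_chain ?l \<in> Ker"
        "path_chain (k ?y) + path_chain (reversepath (k ?y)) \<in> Ker"
        using g k[OF xy(1)] k[OF xy(2)] by (auto intro!: Ker_boundary path_chain_join path_chain_reverse simp: path_image_join)
      moreover note sums = calculation
      have "(path_chain (k ?x) + path_chain \<gamma> - path_chain (k ?x +++ \<gamma>)) +
         (path_chain (k ?x +++ \<gamma>) + path_chain (reversepath (k ?y)) - path_chain ?l) + path_chain ?l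
         - (path_chain (k ?y) + path_chain (reversepath (k ?y))) \<in> Ker"
        by (rule Ker_diff[OF Ker_add[OF Ker_add[OF sums(2,3)] sums(1)] sums(4)])
      then have "path_chain \<gamma> - (path_chain (k ?y) - path_chain (k ?x)) \<in> Ker" by (simp add: algebra_simps)
      moreover have "\<kappa> (chain_boundary 1 (path_chain \<gamma>)) = path_chain (k ?y) - path_chain (k ?x)"
        unfolding chain_boundary_path using \<kappa>_point by (simp add: \<kappa>_def frag_extend_diff)
      ultimately show "frag_of \<sigma> - \<kappa> (chain_boundary 1 (frag_of \<sigma>)) \<in> Ker" by (simp add: g(3))
    qed (auto simp: Ker_zero Ker_diff \<kappa>_def)
    then show ?thesis using c by (simp add: is_cycle_iff \<kappa>_def Ker_def)
  qed
qed (use X in auto)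

text \<open>The monodromy factor of \<open>rank_one_system\<close> becomes the value on a difference
  of chains. This form is additive, and concatenations and reversed paths disappear from later
  computations.\<close>

lemma ev_loop_class:
  assumes "path \<gamma>" "path \<delta>" "path_image \<gamma> \<subseteq> M" "path_image \<delta> \<subseteq> M"
    "pathstart \<gamma> = pathstart \<delta>" "pathfinish \<gamma> = pathfinish \<delta>"
  shows "\<rho> (loop_class M (\<gamma> +++ reversepath \<delta>)) = ev (path_chain \<gamma> - path_chain \<delta>)"
proof -
  have "path_chain \<gamma> + path_chain (reversepath \<delta>) - path_chain (\<gamma> +++ reversepath \<delta>) \<in> Ker"
    "path_chain \<delta> + path_chain (reversepath \<delta>) \<in> Ker"
    using assms by (auto intro!: Ker_boundary path_chain_join path_chain_reverse)
  from Ker_diff[OF this]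
  have k: "(path_chain \<gamma> - path_chain \<delta>) - path_chain (\<gamma> +++ reversepath \<delta>) \<in> Ker" by (simp add: algebra_simps)
  have "is_cycle M (path_chain \<gamma> - path_chain \<delta>)"
    using assms by (auto simp: is_cycle_iff chain_boundary_diff chain_boundary_path intro!: singular_chain_diff singular_chain_path)
  from ev_cong[OF this k] show ?thesis by (simp add: loop_class_def cycle_value_def path_chain_def)
qed

end

section \<open>The topology of the fibration\<close>

lemma disc_like_path_connected:
  assumes "disc_like V" shows "path_connected V"
proof -
  have "path_connected_space (top_of_set V)"
    using assms unfolding disc_like_def by (intro contractible_imp_path_connected_space) blast
  then have "path_connectedin euclidean V" by (simp only: path_connectedin_def topspace_euclidean subset_UNIV)
  then show ?thesis by (simp only: path_connectedin_euclidean)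
qed

lemma disc_like_connected: "disc_like V \<Longrightarrow> connected V"
  unfolding disc_like_def by (metis Diff_empty finite.emptyI)

lemma locally_disc_likeE:
  assumes "locally_disc_like X" "openin (top_of_set X) V" "x \<in> V"
  obtains D where "openin (top_of_set X) D" "x \<in> D" "D \<subseteq> V" "disc_like D"
proof -
  obtain Y where Y: "open Y" "V = X \<inter> Y" using assms(2) by (auto simp: openin_open)
  then have "x \<in> X" "x \<in> Y" using assms(3) by auto
  then obtain D where D: "openin (top_of_set X) D" "x \<in> D" "D \<subseteq> Y" "disc_like D"
    using assms(1) Y(1) unfolding locally_disc_like_def by blast
  moreover have "D \<subseteq> V" using D openin_imp_subset Y by blast
  ultimately show ?thesis using that by blast
qed

lemma locally_disc_like_path_connected:
  assumes X: "locally_disc_like X" and V: "openin (top_of_set X) V" "connected V"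
  shows "path_connected V"
  unfolding path_connected_component
proof (intro ballI)
  fix a b assume ab: "a \<in> V" "b \<in> V"
  show "path_component V a b"
  proof (rule connected_induction_simple[OF V(2) ab, where P = "path_component V a"])
    show "path_component V a a" using ab by (simp add: path_component_refl)
    fix x assume "x \<in> V"
    then obtain D where D: "openin (top_of_set X) D" "x \<in> D" "D \<subseteq> V" "disc_like D"
      using locally_disc_likeE[OF X V(1)] by blast
    have "path_component V a z" if "y \<in> D" "z \<in> D" "path_component V a y" for y z
    proof -
      have "path_component D y z" using disc_like_path_connected[OF D(4)] that by (auto simp: path_connected_component)
      then have "path_component V y z" using path_component_of_subset D(3) by blast
      then show ?thesis using that path_component_trans by blast
    qed
    moreover have "openin (top_of_set V) D"
      using D V openin_imp_subset by (meson openin_subset_trans)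
    ultimately show "\<exists>T. openin (top_of_set V) T \<and> x \<in> T \<and>
       (\<forall>y\<in>T. \<forall>z\<in>T. path_component V a y \<longrightarrow> path_component V a z)" using D by blast
  qed
qed

lemma locally_disc_like_component:
  assumes X: "locally_disc_like X" and V: "openin (top_of_set X) V"
  shows "openin (top_of_set X) (connected_component_set V x)"
proof (subst openin_subopen, intro ballI)
  fix y assume y: "y \<in> connected_component_set V x"
  then have "y \<in> V" using connected_component_in by fastforce
  then obtain D where D: "openin (top_of_set X) D" "y \<in> D" "D \<subseteq> V" "disc_like D"
    using locally_disc_likeE[OF X V] by blast
  have "D \<subseteq> connected_component_set V y"
    using D disc_like_connected by (intro connected_component_maximal) auto
  also have "\<dots> = connected_component_set V x" using y connected_component_eq by fastforce
  finally show "\<exists>T. openin (top_of_set X) T \<and> y \<in> T \<and> T \<subseteq> connected_component_set V x" using D by blast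
qed

lemma openin_diff_finite:
  fixes X :: "'a::t1_space set"
  assumes "openin (top_of_set X) V" "finite A" shows "openin (top_of_set X) (V - A)"
proof -
  obtain Y where Y: "open Y" "V = X \<inter> Y" using assms(1) by (auto simp: openin_open)
  then have "V - A = X \<inter> (Y - A)" by auto
  moreover have "open (Y - A)" using Y(1) assms(2) finite_imp_closed by (auto intro: open_Diff)
  ultimately show ?thesis by (auto simp: openin_open)
qed

text \<open>Were \<open>V - A\<close> split into \<open>P\<close> and \<open>Q\<close>, each disc in
  \<open>V\<close> without \<open>A\<close>, being connected, would lie in one of them. Overlapping
  discs make the same choice, because their overlap is infinite and so has points outside
  \<open>A\<close>; as \<open>V\<close> is connected, the choice would be constant.\<close>

lemma locally_disc_like_punctured_connected:
  fixes X :: "'a::t1_space set"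
  assumes X: "locally_disc_like X" and V: "openin (top_of_set X) V" "connected V" and A: "finite A"
  shows "connected (V - A)"
proof (rule ccontr)
  assume "\<not> connected (V - A)"
  then obtain P Q where PQ: "openin (top_of_set (V - A)) P" "openin (top_of_set (V - A)) Q"
     "V - A \<subseteq> P \<union> Q" "P \<inter> Q = {}" "P \<noteq> {}" "Q \<noteq> {}"
    unfolding connected_openin by blast
  \<comment> \<open>Stated for a neighbourhood, in order to make sense at the points of
    \<open>A\<close> too.\<close>
  define R where "R x \<longleftrightarrow> (\<exists>D. openin (top_of_set X) D \<and> x \<in> D \<and> D \<subseteq> V \<and> D - A \<subseteq> P)" for x
  have alt: "D - A \<subseteq> P" if "disc_like D" "D \<subseteq> V" "(D - A) \<inter> P \<noteq> {}" for D
  proof -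
    have "connected (D - A)" using that A by (simp add: disc_like_def)
    moreover have "openin (top_of_set (D - A)) ((D - A) \<inter> P)" "openin (top_of_set (D - A)) ((D - A) \<inter> Q)"
      using PQ(1,2) that(2) by (auto simp: openin_open)
    moreover have "D - A \<subseteq> (D - A) \<inter> P \<union> (D - A) \<inter> Q" using PQ(3) that(2) by auto
    moreover have "((D - A) \<inter> P) \<inter> ((D - A) \<inter> Q) = {}" using PQ(4) by auto
    ultimately have "(D - A) \<inter> Q = {}" using that(3) unfolding connected_openin by blast
    then show ?thesis using PQ(3) that(2) by auto
  qed
  obtain a b where ab: "a \<in> P" "b \<in> Q" using PQ by auto
  then have abV: "a \<in> V" "b \<in> V" "a \<notin> A" "b \<notin> A"
    using PQ(1,2)[THEN openin_imp_subset] by auto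
  have "R b"
  proof (rule connected_induction_simple[OF V(2) abV(1,2)])
    obtain D where "openin (top_of_set X) D" "a \<in> D" "D \<subseteq> V" "disc_like D"
      using locally_disc_likeE[OF X V(1) abV(1)] by blast
    then show "R a" using alt[of D] ab abV unfolding R_def by blast
    fix x assume "x \<in> V"
    then obtain D where D: "openin (top_of_set X) D" "x \<in> D" "D \<subseteq> V" "disc_like D"
      using locally_disc_likeE[OF X V(1)] by blast
    have "R z" if yz: "y \<in> D" "z \<in> D" "R y" for y z
    proof -
      obtain E where E: "openin (top_of_set X) E" "y \<in> E" "E \<subseteq> V" "E - A \<subseteq> P" using yz(3) by (auto simp: R_def)
      obtain D' where D': "y \<in> D'" "D' \<subseteq> D \<inter> E" "disc_like D'"
        by (rule locally_disc_likeE[OF X openin_Int[OF D(1) E(1)], of y]) (use yz E in blast)+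
      have "infinite (D' - A)" using D'(3) A by (simp add: disc_like_def)
      then obtain w where "w \<in> D' - A" by (metis ex_in_conv finite.emptyI)
      then have "w \<in> (D - A) \<inter> P" using D' E by blast
      then have "(D - A) \<inter> P \<noteq> {}" by blast
      then show ?thesis using alt[OF D(4,3)] D yz unfolding R_def by blast
    qed
    moreover have "openin (top_of_set V) D" using D V openin_imp_subset by (meson openin_subset_trans)
    ultimately show "\<exists>T. openin (top_of_set V) T \<and> x \<in> T \<and> (\<forall>y\<in>T. \<forall>z\<in>T. R y \<longrightarrow> R z)" using D by blast
  qed
  then have "b \<in> P" using abV by (auto simp: R_def)
  then show False using ab PQ(4) by auto
qed

text \<open>The interface between algebraic geometry and topology: smoothness enters through
  \<open>locally_disc_like\<close>, the identity theorem through \<open>no_interior\<close>, and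
  quantifier elimination through the finiteness of \<open>S - U\<close>.\<close>

locale generic_fibration =
  fixes M :: "'a::topological_space set" and S :: "'b::t1_space set" and f :: "'a \<Rightarrow> 'b" and U :: "'b set" and b :: 'b
  assumes M: "locally_disc_like M" "connected M"
    and S: "locally_disc_like S" "connected S"
    and f: "continuous_on M f" "f ` M = S"
    and U: "U \<subseteq> S" "finite (S - U)" "locally_trivial_over M f U"
    and no_interior: "\<And>T s. openin (top_of_set M) T \<Longrightarrow> T \<subseteq> f -` {s} \<Longrightarrow> T = {}"
    and b: "b \<in> U" "connected (fiber M f b)"
begin

abbreviation preimage :: "'b set \<Rightarrow> 'a set" where "preimage V \<equiv> M \<inter> f -` V"

lemma U_open: "openin (top_of_set S) U"
  using openin_diff_finite[of S S "S - U"] U by (simp add: double_diff)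

lemma U_connected: "connected U"
  using locally_disc_like_punctured_connected[OF S(1) _ S(2) U(2)] U(1) by (simp add: double_diff)

lemma preimage_open: "openin (top_of_set S) V \<Longrightarrow> openin (top_of_set M) (preimage V)"
  using continuous_openin_preimage[OF f(1), of S V] f(2) by auto

lemma preimage_mono: "V \<subseteq> W \<Longrightarrow> preimage V \<subseteq> preimage W" by auto

lemma f_preimage: "V \<subseteq> S \<Longrightarrow> f ` preimage V = V"
  using f(2) by auto

lemma trivialization:
  assumes "y \<in> U"
  obtains V h k where "openin (top_of_set U) V" "y \<in> V"
    "continuous_on (V \<times> fiber M f y) h" "continuous_on (preimage V) k"
    "\<And>v z. v \<in> V \<Longrightarrow> z \<in> fiber M f y \<Longrightarrow> h (v, z) \<in> preimage V \<and> f (h (v, z)) = v \<and> k (h (v, z)) = (v, z)"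
    "\<And>x. x \<in> preimage V \<Longrightarrow> fst (k x) = f x \<and> snd (k x) \<in> fiber M f y \<and> h (k x) = x"
proof -
  obtain V h k where V: "openin (top_of_set U) V" "y \<in> V"
    "homeomorphism (V \<times> fiber M f y) (preimage V) h k"
    "\<And>v z. v \<in> V \<Longrightarrow> z \<in> fiber M f y \<Longrightarrow> f (h (v, z)) = v"
    using U(3) assms unfolding locally_trivial_over_def by metis
  have hk: "\<And>w. w \<in> V \<times> fiber M f y \<Longrightarrow> k (h w) = w" "\<And>w. w \<in> V \<times> fiber M f y \<Longrightarrow> h w \<in> preimage V"
    "\<And>x. x \<in> preimage V \<Longrightarrow> h (k x) = x" "\<And>x. x \<in> preimage V \<Longrightarrow> k x \<in> V \<times> fiber M f y"
    using V(3) unfolding homeomorphism_def by blast+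
  have "fst (k x) = f x \<and> snd (k x) \<in> fiber M f y \<and> h (k x) = x" if "x \<in> preimage V" for x
    using hk(3,4)[OF that] V(4)[of "fst (k x)" "snd (k x)"] by (auto simp: mem_Times_iff)
  then show ?thesis using that[of V h k] V hk by (auto simp: homeomorphism_def)
qed

text \<open>Connectedness is known for the fibre over \<open>b\<close>. Neighbouring fibres over
  \<open>U\<close> are continuous images of each other, and \<open>U\<close> is connected because it
  is \<open>S\<close> without finitely many points.\<close>

lemma fibers_connected:
  assumes "y \<in> U" shows "connected (fiber M f y)"
proof (rule connected_induction_simple[OF U_connected b(1) assms])
  show "connected (fiber M f b)" by (rule b(2))
  fix a assume "a \<in> U"
  then obtain V h k where V: "openin (top_of_set U) V" "a \<in> V"
    "continuous_on (V \<times> fiber M f a) h" "continuous_on (preimage V) k"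
    "\<And>v z. v \<in> V \<Longrightarrow> z \<in> fiber M f a \<Longrightarrow> h (v, z) \<in> preimage V \<and> f (h (v, z)) = v \<and> k (h (v, z)) = (v, z)"
    "\<And>x. x \<in> preimage V \<Longrightarrow> fst (k x) = f x \<and> snd (k x) \<in> fiber M f a \<and> h (k x) = x"
    by (rule trivialization) (rule that; assumption)
  have "connected (fiber M f v) \<longleftrightarrow> connected (fiber M f a)" if v: "v \<in> V" for v
  proof
    have "fiber M f v = (\<lambda>z. h (v, z)) ` fiber M f a"
    proof (intro subset_antisym subsetI)
      fix x assume "x \<in> fiber M f v"
      then have x: "x \<in> preimage V" "f x = v" using v by (auto simp: fiber_def)
      then have "x = h (v, snd (k x))" using V(6)[OF x(1)] by (metis prod.collapse)
      then show "x \<in> (\<lambda>z. h (v, z)) ` fiber M f a" using V(6)[OF x(1)] by blast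
    qed (use V(5)[OF v] in \<open>auto simp: fiber_def\<close>)
    moreover have "continuous_on (fiber M f a) (\<lambda>z. h (v, z))"
      by (rule continuous_on_compose2[OF V(3)]) (use v in \<open>auto intro!: continuous_intros\<close>)
    ultimately show "connected (fiber M f v)" if "connected (fiber M f a)"
      using that by (simp add: connected_continuous_image)
    have "fiber M f a = (\<lambda>x. snd (k x)) ` fiber M f v"
    proof (intro subset_antisym subsetI)
      fix z assume "z \<in> fiber M f a"
      then have "z = snd (k (h (v, z)))" "h (v, z) \<in> fiber M f v" using V(5)[OF v] by (auto simp: fiber_def)
      then show "z \<in> (\<lambda>x. snd (k x)) ` fiber M f v" by blast
    qed (use V(6) v in \<open>auto simp: fiber_def\<close>)
    moreover have "continuous_on (fiber M f v) (\<lambda>x. snd (k x))"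
      by (intro continuous_on_snd continuous_on_subset[OF V(4)]) (use v in \<open>auto simp: fiber_def\<close>)
    ultimately show "connected (fiber M f a)" if "connected (fiber M f v)"
      using that by (simp add: connected_continuous_image)
  qed
  then show "\<exists>T. openin (top_of_set U) T \<and> a \<in> T \<and>
     (\<forall>x\<in>T. \<forall>y\<in>T. connected (fiber M f x) \<longrightarrow> connected (fiber M f y))" using V(1,2) by blast
qed

text \<open>Through every point over \<open>U\<close> there passes a local section, obtained from
  the trivialization by fixing the coordinate in the fibre. Openness is needed in order to lift
  connectedness from \<open>V \<inter> U\<close> to its preimage.\<close>

lemma f_open_over_U:
  assumes C: "openin (top_of_set (preimage U)) C" shows "openin (top_of_set U) (f ` C)"
proof (subst openin_subopen, intro ballI)
  fix y assume "y \<in> f ` C"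
  then obtain c where c: "c \<in> C" "y = f c" by blast
  have CU: "C \<subseteq> preimage U" using C openin_imp_subset by blast
  then have "y \<in> U" using c by auto
  then obtain V h k where V: "openin (top_of_set U) V" "y \<in> V"
    "continuous_on (V \<times> fiber M f y) h" "continuous_on (preimage V) k"
    "\<And>v z. v \<in> V \<Longrightarrow> z \<in> fiber M f y \<Longrightarrow> h (v, z) \<in> preimage V \<and> f (h (v, z)) = v \<and> k (h (v, z)) = (v, z)"
    "\<And>x. x \<in> preimage V \<Longrightarrow> fst (k x) = f x \<and> snd (k x) \<in> fiber M f y \<and> h (k x) = x"
    by (rule trivialization) (rule that; assumption)
  have VU: "V \<subseteq> U" using V(1) openin_imp_subset by blast
  have c': "c \<in> preimage V" using c V(2) CU by auto
  let ?z = "snd (k c)"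
  have z: "?z \<in> fiber M f y" "h (y, ?z) = c" using V(6)[OF c'] c(2) by (auto simp: prod.expand) (metis prod.collapse)
  have "continuous_on V (\<lambda>v. h (v, ?z))"
    by (rule continuous_on_compose2[OF V(3)]) (use z in \<open>auto intro!: continuous_intros\<close>)
  then have "openin (top_of_set V) (V \<inter> (\<lambda>v. h (v, ?z)) -` C)"
    by (rule continuous_openin_preimage[OF _ _ C]) (use V(5) z VU in auto)
  then have "openin (top_of_set U) (V \<inter> (\<lambda>v. h (v, ?z)) -` C)" using V(1) openin_trans by blast
  moreover have "V \<inter> (\<lambda>v. h (v, ?z)) -` C \<subseteq> f ` C" using V(5) z by (auto simp: image_iff) metis
  moreover have "y \<in> V \<inter> (\<lambda>v. h (v, ?z)) -` C" using V(2) z c by auto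
  ultimately show "\<exists>T. openin (top_of_set U) T \<and> y \<in> T \<and> T \<subseteq> f ` C" by blast
qed

lemma preimage_finite_no_interior:
  assumes "finite A" "openin (top_of_set M) T" "T \<subseteq> f -` A" shows "T = {}"
  using assms
proof (induction A arbitrary: T rule: finite_induct)
  case (insert a A)
  have "openin (top_of_set M) (T \<inter> preimage (S - {a}))"
    using openin_Int[OF insert.prems(1) preimage_open[OF openin_diff_finite[of S S "{a}"]]] by simp
  moreover have "T \<inter> preimage (S - {a}) \<subseteq> f -` A" using insert.prems by auto
  ultimately have "T \<inter> preimage (S - {a}) = {}" by (rule insert.IH)
  moreover have "T \<subseteq> M" using insert.prems openin_imp_subset by blast
  moreover have "f x \<in> S" if "x \<in> M" for x using f(2) that by blast
  ultimately have "T \<subseteq> f -` {a}" by blast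
  then show ?case using no_interior insert.prems by blast
qed auto

text \<open>Over \<open>V \<inter> U\<close> the map is open with connected fibres, and the part of \<open>M\<close> over \<open>V \<inter> U\<close> is dense in
  the part over \<open>V\<close>.\<close>

lemma preimage_connected:
  assumes V: "openin (top_of_set S) V" "connected V"
  shows "connected (preimage V)" "path_connected (preimage V)"
proof -
  have "V - (S - U) = V \<inter> U" using openin_imp_subset[OF V(1)] by auto
  then have VU: "connected (V \<inter> U)"
    using locally_disc_like_punctured_connected[OF S(1) V U(2)] by simp
  have "connected (preimage U \<inter> f -` (V \<inter> U))"
  proof (rule connected_open_monotone_preimage[OF _ _ f_open_over_U _ VU])
    show "continuous_on (preimage U) f" using f(1) by (rule continuous_on_subset) auto
    show "f ` preimage U = U" using f_preimage U(1) by blast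
    fix y assume "y \<in> U"
    then have "preimage U \<inter> f -` {y} = fiber M f y" by (auto simp: fiber_def)
    then show "connected (preimage U \<inter> f -` {y})" using fibers_connected \<open>y \<in> U\<close> by simp
  qed auto
  then have "connected (preimage (V \<inter> U))" by (rule back_subst[of connected]) auto
  moreover have "preimage V \<subseteq> closure (preimage (V \<inter> U))"
  proof
    fix x assume x: "x \<in> preimage V"
    show "x \<in> closure (preimage (V \<inter> U))"
      unfolding closure_iff_nhds_not_empty
    proof (intro allI impI)
      fix A Y assume Y: "Y \<subseteq> A" "open Y" "x \<in> Y"
      have o: "openin (top_of_set M) (preimage V \<inter> Y)"
        using preimage_open[OF V(1)] Y(2) openin_Int_open by blast
      have "\<not> preimage V \<inter> Y \<subseteq> f -` (S - U)" using preimage_finite_no_interior[OF U(2) o] x Y by auto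
      then show "preimage (V \<inter> U) \<inter> A \<noteq> {}" using Y f(2) by auto
    qed
  qed
  ultimately show c: "connected (preimage V)"
    using connected_intermediate_closure[of "preimage (V \<inter> U)" "preimage V"] by auto
  show "path_connected (preimage V)"
    by (rule locally_disc_like_path_connected[OF M(1) preimage_open[OF V(1)] c])
qed

lemma M_path_connected: "path_connected M"
  using locally_disc_like_path_connected[OF M(1) _ M(2)] by simp

end

section \<open>A character that is trivial on the generic fibre\<close>

locale fibration_character = generic_fibration M S f U b + homology_character M \<rho>
  for M :: "'a::topological_space set" and S :: "'b::t1_space set" and f U b \<rho> +
  assumes rho_fiber: "\<And>c. is_cycle (fiber M f b) c \<Longrightarrow> cycle_value M \<rho> c = 1"
begin

definition good :: "'b set \<Rightarrow> bool" where
  "good W \<longleftrightarrow> openin (top_of_set S) W \<and> trivial_over (preimage W)"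

lemma good_subset: "good W \<Longrightarrow> openin (top_of_set S) V \<Longrightarrow> V \<subseteq> W \<Longrightarrow> good V"
  unfolding good_def using trivial_over_mono preimage_mono by blast

text \<open>In the product of \<open>D\<close> with the fibre, contracting \<open>D\<close> to
  \<open>y\<close> deforms every cycle into the fibre over \<open>y\<close>. The trivialization is
  centred at \<open>a\<close> while \<open>y\<close> is arbitrary in \<open>D\<close>, so this also
  carries triviality from one fibre to its neighbours.\<close>

lemma trivialized_disc_trivial_over:
  assumes V: "continuous_on (V \<times> fiber M f a) h" "continuous_on (preimage V) k"
    "\<And>v z. v \<in> V \<Longrightarrow> z \<in> fiber M f a \<Longrightarrow> h (v, z) \<in> preimage V \<and> f (h (v, z)) = v \<and> k (h (v, z)) = (v, z)"
    "\<And>x. x \<in> preimage V \<Longrightarrow> fst (k x) = f x \<and> snd (k x) \<in> fiber M f a \<and> h (k x) = x"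
    and D: "D \<subseteq> V" "contractible_space (top_of_set D)" "y \<in> D" and y: "trivial_over (fiber M f y)"
  shows "trivial_over (preimage D)"
  unfolding trivial_over_def
proof (intro conjI allI impI)
  fix c assume c: "is_cycle (preimage D) c"
  let ?F = "fiber M f a" and ?X = "top_of_set (preimage D)"
  have kD: "continuous_map ?X (prod_topology (top_of_set D) (top_of_set ?F)) k"
  proof -
    have "continuous_on (preimage D) k" using V(2) by (rule continuous_on_subset) (use D(1) in auto)
    moreover have "k \<in> preimage D \<rightarrow> D \<times> ?F"
    proof
      fix x assume x: "x \<in> preimage D"
      then have "x \<in> preimage V" using D(1) by auto
      from V(4)[OF this] show "k x \<in> D \<times> ?F" using x by (auto simp: mem_Times_iff)
    qed
    ultimately show ?thesis by (simp flip: subtopology_Times)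
  qed
  have hD: "continuous_map (prod_topology (top_of_set D) (top_of_set ?F)) ?X h"
  proof -
    have "continuous_on (D \<times> ?F) h" using V(1) by (rule continuous_on_subset) (use D(1) in auto)
    moreover have "h \<in> D \<times> ?F \<rightarrow> preimage D" using V(3) D(1) by fastforce
    ultimately show ?thesis by (simp flip: subtopology_Times)
  qed
  have "homotopic_with (\<lambda>x. True) (top_of_set D) (top_of_set D) id (\<lambda>x. y)"
    using iffD1[OF contractible_space_alt D(2)] D(3) by simp
  moreover have "homotopic_with (\<lambda>x. True) (top_of_set ?F) (top_of_set ?F) id id" by simp
  ultimately have "homotopic_with (\<lambda>x. True) (prod_topology (top_of_set D) (top_of_set ?F)) (prod_topology (top_of_set D) (top_of_set ?F))
      (\<lambda>z. (id (fst z), id (snd z))) (\<lambda>z. (y, id (snd z)))"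
    by (rule homotopic_with_prod_topology) auto
  then have "homotopic_with (\<lambda>x. True) ?X (prod_topology (top_of_set D) (top_of_set ?F))
      ((\<lambda>z. (id (fst z), id (snd z))) \<circ> k) ((\<lambda>z. (y, id (snd z))) \<circ> k)"
    by (rule homotopic_with_compose_continuous_map_right[OF _ kD]) auto
  then have hom: "homotopic_with (\<lambda>x. True) ?X ?X
      (h \<circ> ((\<lambda>z. (id (fst z), id (snd z))) \<circ> k)) (h \<circ> ((\<lambda>z. (y, id (snd z))) \<circ> k))"
    by (rule homotopic_with_compose_continuous_map_left[OF _ hD]) auto
  \<comment> \<open>The final map of the homotopy: it moves a point into the fibre over
    \<open>y\<close> and keeps its fibre coordinate.\<close>
  let ?r = "h \<circ> ((\<lambda>z. (y, id (snd z))) \<circ> k)"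
  have "homologous_rel 1 ?X {} (chain_map 1 (h \<circ> ((\<lambda>z. (id (fst z), id (snd z))) \<circ> k)) c) (chain_map 1 ?r c)"
    by (rule homotopic_imp_homologous_rel_chain_maps[where T = "{}" and S = ?X]) (use hom c in auto)
  moreover have "chain_map 1 (h \<circ> ((\<lambda>z. (id (fst z), id (snd z))) \<circ> k)) c = c"
  proof (rule chain_map_id_gen)
    show "singular_chain 1 ?X c" using c is_cycle_iff by blast
    show "(h \<circ> ((\<lambda>z. (id (fst z), id (snd z))) \<circ> k)) x = x" if "x \<in> topspace ?X" for x
      using V(4)[of x] that D(1) by auto
  qed
  ultimately have "singular_relboundary 1 ?X {} (c - chain_map 1 ?r c)" by (simp add: homologous_rel_def)
  then have "singular_relboundary 1 (top_of_set M) {} (c - chain_map 1 ?r c)"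
    using singular_boundary_mono[of "preimage D" M] by blast
  then have k: "c - chain_map 1 ?r c \<in> Ker" by (rule Ker_boundary)
  have "continuous_map ?X (top_of_set (fiber M f y)) ?r"
  proof -
    have "continuous_map ?X ?X ?r" using homotopic_with_imp_continuous_maps[OF hom] by blast
    moreover have "?r x \<in> fiber M f y" if "x \<in> preimage D" for x
      using V(4)[of x] V(3)[of y "snd (k x)"] that D(1,3) by (auto simp: fiber_def)
    ultimately show ?thesis by (auto simp: continuous_map_in_subtopology fiber_def)
  qed
  then have "is_cycle (fiber M f y) (chain_map 1 ?r c)"
    by (rule singular_relcycle_chain_map[OF c]) auto
  then have "ev (chain_map 1 ?r c) = 1" using y by (auto simp: trivial_over_def)
  moreover have "is_cycle M c" using cycle_mono[OF c] by auto
  ultimately show "ev c = 1" using ev_cong[OF _ k] by simp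
qed auto

text \<open>The assumption concerns the one fibre over \<open>b\<close>; it spreads over discs by
  the preceding lemma, and over \<open>U\<close> by connectedness.\<close>

lemma trivial_over_fibers:
  assumes "y \<in> U" shows "trivial_over (fiber M f y)"
proof (rule connected_induction_simple[OF U_connected b(1) assms])
  show "trivial_over (fiber M f b)" using rho_fiber by (auto simp: trivial_over_def fiber_def)
  fix a assume "a \<in> U"
  then obtain V h k where V: "openin (top_of_set U) V" "a \<in> V"
    "continuous_on (V \<times> fiber M f a) h" "continuous_on (preimage V) k"
    "\<And>v z. v \<in> V \<Longrightarrow> z \<in> fiber M f a \<Longrightarrow> h (v, z) \<in> preimage V \<and> f (h (v, z)) = v \<and> k (h (v, z)) = (v, z)"
    "\<And>x. x \<in> preimage V \<Longrightarrow> fst (k x) = f x \<and> snd (k x) \<in> fiber M f a \<and> h (k x) = x"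
    by (rule trivialization) (rule that; assumption)
  have "openin (top_of_set S) V" using V(1) U_open openin_trans by blast
  then obtain D where D: "openin (top_of_set S) D" "a \<in> D" "D \<subseteq> V" "disc_like D"
    using locally_disc_likeE[OF S(1) _ V(2)] by blast
  have "trivial_over (fiber M f z)" if "y \<in> D" "z \<in> D" "trivial_over (fiber M f y)" for y z
  proof -
    have "trivial_over (preimage D)"
      using trivialized_disc_trivial_over[OF V(3-6) D(3) _ that(1,3)] D(4) by (simp add: disc_like_def)
    then show ?thesis by (rule trivial_over_mono) (use that(2) in \<open>auto simp: fiber_def\<close>)
  qed
  moreover have "openin (top_of_set U) D"
    using D(1,3) V(1) U(1) openin_imp_subset by (meson openin_subset_trans subset_trans)
  ultimately show "\<exists>T. openin (top_of_set U) T \<and> a \<in> T \<and>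
     (\<forall>x\<in>T. \<forall>y\<in>T. trivial_over (fiber M f x) \<longrightarrow> trivial_over (fiber M f y))" using D(2) by blast
qed

lemma good_near_U:
  assumes "y \<in> U" "openin (top_of_set S) N" "y \<in> N"
  obtains D where "good D" "y \<in> D" "D \<subseteq> N \<inter> U" "connected D"
proof -
  obtain V h k where V: "openin (top_of_set U) V" "y \<in> V"
    "continuous_on (V \<times> fiber M f y) h" "continuous_on (preimage V) k"
    "\<And>v z. v \<in> V \<Longrightarrow> z \<in> fiber M f y \<Longrightarrow> h (v, z) \<in> preimage V \<and> f (h (v, z)) = v \<and> k (h (v, z)) = (v, z)"
    "\<And>x. x \<in> preimage V \<Longrightarrow> fst (k x) = f x \<and> snd (k x) \<in> fiber M f y \<and> h (k x) = x"
    by (rule trivialization[OF assms(1)]) (rule that; assumption)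
  have "openin (top_of_set S) V" using V(1) U_open openin_trans by blast
  then obtain D where D: "openin (top_of_set S) D" "y \<in> D" "D \<subseteq> V \<inter> N" "disc_like D"
    using locally_disc_likeE[OF S(1) openin_Int[OF _ assms(2)]] V(2) assms(3) by (metis IntI)
  have DV: "D \<subseteq> V" using D(3) by auto
  have "trivial_over (preimage D)"
    using trivialized_disc_trivial_over[OF V(3-6) DV _ D(2) trivial_over_fibers[OF assms(1)]] D(4)
    by (simp add: disc_like_def)
  then have "good D" using D(1) by (simp add: good_def)
  moreover have "D \<subseteq> N \<inter> U" using D(3) V(1) openin_imp_subset by blast
  ultimately show ?thesis using that D disc_like_connected by blast
qed

end

section \<open>Characters trivial over small sets\<close>

context fibration_character
begin

text \<open>A good set may be disconnected, whereas paths over a set are available when it is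
  connected.\<close>

lemma good_connected_neighborhood:
  assumes "connected A" "A \<noteq> {}" "A \<subseteq> W" "good W"
  obtains C where "good C" "connected C" "A \<subseteq> C" "C \<subseteq> W"
proof -
  obtain a where a: "a \<in> A" using assms(2) by blast
  let ?C = "connected_component_set W a"
  have "openin (top_of_set S) ?C"
    using locally_disc_like_component[OF S(1)] assms(4) by (auto simp: good_def)
  then have "good ?C" using good_subset[OF assms(4)] connected_component_subset by blast
  moreover have "A \<subseteq> ?C" by (rule connected_component_maximal[OF a assms(1,3)])
  ultimately show ?thesis using that[of ?C] connected_component_subset by blast
qed

lemma good_path:
  assumes "good C" "connected C" "x \<in> preimage C" "y \<in> preimage C"
  obtains \<gamma> where "path \<gamma>" "path_image \<gamma> \<subseteq> preimage C" "pathstart \<gamma> = x" "pathfinish \<gamma> = y"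
proof -
  have "path_connected (preimage C)" using preimage_connected(2) assms(1,2) by (auto simp: good_def)
  then show ?thesis using that assms(3,4) unfolding path_connected_def by blast
qed

text \<open>The union of two good sets need not be good, so the two paths are not compared directly.
  Each is compared with a third one that runs over both \<open>W\<close> and \<open>W'\<close>; the
  connected set \<open>A\<close>, in practice the image of a simplex, puts both end points over one
  component of the intersection.\<close>

lemma good_paths_Ker:
  assumes "good W" "path \<gamma>" "path_image \<gamma> \<subseteq> preimage W" "good W'" "path \<gamma>'" "path_image \<gamma>' \<subseteq> preimage W'"
    and "pathstart \<gamma> = pathstart \<gamma>'" "pathfinish \<gamma> = pathfinish \<gamma>'"
    and A: "connected A" "A \<subseteq> W" "A \<subseteq> W'" "f (pathstart \<gamma>) \<in> A" "f (pathfinish \<gamma>) \<in> A"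
  shows "path_chain \<gamma> - path_chain \<gamma>' \<in> Ker"
proof -
  have "openin (top_of_set S) (W \<inter> W')" using assms(1,4) by (auto simp: good_def)
  then have "good (W \<inter> W')" by (rule good_subset[OF assms(1)]) auto
  then obtain C where C: "good C" "connected C" "A \<subseteq> C" "C \<subseteq> W \<inter> W'"
    using good_connected_neighborhood[OF A(1) _ _ \<open>good (W \<inter> W')\<close>] A by (metis empty_iff le_inf_iff)
  have "pathstart \<gamma> \<in> M" "pathfinish \<gamma> \<in> M" using assms(3) pathstart_in_path_image pathfinish_in_path_image by blast+
  then have "pathstart \<gamma> \<in> preimage C" "pathfinish \<gamma> \<in> preimage C" using A(4,5) C(3) by auto
  then obtain \<delta> where \<delta>: "path \<delta>" "path_image \<delta> \<subseteq> preimage C" "pathstart \<delta> = pathstart \<gamma>" "pathfinish \<delta> = pathfinish \<gamma>"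
    using good_path[OF C(1,2)] by metis
  have "path_image \<delta> \<subseteq> preimage W" "path_image \<delta> \<subseteq> preimage W'" using \<delta>(2) C(4) by auto
  then have "path_chain \<gamma> - path_chain \<delta> \<in> Ker" "path_chain \<gamma>' - path_chain \<delta> \<in> Ker"
    using trivial_over_paths[of "preimage W" \<gamma> \<delta>] trivial_over_paths[of "preimage W'" \<gamma>' \<delta>] assms \<delta> by (auto simp: good_def)
  from Ker_diff[OF this] show ?thesis by simp
qed

text \<open>Two cycles are compared through the following device. Fix a set-theoretic section \<open>m\<close> of \<open>f\<close>.
  A small simplex of \<open>S\<close> lifts to a path between the chosen points, and a point \<open>x\<close> of \<open>M\<close> is joined
  to \<open>m (f x)\<close>; modulo the kernel of \<open>\<rho>\<close> both are independent of all choices.\<close>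

theorem good_cover_trivial_on_kernel:
  assumes cover: "\<And>y. y \<in> S \<Longrightarrow> \<exists>W. good W \<and> y \<in> W"
    and c: "is_cycle M c" and bd: "singular_relboundary 1 (top_of_set S) {} (chain_map 1 f c)"
  shows "ev c = 1"
proof -
  let ?\<Delta> = "standard_simplex 1"
  have "\<forall>y\<in>S. \<exists>x. x \<in> M \<and> f x = y" using f(2) by blast
  then obtain m where m: "\<And>y. y \<in> S \<Longrightarrow> m y \<in> M \<and> f (m y) = y" by metis
  have goodS: "W \<subseteq> S" if "good W" for W using that openin_imp_subset by (auto simp: good_def)
  have m_pre: "m y \<in> preimage C" if "y \<in> C" "good C" for y C
    using m[of y] goodS[OF that(2)] that(1) by auto
  define tP where "tP s W \<gamma> \<longleftrightarrow> good W \<and> s ` ?\<Delta> \<subseteq> W \<and> path \<gamma> \<and> path_image \<gamma> \<subseteq> preimage W \<and>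
     pathstart \<gamma> = m (simplex_start s) \<and> pathfinish \<gamma> = m (simplex_end s)" for s W \<gamma>
  \<comment> \<open>The value is arbitrary for a simplex that lies in no good set; after enough
    subdivisions such simplices do not occur.\<close>
  define tp where "tp s = (SOME \<gamma>. \<exists>W. tP s W \<gamma>)" for s
  define kP where "kP x W \<gamma> \<longleftrightarrow> good W \<and> f x \<in> W \<and> path \<gamma> \<and> path_image \<gamma> \<subseteq> preimage W \<and>
     pathstart \<gamma> = m (f x) \<and> pathfinish \<gamma> = x" for x W \<gamma>
  define kp where "kp x = (SOME \<gamma>. \<exists>W. kP x W \<gamma>)" for x
  have verts: "simplex_start s \<in> s ` ?\<Delta>" "simplex_end s \<in> s ` ?\<Delta>" for s :: "(nat \<Rightarrow> real) \<Rightarrow> 'c"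
    using vertices_in_simplex_1 by blast+
  have tp: "path_chain (tp s) - path_chain \<gamma> \<in> Ker"
    if s: "connected (s ` ?\<Delta>)" and \<gamma>: "tP s W \<gamma>" for s W \<gamma>
  proof -
    have "\<exists>W. tP s W (tp s)" unfolding tp_def using \<gamma> by (intro someI_ex[of "\<lambda>\<gamma>. \<exists>W. tP s W \<gamma>"]) blast
    then obtain W' where t: "tP s W' (tp s)" by blast
    have "s ` ?\<Delta> \<subseteq> S" using \<gamma> goodS[of W] unfolding tP_def by blast
    then have "simplex_start s \<in> S" "simplex_end s \<in> S" using verts[of s] by auto
    then have "f (m (simplex_start s)) = simplex_start s" "f (m (simplex_end s)) = simplex_end s" using m by auto
    then show ?thesis
      using good_paths_Ker[of W' "tp s" W \<gamma> "s ` ?\<Delta>"] t \<gamma> s verts[of s] unfolding tP_def by auto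
  qed
  have kp: "path_chain (kp x) - path_chain \<gamma> \<in> Ker" if x: "x \<in> M" and \<gamma>: "kP x W \<gamma>" for x W \<gamma>
  proof -
    have "\<exists>W. kP x W (kp x)" unfolding kp_def using \<gamma> by (intro someI_ex[of "\<lambda>\<gamma>. \<exists>W. kP x W \<gamma>"]) blast
    then obtain W' where t: "kP x W' (kp x)" by blast
    have "f (m (f x)) = f x" using m x f(2) by blast
    then show ?thesis
      using good_paths_Ker[of W' "kp x" W \<gamma> "{f x}"] t \<gamma> unfolding kP_def by auto
  qed
  \<comment> \<open>The only point of \<open>standard_simplex 0\<close>, at which a 0-simplex is
    evaluated to recover its point. The three linear extensions below lift 1-chains of
    \<open>S\<close>, attach the joining paths to 0-chains of \<open>M\<close>, and apply
    \<open>m\<close> to 0-chains of \<open>S\<close>.\<close>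
  define e0 where "e0 = (\<lambda>i::nat. if i = 0 then 1 else (0::real))"
  define T where "T = frag_extend (\<lambda>s. path_chain (tp s))"
  define \<kappa> where "\<kappa> = frag_extend (\<lambda>v. path_chain (kp (v e0)))"
  define \<mu> where "\<mu> = frag_extend (\<lambda>v. point_chain (m (v e0)))"
  have \<kappa>_pt: "\<kappa> (point_chain x) = path_chain (kp x)" for x
    by (simp add: \<kappa>_def point_chain_def e0_def)
  have \<mu>_pt: "\<mu> (point_chain x) = point_chain (m x)" for x
    by (simp add: \<mu>_def point_chain_def e0_def)
  have add: "T (a - b) = T a - T b" "\<kappa> (a' - b') = \<kappa> a' - \<kappa> b'" "\<mu> (a'' - b'') = \<mu> a'' - \<mu> b''" for a b a' b' a'' b''
    by (simp_all add: T_def \<kappa>_def \<mu>_def frag_extend_diff)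
  have zero: "T 0 = 0" "\<kappa> 0 = 0" "\<mu> 0 = 0" by (simp_all add: T_def \<kappa>_def \<mu>_def)
  \<comment> \<open>A small simplex, the lift of its image and the joining paths at its two ends
    form a closed quadrilateral over one good set.\<close>
  have step1: "frag_of \<sigma> - T (chain_map 1 f (frag_of \<sigma>)) - \<kappa> (chain_boundary 1 (frag_of \<sigma>)) \<in> Ker"
    if \<sigma>: "singular_simplex 1 (top_of_set M) \<sigma>" "\<sigma> ` ?\<Delta> \<subseteq> preimage W" "good W" for \<sigma> W
  proof -
    obtain \<gamma> where \<gamma>: "path \<gamma>" "path_image \<gamma> = \<sigma> ` ?\<Delta>" "path_image \<gamma> \<subseteq> M" "frag_of \<sigma> = path_chain \<gamma>"
      "pathstart \<gamma> = simplex_start \<sigma>" "pathfinish \<gamma> = simplex_end \<sigma>"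
      using simplex_as_path[OF \<sigma>(1)] by metis
    define s where "s = simplex_map 1 f \<sigma>"
    have s_img: "s ` ?\<Delta> = f ` \<sigma> ` ?\<Delta>" by (auto simp: s_def simplex_map_def)
    have conn: "connected (s ` ?\<Delta>)"
      unfolding s_img \<gamma>(2)[symmetric]
      using connected_path_image[OF \<gamma>(1)] continuous_on_subset[OF f(1) \<gamma>(3)] by (rule connected_continuous_image[rotated])
    have se: "simplex_start s = f (pathstart \<gamma>)" "simplex_end s = f (pathfinish \<gamma>)"
      using vertices_in_simplex_1 \<gamma>(5,6) by (simp_all add: s_def simplex_map_def del: basis_in_standard_simplex)
    have "s ` ?\<Delta> \<subseteq> W" using \<sigma>(2) by (auto simp: s_img)
    then obtain C where C: "good C" "connected C" "s ` ?\<Delta> \<subseteq> C" "C \<subseteq> W"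
      using good_connected_neighborhood[OF conn _ _ \<sigma>(3)] verts(1)[of s] by (metis empty_iff)
    let ?x = "pathstart \<gamma>" and ?y = "pathfinish \<gamma>"
    have xy: "?x \<in> M" "?y \<in> M" "f ?x \<in> C" "f ?y \<in> C"
      using subsetD[OF \<gamma>(3) pathstart_in_path_image] subsetD[OF \<gamma>(3) pathfinish_in_path_image]
        subsetD[OF C(3) verts(1)[of s]] subsetD[OF C(3) verts(2)[of s]] unfolding se by auto
    then have pre: "?x \<in> preimage C" "?y \<in> preimage C" "m (f ?x) \<in> preimage C" "m (f ?y) \<in> preimage C"
      using m_pre C(1) by auto
    obtain t where t: "path t" "path_image t \<subseteq> preimage C" "pathstart t = m (f ?x)" "pathfinish t = m (f ?y)"
      using good_path[OF C(1,2) pre(3,4)] by metis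
    obtain k where k: "path k" "path_image k \<subseteq> preimage C" "pathstart k = m (f ?x)" "pathfinish k = ?x"
      using good_path[OF C(1,2) pre(3,1)] by metis
    obtain l where l: "path l" "path_image l \<subseteq> preimage C" "pathstart l = m (f ?y)" "pathfinish l = ?y"
      using good_path[OF C(1,2) pre(4,2)] by metis
    have \<gamma>C: "path_image \<gamma> \<subseteq> preimage C"
      using \<gamma>(3) C(3) unfolding s_img \<gamma>(2)[symmetric] by auto
    have "is_cycle (preimage C) (path_chain \<gamma> - path_chain t - (path_chain l - path_chain k))"
      unfolding is_cycle_iff
      by (intro conjI singular_chain_diff singular_chain_path \<gamma>(1) \<gamma>C t(1,2) k(1,2) l(1,2))
        (simp add: chain_boundary_diff chain_boundary_path t k l)
    then have z: "path_chain \<gamma> - path_chain t - (path_chain l - path_chain k) \<in> Ker"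
      using trivial_over_Ker C(1) by (auto simp: good_def)
    have 1: "path_chain (tp s) - path_chain t \<in> Ker"
      by (rule tp[OF conn, of C]) (use t C se in \<open>auto simp: tP_def\<close>)
    have 2: "path_chain (kp ?x) - path_chain k \<in> Ker" by (rule kp[of _ C]) (use k C xy in \<open>auto simp: kP_def\<close>)
    have 3: "path_chain (kp ?y) - path_chain l \<in> Ker" by (rule kp[of _ C]) (use l C xy in \<open>auto simp: kP_def\<close>)
    have "path_chain \<gamma> - path_chain (tp s) - (path_chain (kp ?y) - path_chain (kp ?x)) \<in> Ker"
      using Ker_diff[OF Ker_diff[OF z 1] Ker_diff[OF 3 2]] by (simp add: algebra_simps)
    moreover have "T (chain_map 1 f (frag_of \<sigma>)) = path_chain (tp s)" by (simp add: T_def s_def)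
    moreover have "\<kappa> (chain_boundary 1 (frag_of \<sigma>)) = path_chain (kp ?y) - path_chain (kp ?x)"
      by (simp add: \<gamma>(4) chain_boundary_path add \<kappa>_pt)
    ultimately show ?thesis using \<gamma>(4) by simp
  qed
  \<comment> \<open>The lifts of the three faces meet in the chosen points over the vertices and
    close up to a cycle over one good set. Nothing is asserted about a lift of \<open>d\<close>
    itself.\<close>
  have step2: "T (chain_boundary 2 (frag_of d)) \<in> Ker"
    if d: "singular_simplex 2 (top_of_set S) d" "d ` standard_simplex 2 \<subseteq> W" "good W" for d W
  proof -
    have "connected (d ` standard_simplex 2)"
    proof -
      have "connectedin (top_of_set S) (d ` standard_simplex 2)"
        by (rule connectedin_continuous_map_image[where X = "subtopology (powertop_real UNIV) (standard_simplex 2)"])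
          (use d(1) connectedin_standard_simplex[of 2] in \<open>auto simp: singular_simplex_def connectedin_subtopology\<close>)
      then show ?thesis by (simp add: connectedin_subtopology)
    qed
    then obtain C where C: "good C" "connected C" "d ` standard_simplex 2 \<subseteq> C" "C \<subseteq> W"
      using good_connected_neighborhood[OF _ _ d(2,3)] nonempty_standard_simplex by (metis image_is_empty)
    define s where "s i = singular_face 2 i d" for i
    have face: "singular_simplex 1 (top_of_set S) (s i)" "s i ` ?\<Delta> \<subseteq> C" if "i \<le> 2" for i
    proof -
      have "singular_simplex 2 (top_of_set C) d"
        using d(1) C(3) by (auto simp: singular_simplex_def continuous_map_in_subtopology)
      then have "singular_simplex (2 - Suc 0) (top_of_set C) (s i)"
        unfolding s_def by (rule singular_simplex_singular_face) (use that in auto)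
      then have si: "singular_simplex 1 (top_of_set C) (s i)" by (simp add: One_nat_def numeral_2_eq_2)
      then show "s i ` ?\<Delta> \<subseteq> C" by (auto simp: singular_simplex_def continuous_map_in_subtopology)
      show "singular_simplex 1 (top_of_set S) (s i)"
        using si goodS[OF C(1)] by (rule singular_simplex_mono)
    qed
    have "\<exists>\<gamma>. tP (s i) C \<gamma>" if "i \<le> 2" for i
    proof -
      have "simplex_start (s i) \<in> C" "simplex_end (s i) \<in> C" using face(2)[OF that] verts[of "s i"] by auto
      then have "m (simplex_start (s i)) \<in> preimage C" "m (simplex_end (s i)) \<in> preimage C" using m_pre C(1) by auto
      then show ?thesis using good_path[OF C(1,2)] face(2)[OF that] C(1) unfolding tP_def by metis
    qed
    then obtain g where g: "\<And>i. i \<le> 2 \<Longrightarrow> tP (s i) C (g i)" by metis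
    have conn: "connected (s i ` ?\<Delta>)" if "i \<le> 2" for i
      using simplex_as_path[OF face(1)[OF that]] connected_path_image by metis
    have d3: "chain_boundary 2 (frag_of d) = frag_of (s 0) - frag_of (s 1) + frag_of (s 2)"
      by (simp add: chain_boundary_of s_def numeral_2_eq_2 One_nat_def)
    have bg: "chain_boundary 1 (path_chain (g i)) = \<mu> (chain_boundary 1 (frag_of (s i)))" if "i \<le> 2" for i
      using g[OF that] unfolding chain_boundary_1 chain_boundary_path add \<mu>_pt tP_def by simp
    \<comment> \<open>Closedness upstairs is inherited, through \<mu>, from the vanishing of the
      double boundary downstairs.\<close>
    have "chain_boundary 1 (path_chain (g 0) - path_chain (g 1) + path_chain (g 2)) = \<mu> (chain_boundary 1 (chain_boundary 2 (frag_of d)))"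
      unfolding d3 chain_boundary_add chain_boundary_diff
      using bg[of 0] bg[of 1] bg[of 2] by (simp add: \<mu>_def frag_extend_add frag_extend_diff)
    also have "chain_boundary 1 (chain_boundary 2 (frag_of d)) = 0"
      using chain_boundary_boundary_alt[of 1 "top_of_set S" "frag_of d"] d(1)
      by (simp add: singular_chain_of numeral_2_eq_2 One_nat_def)
    finally have "is_cycle (preimage C) (path_chain (g 0) - path_chain (g 1) + path_chain (g 2))"
      unfolding is_cycle_iff using g[of 0] g[of 1] g[of 2] zero
      by (auto simp: tP_def intro!: singular_chain_add singular_chain_diff singular_chain_path)
    then have z: "path_chain (g 0) - path_chain (g 1) + path_chain (g 2) \<in> Ker"
      using trivial_over_Ker C(1) by (auto simp: good_def)
    have k: "path_chain (tp (s i)) - path_chain (g i) \<in> Ker" if "i \<le> 2" for i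
      using tp[OF conn[OF that] g[OF that]] .
    have "(path_chain (tp (s 0)) - path_chain (g 0)) - (path_chain (tp (s 1)) - path_chain (g 1))
        + (path_chain (tp (s 2)) - path_chain (g 2)) + (path_chain (g 0) - path_chain (g 1) + path_chain (g 2)) \<in> Ker"
      by (intro Ker_add[OF Ker_add[OF Ker_diff] z] k) auto
    then have "path_chain (tp (s 0)) - path_chain (tp (s 1)) + path_chain (tp (s 2)) \<in> Ker" by (simp add: algebra_simps)
    then show ?thesis unfolding d3 by (simp add: T_def frag_extend_add frag_extend_diff)
  qed
  obtain e where e: "singular_chain 2 (top_of_set S) e" "chain_boundary 2 e = chain_map 1 f c"
    using bd by (auto simp: singular_boundary numeral_2_eq_2 One_nat_def)
  define \<C> where "\<C> = {W. good W}"
  obtain n1 where n1: "\<And>k \<sigma>. n1 \<le> k \<Longrightarrow> \<sigma> \<in> Poly_Mapping.keys ((singular_subdivision 2 ^^ k) e) \<Longrightarrow>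
      \<exists>V\<in>\<C>. \<sigma> \<in> standard_simplex 2 \<rightarrow> V"
    by (rule sufficient_iterated_singular_subdivision_exists[OF _ _ e(1), of \<C>])
      (use cover in \<open>auto simp: \<C>_def good_def\<close>)
  obtain n2 where n2: "\<And>k \<sigma>. n2 \<le> k \<Longrightarrow> \<sigma> \<in> Poly_Mapping.keys ((singular_subdivision 1 ^^ k) c) \<Longrightarrow>
      \<exists>V\<in>preimage ` \<C>. \<sigma> \<in> ?\<Delta> \<rightarrow> V"
  proof (rule sufficient_iterated_singular_subdivision_exists[of "preimage ` \<C>" "top_of_set M" 1 c])
    show "topspace (top_of_set M) \<subseteq> \<Union> (preimage ` \<C>)"
    proof
      fix x assume "x \<in> topspace (top_of_set M)"
      then have "x \<in> M" "f x \<in> S" using f(2) by auto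
      then show "x \<in> \<Union> (preimage ` \<C>)" using cover[of "f x"] by (auto simp: \<C>_def)
    qed
    show "singular_chain 1 (top_of_set M) c" using c is_cycle_iff by blast
  qed (use preimage_open in \<open>auto simp: \<C>_def good_def\<close>)
  \<comment> \<open>Both chains are subdivided equally often, which preserves the relation between
    the boundary of \<open>e' k\<close> and the image of \<open>c' k\<close>.\<close>
  define N where "N = max n1 n2"
  define c' where "c' k = (singular_subdivision 1 ^^ k) c" for k
  define e' where "e' k = (singular_subdivision 2 ^^ k) e" for k
  have ind: "is_cycle M (c' k) \<and> c' k - c \<in> Ker \<and> singular_chain 2 (top_of_set S) (e' k) \<and>
      chain_boundary 2 (e' k) = chain_map 1 f (c' k)" for k
  proof (induction k)
    case 0
    then show ?case using c e Ker_zero by (simp add: c'_def e'_def)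
  next
    case (Suc k)
    let ?Sc = "singular_subdivision 1 (c' k)" and ?Se = "singular_subdivision 2 (e' k)"
    have h: "homologous_rel 1 (top_of_set M) {} ?Sc (c' k)"
      using homologous_rel_singular_subdivision Suc by blast
    then have "is_cycle M ?Sc" using Suc homologous_rel_singular_relcycle by blast
    moreover have "?Sc - c' k \<in> Ker" using h Ker_boundary by (simp add: homologous_rel_def)
    then have "?Sc - c \<in> Ker" using Ker_add[of "?Sc - c' k" "c' k - c"] Suc by simp
    moreover have "singular_chain 2 (top_of_set S) ?Se" using Suc singular_chain_singular_subdivision by blast
    moreover have "chain_boundary 2 ?Se = chain_map 1 f ?Sc"
    proof -
      have "chain_boundary 2 ?Se = singular_subdivision 1 (chain_boundary 2 (e' k))"
        using chain_boundary_singular_subdivision[of 2 "top_of_set S" "e' k"] Suc by (simp add: numeral_2_eq_2 One_nat_def)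
      also have "\<dots> = chain_map 1 f ?Sc"
        using naturality_singular_subdivision[of 1 "top_of_set M" "c' k" f] Suc by (simp add: is_cycle_iff)
      finally show ?thesis .
    qed
    ultimately show ?case by (simp add: c'_def e'_def)
  qed
  have "c' N - T (chain_map 1 f (c' N)) - \<kappa> (chain_boundary 1 (c' N)) \<in> Ker"
  proof (rule chain_induct_mod[where \<Phi> = "\<lambda>c. c - T (chain_map 1 f c) - \<kappa> (chain_boundary 1 c)"])
    fix \<sigma> assume s: "\<sigma> \<in> Poly_Mapping.keys (c' N)"
    then obtain W where "good W" "\<sigma> \<in> ?\<Delta> \<rightarrow> preimage W" using n2[of N \<sigma>] by (auto simp: N_def c'_def \<C>_def)
    moreover have "singular_simplex 1 (top_of_set M) \<sigma>"
      using ind[of N] s by (auto simp: is_cycle_iff singular_chain_def)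
    ultimately show "frag_of \<sigma> - T (chain_map 1 f (frag_of \<sigma>)) - \<kappa> (chain_boundary 1 (frag_of \<sigma>)) \<in> Ker"
      by (intro step1) auto
  qed (use Ker_zero Ker_diff in \<open>auto simp: zero add chain_map_diff chain_boundary_diff\<close>)
  moreover have "T (chain_boundary 2 (e' N)) \<in> Ker"
  proof (rule chain_induct_mod[where \<Phi> = "\<lambda>c. T (chain_boundary 2 c)"])
    fix d assume s: "d \<in> Poly_Mapping.keys (e' N)"
    then obtain W where "good W" "d \<in> standard_simplex 2 \<rightarrow> W" using n1[of N d] by (auto simp: N_def e'_def \<C>_def)
    moreover have "singular_simplex 2 (top_of_set S) d"
      using ind[of N] s by (auto simp: singular_chain_def)
    ultimately show "T (chain_boundary 2 (frag_of d)) \<in> Ker" by (intro step2) auto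
  qed (use Ker_zero Ker_diff in \<open>auto simp: zero add chain_boundary_diff\<close>)
  \<comment> \<open>The two terms with \<open>T\<close> cancel, and the term with \<kappa> vanishes
    because \<open>c' N\<close> is a cycle.\<close>
  ultimately have "(c' N - T (chain_map 1 f (c' N)) - \<kappa> (chain_boundary 1 (c' N))) + T (chain_boundary 2 (e' N)) \<in> Ker"
    by (rule Ker_add)
  then have "c' N \<in> Ker" using ind[of N] by (simp add: is_cycle_iff zero)
  then have "c' N - (c' N - c) \<in> Ker" using ind[of N] Ker_diff by blast
  then show ?thesis by (simp add: Ker_def)
qed

end

section \<open>The direct image of a local system\<close>

lemma complex_ring_simps [simp]:
  "carrier complex_ring = UNIV" "mult complex_ring = (*)" "one complex_ring = 1"
  "zero complex_ring = 0" "add complex_ring = (+)"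
  by (simp_all add: complex_ring_def)

lemma cring_complex_ring: "cring complex_ring"
proof (rule cringI)
  show "abelian_group complex_ring"
    by (rule abelian_groupI) (auto intro: exI[of _ "- _"] left_minus)
  show "Group.comm_monoid complex_ring" by (rule comm_monoidI) auto
qed (auto simp: distrib_right)

lemma function_module_simps [simp]:
  "carrier (function_module I K) = K" "zero (function_module I K) = (\<lambda>i\<in>I. 0)"
  "add (function_module I K) = (\<lambda>s t. \<lambda>i\<in>I. s i + t i)" "smult (function_module I K) = (\<lambda>c s. \<lambda>i\<in>I. c * s i)"
  by (simp_all add: function_module_def)

lemma function_module_module:
  assumes ext: "K \<subseteq> extensional I" and zero: "(\<lambda>i\<in>I. 0) \<in> K"
    and add: "\<And>s t. s \<in> K \<Longrightarrow> t \<in> K \<Longrightarrow> (\<lambda>i\<in>I. s i + t i) \<in> K"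
    and smult: "\<And>c s. s \<in> K \<Longrightarrow> (\<lambda>i\<in>I. c * s i) \<in> K"
  shows "Module.module complex_ring (function_module I K)"
proof -
  have e: "s \<in> extensional I" if "s \<in> K" for s using ext that by blast
  have "abelian_group (function_module I K)"
  proof (rule abelian_groupI)
    fix x assume x: "x \<in> carrier (function_module I K)"
    show "\<exists>y\<in>carrier (function_module I K). y \<oplus>\<^bsub>function_module I K\<^esub> x = \<zero>\<^bsub>function_module I K\<^esub>"
      using smult[of x "-1"] x by (intro bexI[of _ "\<lambda>i\<in>I. (-1) * x i"]) (auto intro!: restrict_ext)
  qed (use zero add e in \<open>auto intro!: extensionalityI[of _ I] simp: algebra_simps\<close>)
  then show ?thesis
    by (rule moduleI[OF cring_complex_ring])
      (use smult e in \<open>auto simp: algebra_simps intro!: extensionalityI[of _ I]\<close>)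
qed

text \<open>The library's \<open>subpath\<close> is available in normed spaces only.\<close>

definition subarc :: "real \<Rightarrow> real \<Rightarrow> (real \<Rightarrow> 'a) \<Rightarrow> real \<Rightarrow> 'a" where
  "subarc u v \<delta> = (\<lambda>x. \<delta> ((v - u) * x + u))"

lemma affine_unit_image: "(\<lambda>x. (v - u) * x + u) ` {0..1} = closed_segment u (v::real)"
proof -
  have "(v - u) * x + u = (1 - x) *\<^sub>R u + x *\<^sub>R v" for x by (simp add: algebra_simps)
  then show ?thesis by (auto simp: closed_segment_def image_def)
qed

lemma subarc:
  fixes \<delta> :: "real \<Rightarrow> 'a::topological_space"
  shows "path_image (subarc u v \<delta>) = \<delta> ` closed_segment u v"
    "pathstart (subarc u v \<delta>) = \<delta> u" "pathfinish (subarc u v \<delta>) = \<delta> v"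
    "path \<delta> \<Longrightarrow> u \<in> {0..1} \<Longrightarrow> v \<in> {0..1} \<Longrightarrow> path (subarc u v \<delta>)"
proof -
  show "path_image (subarc u v \<delta>) = \<delta> ` closed_segment u v"
    unfolding path_image_def affine_unit_image[symmetric] image_image subarc_def ..
  show "pathstart (subarc u v \<delta>) = \<delta> u" "pathfinish (subarc u v \<delta>) = \<delta> v"
    by (auto simp: subarc_def pathstart_def pathfinish_def)
  assume "path \<delta>" and uv: "u \<in> {0..1}" "v \<in> {0..1}"
  have "(\<lambda>x. (v - u) * x + u) ` {0..1} \<subseteq> {0..1}"
    unfolding affine_unit_image by (rule closed_segment_subset[OF uv convex_real_interval(5)])
  then show "path (subarc u v \<delta>)"
    using \<open>path \<delta>\<close> unfolding path_def subarc_def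
    by (intro continuous_on_compose2[where f = "\<lambda>x. (v - u) * x + u" and g = \<delta> and t = "{0..1}"])
      (auto intro!: continuous_intros)
qed

section \<open>The direct image is a sheaf\<close>

context fibration_character
begin

context
  fixes p :: 'a
  assumes p: "p \<in> M"
begin

abbreviation paths :: "'b set \<Rightarrow> (real \<Rightarrow> 'a) set" where
  "paths V \<equiv> paths_into M p (preimage V)"

text \<open>The carrier of the direct image over \<open>V\<close>, with the monodromy factor in the
  form given by \<open>ev_loop_class\<close>. The paths run anywhere in \<open>M\<close>; their end
  points lie over \<open>V\<close>.\<close>

definition sections :: "'b set \<Rightarrow> ((real \<Rightarrow> 'a) \<Rightarrow> complex) set" where
  "sections V = {s \<in> extensional (paths V).
     (\<forall>\<gamma>\<in>paths V. \<forall>\<gamma>'\<in>paths V. pathfinish \<gamma> = pathfinish \<gamma>' \<longrightarrow>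
        s \<gamma> = ev (path_chain \<gamma> - path_chain \<gamma>') * s \<gamma>') \<and>
     (\<forall>\<gamma>\<in>paths V. \<forall>\<delta>. path \<delta> \<and> path_image \<delta> \<subseteq> preimage V \<and> pathstart \<delta> = pathfinish \<gamma> \<longrightarrow>
        s (\<gamma> +++ \<delta>) = s \<gamma>)}"

abbreviation image_sheaf where
  "image_sheaf \<equiv> direct_image M f (rank_one_system M p \<rho>)"

lemma pathsD:
  assumes "\<gamma> \<in> paths V"
  shows "path \<gamma>" "path_image \<gamma> \<subseteq> M" "pathstart \<gamma> = p" "pathfinish \<gamma> \<in> M" "f (pathfinish \<gamma>) \<in> V"
  using assms by (auto simp: paths_into_def)

lemma pathsI:
  "path \<gamma> \<Longrightarrow> path_image \<gamma> \<subseteq> M \<Longrightarrow> pathstart \<gamma> = p \<Longrightarrow> f (pathfinish \<gamma>) \<in> V \<Longrightarrow> \<gamma> \<in> paths V"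
  using pathfinish_in_path_image[of \<gamma>] by (auto simp: paths_into_def)

lemma paths_change: "\<gamma> \<in> paths V \<Longrightarrow> f (pathfinish \<gamma>) \<in> W \<Longrightarrow> \<gamma> \<in> paths W"
  by (auto simp: paths_into_def)

lemma paths_mono: "V \<subseteq> W \<Longrightarrow> paths V \<subseteq> paths W"
  by (auto simp: paths_into_def)

lemma paths_join:
  assumes "\<gamma> \<in> paths V" "path \<delta>" "path_image \<delta> \<subseteq> M" "pathstart \<delta> = pathfinish \<gamma>" "f (pathfinish \<delta>) \<in> W"
  shows "\<gamma> +++ \<delta> \<in> paths W"
  using assms pathsD[OF assms(1)] by (intro pathsI) (auto simp: path_image_join)

lemma paths_cycle:
  assumes "\<gamma> \<in> paths V" "\<gamma>' \<in> paths W" "pathfinish \<gamma> = pathfinish \<gamma>'"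
  shows "is_cycle M (path_chain \<gamma> - path_chain \<gamma>')"
  using pathsD[OF assms(1)] pathsD[OF assms(2)] assms(3)
  by (auto simp: is_cycle_iff chain_boundary_diff chain_boundary_path intro!: singular_chain_diff singular_chain_path)

lemma sec_image_sheaf: "sec image_sheaf V = function_module (paths V) (sections V)"
proof -
  have "\<rho> (loop_class M (\<gamma> +++ reversepath \<gamma>')) = ev (path_chain \<gamma> - path_chain \<gamma>')"
    if "\<gamma> \<in> paths V" "\<gamma>' \<in> paths V" "pathfinish \<gamma> = pathfinish \<gamma>'" for \<gamma> \<gamma>'
    using ev_loop_class[of \<gamma> \<gamma>'] pathsD[OF that(1)] pathsD[OF that(2)] that(3) by simp
  then have "sections V = {s \<in> extensional (paths V).
     (\<forall>\<gamma>\<in>paths V. \<forall>\<gamma>'\<in>paths V. pathfinish \<gamma> = pathfinish \<gamma>' \<longrightarrow>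
        s \<gamma> = \<rho> (loop_class M (\<gamma> +++ reversepath \<gamma>')) * s \<gamma>') \<and>
     (\<forall>\<gamma>\<in>paths V. \<forall>\<delta>. path \<delta> \<and> path_image \<delta> \<subseteq> preimage V \<and> pathstart \<delta> = pathfinish \<gamma> \<longrightarrow>
        s (\<gamma> +++ \<delta>) = s \<gamma>)}"
    unfolding sections_def by (intro Collect_cong conj_cong refl ball_cong imp_cong) auto
  then show ?thesis by (simp add: direct_image_def rank_one_system_def)
qed

lemma res_image_sheaf: "res image_sheaf V W s = restrict s (paths W)"
  by (simp add: direct_image_def rank_one_system_def)

lemma sections_ext: "s \<in> sections V \<Longrightarrow> s \<in> extensional (paths V)"
  and sections_eq: "s \<in> sections V \<Longrightarrow> \<gamma> \<in> paths V \<Longrightarrow> \<gamma>' \<in> paths V \<Longrightarrow> pathfinish \<gamma> = pathfinish \<gamma>' \<Longrightarrow>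
     s \<gamma> = ev (path_chain \<gamma> - path_chain \<gamma>') * s \<gamma>'"
  and sections_prolong: "s \<in> sections V \<Longrightarrow> \<gamma> \<in> paths V \<Longrightarrow> path \<delta> \<Longrightarrow> path_image \<delta> \<subseteq> preimage V \<Longrightarrow>
     pathstart \<delta> = pathfinish \<gamma> \<Longrightarrow> s (\<gamma> +++ \<delta>) = s \<gamma>"
  unfolding sections_def by blast+

lemma paths_prolong:
  assumes "\<gamma> \<in> paths V" "path \<delta>" "path_image \<delta> \<subseteq> preimage V" "pathstart \<delta> = pathfinish \<gamma>"
  shows "\<gamma> +++ \<delta> \<in> paths V"
  using paths_join[OF assms(1,2) _ assms(4)] assms(3) pathfinish_in_path_image[of \<delta>] by auto

lemma sectionsI:
  assumes "s \<in> extensional (paths V)"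
    and "\<And>\<gamma> \<gamma>'. \<gamma> \<in> paths V \<Longrightarrow> \<gamma>' \<in> paths V \<Longrightarrow> pathfinish \<gamma> = pathfinish \<gamma>' \<Longrightarrow>
     s \<gamma> = ev (path_chain \<gamma> - path_chain \<gamma>') * s \<gamma>'"
    and "\<And>\<gamma> \<delta>. \<gamma> \<in> paths V \<Longrightarrow> \<gamma> +++ \<delta> \<in> paths V \<Longrightarrow> path \<delta> \<Longrightarrow> path_image \<delta> \<subseteq> preimage V \<Longrightarrow>
     pathstart \<delta> = pathfinish \<gamma> \<Longrightarrow> s (\<gamma> +++ \<delta>) = s \<gamma>"
  shows "s \<in> sections V"
  unfolding sections_def
proof (intro CollectI conjI ballI allI impI)
  fix \<gamma> \<delta> assume g: "\<gamma> \<in> paths V" "path \<delta> \<and> path_image \<delta> \<subseteq> preimage V \<and> pathstart \<delta> = pathfinish \<gamma>"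
  then show "s (\<gamma> +++ \<delta>) = s \<gamma>" using assms(3)[OF g(1) paths_prolong[OF g(1)]] by blast
qed (fact assms(1), rule assms(2))

lemma sections_smult:
  assumes s: "s \<in> sections V" shows "(\<lambda>\<gamma>\<in>paths V. c * s \<gamma>) \<in> sections V"
proof (rule sectionsI)
  fix \<gamma> \<gamma>' assume g: "\<gamma> \<in> paths V" "\<gamma>' \<in> paths V" "pathfinish \<gamma> = pathfinish \<gamma>'"
  show "(\<lambda>\<gamma>\<in>paths V. c * s \<gamma>) \<gamma> = ev (path_chain \<gamma> - path_chain \<gamma>') * (\<lambda>\<gamma>\<in>paths V. c * s \<gamma>) \<gamma>'"
    by (simp add: g(1,2) sections_eq[OF s g])
next
  fix \<gamma> \<delta> assume g: "\<gamma> \<in> paths V" "\<gamma> +++ \<delta> \<in> paths V" "path \<delta>" "path_image \<delta> \<subseteq> preimage V" "pathstart \<delta> = pathfinish \<gamma>"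
  show "(\<lambda>\<gamma>\<in>paths V. c * s \<gamma>) (\<gamma> +++ \<delta>) = (\<lambda>\<gamma>\<in>paths V. c * s \<gamma>) \<gamma>"
    by (simp add: g(1,2) sections_prolong[OF s g(1,3-5)])
qed simp

lemma sections_restrict:
  assumes "s \<in> sections V" "W \<subseteq> V" shows "restrict s (paths W) \<in> sections W"
proof (rule sectionsI)
  fix \<gamma> \<delta> assume g: "\<gamma> \<in> paths W" "\<gamma> +++ \<delta> \<in> paths W" "path \<delta>" "path_image \<delta> \<subseteq> preimage W" "pathstart \<delta> = pathfinish \<gamma>"
  have "path_image \<delta> \<subseteq> preimage V" using g(4) assms(2) by blast
  then show "restrict s (paths W) (\<gamma> +++ \<delta>) = restrict s (paths W) \<gamma>"
    using g sections_prolong[OF assms(1)] paths_mono[OF assms(2)] by auto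
next
  fix \<gamma> \<gamma>' assume g: "\<gamma> \<in> paths W" "\<gamma>' \<in> paths W" "pathfinish \<gamma> = pathfinish \<gamma>'"
  then have "\<gamma> \<in> paths V" "\<gamma>' \<in> paths V" using paths_mono[OF assms(2)] by auto
  from sections_eq[OF assms(1) this g(3)] g
  show "restrict s (paths W) \<gamma> = ev (path_chain \<gamma> - path_chain \<gamma>') * restrict s (paths W) \<gamma>'" by simp
qed simp

lemma sections_module: "Module.module complex_ring (sec image_sheaf V)"
  unfolding sec_image_sheaf
proof (rule function_module_module)
  show "(\<lambda>i\<in>paths V. 0) \<in> sections V" by (rule sectionsI) auto
  fix s t assume st: "s \<in> sections V" "t \<in> sections V"
  show "(\<lambda>i\<in>paths V. s i + t i) \<in> sections V"
  proof (rule sectionsI)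
    fix \<gamma> \<gamma>' assume g: "\<gamma> \<in> paths V" "\<gamma>' \<in> paths V" "pathfinish \<gamma> = pathfinish \<gamma>'"
    show "(\<lambda>i\<in>paths V. s i + t i) \<gamma> = ev (path_chain \<gamma> - path_chain \<gamma>') * (\<lambda>i\<in>paths V. s i + t i) \<gamma>'"
      by (simp add: g(1,2) sections_eq[OF st(1) g] sections_eq[OF st(2) g] distrib_left)
  next
    fix \<gamma> \<delta> assume g: "\<gamma> \<in> paths V" "\<gamma> +++ \<delta> \<in> paths V" "path \<delta>" "path_image \<delta> \<subseteq> preimage V" "pathstart \<delta> = pathfinish \<gamma>"
    show "(\<lambda>i\<in>paths V. s i + t i) (\<gamma> +++ \<delta>) = (\<lambda>i\<in>paths V. s i + t i) \<gamma>"
      by (simp add: g(1,2) sections_prolong[OF st(1) g(1,3-5)] sections_prolong[OF st(2) g(1,3-5)])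
  qed simp
  show "(\<lambda>i\<in>paths V. c * s i) \<in> sections V" for c by (rule sections_smult[OF st(1)])
qed (use sections_ext in auto)

text \<open>The three parameters may come in any order, since the relation is pushed forward from a
  cycle in the unit interval.\<close>

lemma path_chain_subarc:
  assumes "path \<delta>" "path_image \<delta> \<subseteq> M" "u \<in> {0..1}" "v \<in> {0..1}" "w \<in> {0..1}"
  shows "path_chain (subarc u v \<delta>) + path_chain (subarc v w \<delta>) - path_chain (subarc u w \<delta>) \<in> Ker"
proof -
  define l where "l u v = (\<lambda>x::real. (v - u) * x + u)" for u v
  have im: "l u v ` {0..1} \<subseteq> {0..1}" if "u \<in> {0..1}" "v \<in> {0..1}" for u v
    using affine_unit_image[where u = u and v = v] that closed_segment_subset[OF that convex_real_interval(5)]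
    by (auto simp: l_def)
  have l: "path (l u v)" for u v by (auto simp: l_def path_def intro!: continuous_intros)
  have "is_cycle {0..1} (path_chain (l u v) + path_chain (l v w) - path_chain (l u w))"
    unfolding is_cycle_iff
  proof (intro conjI singular_chain_add singular_chain_diff singular_chain_path l)
    show "chain_boundary 1 (path_chain (l u v) + path_chain (l v w) - path_chain (l u w)) = 0"
      by (simp add: chain_boundary_add chain_boundary_diff chain_boundary_path l_def pathstart_def pathfinish_def)
  qed (use im assms in \<open>auto simp: path_image_def\<close>)
  from interval_cycle_push[OF assms(1,2) this]
  have "singular_relboundary 1 (top_of_set M) {}
     (path_chain (\<delta> \<circ> l u v) + path_chain (\<delta> \<circ> l v w) - path_chain (\<delta> \<circ> l u w))"
    by (simp add: chain_map_add chain_map_diff chain_map_path)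
  moreover have "\<delta> \<circ> l u v = subarc u v \<delta>" for u v by (auto simp: l_def subarc_def)
  ultimately show ?thesis by (auto intro: Ker_boundary)
qed

text \<open>The local sections are invariant under prolongation inside one member of the cover,
  whereas \<delta> may run through several. The value after following \<delta> up to time
  \<open>r\<close> is locally constant in \<open>r\<close>, and the unit interval is connected; this
  takes the place of a subdivision of \<delta>.\<close>

lemma sections_glue_prolong:
  assumes open_U: "\<And>U. U \<in> \<U> \<Longrightarrow> openin (top_of_set S) U"
    and sec: "\<And>U. U \<in> \<U> \<Longrightarrow> s U \<in> sections U"
    and t: "\<And>U \<gamma>. U \<in> \<U> \<Longrightarrow> \<gamma> \<in> paths U \<Longrightarrow> t \<gamma> = s U \<gamma>"
    and \<gamma>: "\<gamma> \<in> paths (\<Union>\<U>)" and \<delta>: "path \<delta>" "path_image \<delta> \<subseteq> preimage (\<Union>\<U>)" "pathstart \<delta> = pathfinish \<gamma>"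
  shows "t (\<gamma> +++ \<delta>) = t \<gamma>"
proof -
  have \<delta>M: "path_image \<delta> \<subseteq> M" using \<delta>(2) by auto
  have sub: "path (subarc u v \<delta>)" "path_image (subarc u v \<delta>) \<subseteq> path_image \<delta>"
    "pathstart (subarc u v \<delta>) = \<delta> u" "pathfinish (subarc u v \<delta>) = \<delta> v" if "u \<in> {0..1}" "v \<in> {0..1}" for u v
    using that \<delta>(1) subarc[where \<delta> = \<delta> and u = u and v = v] closed_segment_subset[OF that convex_real_interval(5)]
    by (auto simp: path_image_def)
  have d0: "\<delta> 0 = pathfinish \<gamma>" using \<delta>(3) by (simp add: pathstart_def)
  have mem: "\<gamma> +++ subarc 0 r \<delta> \<in> paths W" if "r \<in> {0..1}" "f (\<delta> r) \<in> W" for r W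
    by (rule paths_join[OF \<gamma>]) (use sub[of 0 r] that d0 \<delta>M in auto)
  have key: "t (\<gamma> +++ subarc 0 r \<delta>) = t \<gamma>" if r: "r \<in> {0..1}" for r
  proof (rule connected_induction_simple[of "{0..1::real}" 0 r "\<lambda>r. t (\<gamma> +++ subarc 0 r \<delta>) = t \<gamma>"])
    obtain U where U: "U \<in> \<U>" "f (pathfinish \<gamma>) \<in> U" using pathsD(5)[OF \<gamma>] by blast
    have gU: "\<gamma> \<in> paths U" using paths_change[OF \<gamma> U(2)] .
    have "path_image (subarc 0 0 \<delta>) \<subseteq> preimage U"
      using d0 U(2) pathsD(4)[OF \<gamma>] by (auto simp: subarc)
    then have "s U (\<gamma> +++ subarc 0 0 \<delta>) = s U \<gamma>"
      using sections_prolong[OF sec[OF U(1)] gU] sub[of 0 0] d0 by simp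
    then show "t (\<gamma> +++ subarc 0 0 \<delta>) = t \<gamma>"
      using t[OF U(1) gU] t[OF U(1) mem[of 0 U]] d0 U(2) by simp
    fix a :: real assume a: "a \<in> {0..1}"
    have "\<delta> a \<in> path_image \<delta>" using a by (auto simp: path_image_def)
    then obtain U where U: "U \<in> \<U>" "f (\<delta> a) \<in> U" using \<delta>(2) by blast
    have "openin (top_of_set {0..1}) ({0..1} \<inter> \<delta> -` preimage U)"
      by (rule continuous_openin_preimage[OF _ _ preimage_open[OF open_U[OF U(1)]]])
        (use \<delta>(1) \<delta>M in \<open>auto simp: path_def path_image_def\<close>)
    then obtain Y where Y: "open Y" "{0..1} \<inter> \<delta> -` preimage U = {0..1} \<inter> Y" by (auto simp: openin_open)
    have "a \<in> Y" using Y(2) a U(2) \<delta>M \<open>\<delta> a \<in> path_image \<delta>\<close> by blast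
    then obtain \<epsilon> where \<epsilon>: "\<epsilon> > 0" "ball a \<epsilon> \<subseteq> Y" using Y(1) openE by blast
    let ?T = "{0..1} \<inter> ball a \<epsilon>"
    have "t (\<gamma> +++ subarc 0 v \<delta>) = t (\<gamma> +++ subarc 0 u \<delta>)" if uv: "u \<in> ?T" "v \<in> ?T" for u v
    proof -
      have "convex ?T" by (intro convex_Int) auto
      then have "closed_segment u v \<subseteq> ?T" using uv by (simp add: convex_contains_segment)
      then have inU: "path_image (subarc u v \<delta>) \<subseteq> preimage U"
        using Y(2) \<epsilon>(2) unfolding subarc(1) by blast
      have fu: "f (\<delta> u) \<in> U" "f (\<delta> v) \<in> U" using Y(2) \<epsilon>(2) uv by blast+
      let ?g = "\<gamma> +++ subarc 0 u \<delta>" and ?h = "\<gamma> +++ subarc 0 v \<delta>"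
      have g: "?g \<in> paths U" "?h \<in> paths U" using mem uv fu by auto
      have ge: "pathfinish ?g = \<delta> u" using sub[of 0 u] uv by simp
      have s1: "s U (?g +++ subarc u v \<delta>) = s U ?g"
        using sections_prolong[OF sec[OF U(1)] g(1)] sub[of u v] uv inU ge by simp
      have gp: "?g +++ subarc u v \<delta> \<in> paths U"
        by (rule paths_prolong[OF g(1)]) (use sub[of u v] uv inU ge in auto)
      \<comment> \<open>These are different paths to the same point. Equivariance compares their
        values, and the factor is 1 because the chains agree modulo \<open>Ker\<close>.\<close>
      have s2: "s U ?h = ev (path_chain ?h - path_chain (?g +++ subarc u v \<delta>)) * s U (?g +++ subarc u v \<delta>)"
        by (rule sections_eq[OF sec[OF U(1)] g(2) gp]) (use sub[of 0 v] sub[of u v] uv in auto)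
      have k1: "path_chain \<gamma> + path_chain (subarc 0 v \<delta>) - path_chain ?h \<in> Ker"
        "path_chain \<gamma> + path_chain (subarc 0 u \<delta>) - path_chain ?g \<in> Ker"
        using pathsD[OF \<gamma>] sub[of 0 v] sub[of 0 u] uv \<delta>M d0 by (auto intro!: Ker_boundary path_chain_join)
      have k2: "path_chain ?g + path_chain (subarc u v \<delta>) - path_chain (?g +++ subarc u v \<delta>) \<in> Ker"
        using pathsD[OF g(1)] sub[of u v] uv \<delta>M ge by (auto intro!: Ker_boundary path_chain_join)
      have k3: "path_chain (subarc 0 u \<delta>) + path_chain (subarc u v \<delta>) - path_chain (subarc 0 v \<delta>) \<in> Ker"
        by (rule path_chain_subarc[OF \<delta>(1) \<delta>M]) (use uv in auto)
      have "path_chain ?h - path_chain (?g +++ subarc u v \<delta>) \<in> Ker"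
        using Ker_diff[OF Ker_diff[OF Ker_add[OF k1(2) k2] k1(1)] k3] by (simp add: algebra_simps)
      then have "s U ?h = s U ?g" using s1 s2 by (simp add: Ker_def)
      then show ?thesis using t[OF U(1)] g by simp
    qed
    moreover have "openin (top_of_set {0..1}) ?T" by auto
    moreover have "a \<in> ?T" using a \<epsilon>(1) by simp
    ultimately show "\<exists>T. openin (top_of_set {0..1}) T \<and> a \<in> T \<and>
       (\<forall>x\<in>T. \<forall>y\<in>T. t (\<gamma> +++ subarc 0 x \<delta>) = t \<gamma> \<longrightarrow> t (\<gamma> +++ subarc 0 y \<delta>) = t \<gamma>)" by metis
  qed (use r in auto)
  have "subarc 0 1 \<delta> = \<delta>" by (simp add: subarc_def)
  then show ?thesis using key[of 1] by simp
qed

text \<open>Stated for a topology \<open>X\<close> of open subsets of \<open>S\<close>, because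
  local systems are considered on the complements of finite sets. Gluing is possible path by path:
  whether a path belongs to a member of the cover depends on its end point alone.\<close>

theorem sheaf_image_sheaf:
  assumes X: "\<And>V. openin X V \<Longrightarrow> openin (top_of_set S) V"
  shows "sheaf X image_sheaf"
  unfolding sheaf_def
proof (intro conjI allI impI)
  fix U show "Module.module complex_ring (sec image_sheaf U)" by (rule sections_module)
next
  fix U V assume "openin X U \<and> openin X V \<and> V \<subseteq> U"
  then have V: "V \<subseteq> U" by blast
  note P = subsetD[OF paths_mono[OF V]]
  show "linear_between (sec image_sheaf U) (sec image_sheaf V) (res image_sheaf U V)"
    unfolding linear_between_def sec_image_sheaf res_image_sheaf
    using sections_restrict[OF _ V] P by (auto intro!: restrict_ext)
next
  fix U assume "openin X U"
  show "\<forall>s\<in>carrier (sec image_sheaf U). res image_sheaf U U s = s"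
    unfolding sec_image_sheaf res_image_sheaf using sections_ext by (auto simp: extensional_restrict)
next
  fix U V W assume "openin X U \<and> openin X V \<and> openin X W \<and> W \<subseteq> V \<and> V \<subseteq> U"
  then have "paths V \<inter> paths W = paths W" using paths_mono by blast
  then show "\<forall>s\<in>carrier (sec image_sheaf U). res image_sheaf V W (res image_sheaf U V s) = res image_sheaf U W s"
    unfolding res_image_sheaf by (simp add: restrict_restrict)
next
  fix \<U> s
  assume a: "(\<forall>U\<in>\<U>. openin X U \<and> s U \<in> carrier (sec image_sheaf U)) \<and>
    (\<forall>U\<in>\<U>. \<forall>V\<in>\<U>. res image_sheaf U (U \<inter> V) (s U) = res image_sheaf V (U \<inter> V) (s V))"
  have sec: "s U \<in> sections U" if "U \<in> \<U>" for U using a that by (simp add: sec_image_sheaf)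
  have agree: "s U \<gamma> = s V \<gamma>" if "U \<in> \<U>" "V \<in> \<U>" "\<gamma> \<in> paths U" "\<gamma> \<in> paths V" for U V \<gamma>
  proof -
    have "\<gamma> \<in> paths (U \<inter> V)" using that pathsD by (intro paths_change[OF that(3)]) blast
    moreover have "restrict (s U) (paths (U \<inter> V)) = restrict (s V) (paths (U \<inter> V))"
      using a that unfolding res_image_sheaf by blast
    ultimately show ?thesis by (metis restrict_apply')
  qed
  define t where "t = (\<lambda>\<gamma>\<in>paths (\<Union>\<U>). s (SOME U. U \<in> \<U> \<and> f (pathfinish \<gamma>) \<in> U) \<gamma>)"
  have t: "t \<gamma> = s U \<gamma>" if "U \<in> \<U>" "\<gamma> \<in> paths U" for U \<gamma>
  proof -
    let ?V = "SOME U. U \<in> \<U> \<and> f (pathfinish \<gamma>) \<in> U"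
    have V: "?V \<in> \<U> \<and> f (pathfinish \<gamma>) \<in> ?V"
      by (rule someI[of _ U]) (use that pathsD in auto)
    then have "\<gamma> \<in> paths ?V" using paths_change[OF that(2)] by blast
    moreover have "\<gamma> \<in> paths (\<Union>\<U>)" using that paths_mono[of U "\<Union>\<U>"] by blast
    ultimately show ?thesis using agree[of ?V U \<gamma>] V that by (simp add: t_def)
  qed
  have cover: "\<exists>U\<in>\<U>. \<gamma> \<in> paths U" if "\<gamma> \<in> paths (\<Union>\<U>)" for \<gamma>
    using pathsD(5)[OF that] paths_change[OF that] by blast
  have "t \<in> sections (\<Union>\<U>)"
  proof (rule sectionsI)
    fix \<gamma> \<gamma>' assume g: "\<gamma> \<in> paths (\<Union>\<U>)" "\<gamma>' \<in> paths (\<Union>\<U>)" "pathfinish \<gamma> = pathfinish \<gamma>'"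
    then obtain U where U: "U \<in> \<U>" "\<gamma> \<in> paths U" using cover by blast
    then have "\<gamma>' \<in> paths U" using paths_change[OF g(2)] g(3) pathsD(5)[OF U(2)] by simp
    then show "t \<gamma> = ev (path_chain \<gamma> - path_chain \<gamma>') * t \<gamma>'"
      using sections_eq[OF sec[OF U(1)] U(2) _ g(3)] t U by simp
  next
    fix \<gamma> \<delta> assume "\<gamma> \<in> paths (\<Union>\<U>)" "path \<delta>" "path_image \<delta> \<subseteq> preimage (\<Union>\<U>)" "pathstart \<delta> = pathfinish \<gamma>"
    then show "t (\<gamma> +++ \<delta>) = t \<gamma>"
      using sections_glue_prolong[of \<U> s t \<gamma> \<delta>] X a sec t by blast
  qed (simp add: t_def)
  moreover have "restrict t (paths U) = s U" if "U \<in> \<U>" for U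
    by (rule extensionalityI[of _ "paths U"]) (use t[OF that] sections_ext[OF sec[OF that]] in auto)
  moreover have "t' = t" if t': "t' \<in> sections (\<Union>\<U>)" "\<forall>U\<in>\<U>. restrict t' (paths U) = s U" for t'
  proof (rule extensionalityI[of _ "paths (\<Union>\<U>)"])
    fix \<gamma> assume "\<gamma> \<in> paths (\<Union>\<U>)"
    then obtain U where U: "U \<in> \<U>" "\<gamma> \<in> paths U" using cover by blast
    then show "t' \<gamma> = t \<gamma>" using t'(2) t[OF U] by (metis restrict_apply')
  qed (use t' sections_ext in \<open>auto simp: t_def\<close>)
  ultimately show "\<exists>!t. t \<in> carrier (sec image_sheaf (\<Union>\<U>)) \<and> (\<forall>U\<in>\<U>. res image_sheaf (\<Union>\<U>) U t = s U)"
    unfolding sec_image_sheaf res_image_sheaf function_module_simps by (intro ex1I[of _ t]) blast+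
qed

end

end

section \<open>The singular support\<close>

context fibration_character
begin

context
  fixes p :: 'a
  assumes p: "p \<in> M"
begin

text \<open>The two conditions on a section combined: where the preimage of \<open>V\<close> is path
  connected, one value determines the section.\<close>

lemma sections_transport:
  assumes s: "s \<in> sections p V" and g: "\<gamma> \<in> paths p V" "\<gamma>' \<in> paths p V"
    and d: "path \<delta>" "path_image \<delta> \<subseteq> preimage V" "pathstart \<delta> = pathfinish \<gamma>'" "pathfinish \<delta> = pathfinish \<gamma>"
  shows "s \<gamma> = ev (path_chain \<gamma> - (path_chain \<gamma>' + path_chain \<delta>)) * s \<gamma>'"
proof -
  have j: "\<gamma>' +++ \<delta> \<in> paths p V" using paths_prolong[OF p g(2) d(1-3)] .
  have f: "pathfinish \<gamma> = pathfinish (\<gamma>' +++ \<delta>)" using d by simp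
  have "path_image \<delta> \<subseteq> M" using d(2) by auto
  then have k: "path_chain \<gamma>' + path_chain \<delta> - path_chain (\<gamma>' +++ \<delta>) \<in> Ker"
    using pathsD[OF p g(2)] d by (auto intro!: Ker_boundary path_chain_join)
  have "ev (path_chain \<gamma> - path_chain (\<gamma>' +++ \<delta>)) = ev (path_chain \<gamma> - (path_chain \<gamma>' + path_chain \<delta>))"
  proof (rule ev_cong[OF paths_cycle[OF p g(1) j f]])
    have "path_chain \<gamma> - path_chain (\<gamma>' +++ \<delta>) - (path_chain \<gamma> - (path_chain \<gamma>' + path_chain \<delta>)) =
       path_chain \<gamma>' + path_chain \<delta> - path_chain (\<gamma>' +++ \<delta>)" by (simp add: algebra_simps)
    then show "path_chain \<gamma> - path_chain (\<gamma>' +++ \<delta>) - (path_chain \<gamma> - (path_chain \<gamma>' + path_chain \<delta>)) \<in> Ker"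
      by (simp only: k)
  qed
  then show ?thesis
    using sections_eq[OF p s g(1) j f] sections_prolong[OF p s g(2) d(1-3)] by simp
qed

lemma paths_exist:
  assumes "x \<in> preimage V"
  obtains \<gamma> where "\<gamma> \<in> paths p V" "pathfinish \<gamma> = x"
proof -
  obtain \<gamma> where "path \<gamma>" "path_image \<gamma> \<subseteq> M" "pathstart \<gamma> = p" "pathfinish \<gamma> = x"
    using M_path_connected p assms unfolding path_connected_def by blast
  moreover from this have "\<gamma> \<in> paths p V" using assms by (intro pathsI[OF p]) auto
  ultimately show ?thesis using that by blast
qed

text \<open>The value at a path is its monodromy relative to \<open>g0\<close> followed by a chosen
  path over \<open>W\<close>. Triviality of \<rho> over \<open>W\<close> removes the dependence on
  that choice, which is what invariance under prolongation amounts to.\<close>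

lemma good_generator:
  assumes W: "good W" "connected W" "W \<noteq> {}"
  obtains s where "s \<in> sections p W" "\<And>\<gamma>. \<gamma> \<in> paths p W \<Longrightarrow> s \<gamma> \<noteq> 0"
proof -
  have "W \<subseteq> S" using W(1) openin_imp_subset by (auto simp: good_def)
  then obtain x0 where x0: "x0 \<in> preimage W" using W(3) f(2) by blast
  obtain g0 where g0: "g0 \<in> paths p W" "pathfinish g0 = x0" by (rule paths_exist[OF x0])
  have "\<forall>x\<in>preimage W. \<exists>\<delta>. path \<delta> \<and> path_image \<delta> \<subseteq> preimage W \<and> pathstart \<delta> = x0 \<and> pathfinish \<delta> = x"
    using good_path[OF W(1,2) x0] by metis
  then obtain d where d: "\<And>x. x \<in> preimage W \<Longrightarrow> path (d x) \<and> path_image (d x) \<subseteq> preimage W \<and> pathstart (d x) = x0 \<and> pathfinish (d x) = x"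
    by metis
  define ch where "ch \<gamma> = path_chain \<gamma> - (path_chain g0 + path_chain (d (pathfinish \<gamma>)))" for \<gamma>
  define s where "s = (\<lambda>\<gamma>\<in>paths p W. ev (ch \<gamma>))"
  have fin: "pathfinish \<gamma> \<in> preimage W" if "\<gamma> \<in> paths p W" for \<gamma> using pathsD[OF p that] by auto
  have cyc: "is_cycle M (ch \<gamma>)" if "\<gamma> \<in> paths p W" for \<gamma>
    using pathsD[OF p that] pathsD[OF p g0(1)] d[OF fin[OF that]] g0(2)
    by (auto simp: ch_def is_cycle_iff chain_boundary_diff chain_boundary_add chain_boundary_path
        intro!: singular_chain_diff singular_chain_add singular_chain_path)
  have "s \<in> sections p W"
  proof (rule sectionsI[OF p])
    fix \<gamma> \<gamma>' assume g: "\<gamma> \<in> paths p W" "\<gamma>' \<in> paths p W" "pathfinish \<gamma> = pathfinish \<gamma>'"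
    have "ch \<gamma> = (path_chain \<gamma> - path_chain \<gamma>') + ch \<gamma>'" by (simp add: ch_def g(3))
    then have "ev (ch \<gamma>) = ev (path_chain \<gamma> - path_chain \<gamma>') * ev (ch \<gamma>')"
      using ev_add[OF paths_cycle[OF p g] cyc[OF g(2)]] by simp
    then show "s \<gamma> = ev (path_chain \<gamma> - path_chain \<gamma>') * s \<gamma>'" using g by (simp add: s_def)
  next
    fix \<gamma> \<delta> assume g: "\<gamma> \<in> paths p W" "\<gamma> +++ \<delta> \<in> paths p W" "path \<delta>" "path_image \<delta> \<subseteq> preimage W" "pathstart \<delta> = pathfinish \<gamma>"
    have fin': "pathfinish \<delta> \<in> preimage W" using fin[OF g(2)] by simp
    have "path_image \<delta> \<subseteq> M" using g(4) by auto
    then have k1: "path_chain \<gamma> + path_chain \<delta> - path_chain (\<gamma> +++ \<delta>) \<in> Ker"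
      using pathsD[OF p g(1)] g by (auto intro!: Ker_boundary path_chain_join)
    have "is_cycle (preimage W) (path_chain (d (pathfinish \<gamma>)) + path_chain \<delta> - path_chain (d (pathfinish \<delta>)))"
      using d[OF fin[OF g(1)]] d[OF fin'] g
      by (auto simp: is_cycle_iff chain_boundary_diff chain_boundary_add chain_boundary_path
          intro!: singular_chain_diff singular_chain_add singular_chain_path)
    then have k2: "path_chain (d (pathfinish \<gamma>)) + path_chain \<delta> - path_chain (d (pathfinish \<delta>)) \<in> Ker"
      using trivial_over_Ker W(1) by (auto simp: good_def)
    have "ch (\<gamma> +++ \<delta>) - ch \<gamma> \<in> Ker"
      using Ker_diff[OF k2 k1] by (simp add: ch_def algebra_simps)
    then have "ev (ch (\<gamma> +++ \<delta>)) = ev (ch \<gamma>)"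
      using ev_cong[OF cyc[OF g(2)], of "ch \<gamma>"] by simp
    then show "s (\<gamma> +++ \<delta>) = s \<gamma>" using g by (simp add: s_def)
  qed (simp add: s_def)
  moreover have "s \<gamma> \<noteq> 0" if "\<gamma> \<in> paths p W" for \<gamma> using ev_nonzero[OF cyc[OF that]] that by (simp add: s_def)
  ultimately show ?thesis using that by blast
qed

lemma open_component:
  assumes "openin (top_of_set S) V" "y \<in> V"
  obtains C where "openin (top_of_set S) C" "connected C" "y \<in> C" "C \<subseteq> V"
proof (rule that)
  show "openin (top_of_set S) (connected_component_set V y)" by (rule locally_disc_like_component[OF S(1) assms(1)])
  show "connected (connected_component_set V y)" by simp
  show "y \<in> connected_component_set V y" using assms(2) by simp
qed (rule connected_component_subset)

text \<open>Transport multiplies both sections by the same factor.\<close>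

lemma section_ratio:
  assumes s: "s \<in> sections p V" and s0: "s0 \<in> sections p V" and V: "openin (top_of_set S) V" "connected V"
    and nz: "\<And>\<gamma>. \<gamma> \<in> paths p V \<Longrightarrow> s0 \<gamma> \<noteq> 0" and g: "\<gamma> \<in> paths p V" "\<gamma>' \<in> paths p V"
  shows "s \<gamma> / s0 \<gamma> = s \<gamma>' / s0 \<gamma>'"
proof -
  have "pathfinish \<gamma>' \<in> preimage V" "pathfinish \<gamma> \<in> preimage V" using pathsD[OF p g(1)] pathsD[OF p g(2)] by auto
  then obtain \<delta> where d: "path \<delta>" "path_image \<delta> \<subseteq> preimage V" "pathstart \<delta> = pathfinish \<gamma>'" "pathfinish \<delta> = pathfinish \<gamma>"
    using preimage_connected(2)[OF V] unfolding path_connected_def by metis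
  let ?e = "ev (path_chain \<gamma> - (path_chain \<gamma>' + path_chain \<delta>))"
  have "s \<gamma> = ?e * s \<gamma>'" "s0 \<gamma> = ?e * s0 \<gamma>'"
    by (rule sections_transport[OF s g d], rule sections_transport[OF s0 g d])
  then show ?thesis using nz[OF g(1)] by simp
qed

text \<open>Sections over \<open>V \<subseteq> W\<close> are the locally constant multiples of a generator over \<open>W\<close>.\<close>

lemma image_sheaf_trivial:
  assumes W: "good W" "connected W"
  shows "sheaf_isomorphic (subtopology (top_of_set S) W) (image_sheaf p) (constant_sheaf (subtopology (top_of_set S) W) 1)"
proof -
  let ?X = "subtopology (top_of_set S) W"
  have Wo: "openin (top_of_set S) W" using W(1) by (simp add: good_def)
  have op: "openin ?X V \<longleftrightarrow> openin (top_of_set S) V \<and> V \<subseteq> W" for V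
    by (rule openin_open_subtopology[OF Wo])
  have WS: "W \<subseteq> S" using openin_imp_subset[OF Wo] .
  obtain s0 where s0: "s0 \<in> sections p W" "\<And>\<gamma>. \<gamma> \<in> paths p W \<Longrightarrow> s0 \<gamma> \<noteq> 0"
  proof (cases "W = {}")
    case True
    then have "paths p W = {}" by (auto simp: paths_into_def)
    moreover have "(\<lambda>\<gamma>. undefined) \<in> sections p W" using calculation by (intro sectionsI[OF p]) (auto simp: extensional_def)
    ultimately show ?thesis using that by blast
  qed (use good_generator[OF W] in blast)
  have "\<forall>y\<in>W. \<exists>\<gamma>. \<gamma> \<in> paths p W \<and> f (pathfinish \<gamma>) = y"
  proof
    fix y assume y: "y \<in> W"
    then obtain x where "x \<in> preimage W" "f x = y" using WS f(2) by blast
    then show "\<exists>\<gamma>. \<gamma> \<in> paths p W \<and> f (pathfinish \<gamma>) = y" using paths_exist[of x W] by metis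
  qed
  then obtain g where g: "\<And>y. y \<in> W \<Longrightarrow> g y \<in> paths p W \<and> f (pathfinish (g y)) = y" by metis
  have gV: "g y \<in> paths p V" if "y \<in> V" "V \<subseteq> W" for y V
    using g[of y] that paths_change[OF p, of "g y" W V] by auto
  \<comment> \<open>The quotient by the generator, read off at one path to each fibre; by
    \<open>ratio\<close> any other path would do, and the result is locally constant.\<close>
  define \<phi> where "\<phi> V s = (\<lambda>(y, j)\<in>V \<times> {..<(1::nat)}. s (g y) / s0 (g y))" for V s
  have res0: "restrict s0 (paths p V) \<in> sections p V" if "V \<subseteq> W" for V
    by (rule sections_restrict[OF p s0(1) that])
  have ratio: "s \<gamma> / s0 \<gamma> = s \<gamma>' / s0 \<gamma>'"
    if "s \<in> sections p V" "V \<subseteq> W" "openin (top_of_set S) C" "connected C" "C \<subseteq> V" "\<gamma> \<in> paths p C" "\<gamma>' \<in> paths p C" for s V C \<gamma> \<gamma>'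
  proof -
    have sub: "paths p C \<subseteq> paths p W" using paths_mono[OF p, of C W] that by auto
    have "C \<subseteq> W" using that by auto
    have "restrict s (paths p C) \<gamma> / restrict s0 (paths p C) \<gamma> = restrict s (paths p C) \<gamma>' / restrict s0 (paths p C) \<gamma>'"
      by (rule section_ratio[OF sections_restrict[OF p that(1,5)] res0[OF \<open>C \<subseteq> W\<close>] that(3,4) _ that(6,7)])
        (use s0(2) sub in auto)
    then show ?thesis using that(6,7) by simp
  qed
  let ?const = "\<lambda>V. {s \<in> extensional (V \<times> {..<(1::nat)}).
     \<forall>x\<in>V. \<exists>N. openin ?X N \<and> x \<in> N \<and> N \<subseteq> V \<and> (\<forall>y\<in>N. \<forall>j<1. s (y, j) = (s (x, j) :: complex))}"
  have sec_const: "sec (constant_sheaf ?X 1) V = function_module (V \<times> {..<1}) (?const V)" for V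
    by (simp add: constant_sheaf_def)
  have into: "\<phi> V s \<in> ?const V" if V: "openin ?X V" and s: "s \<in> sections p V" for V s
  proof (intro CollectI conjI ballI)
    show "\<phi> V s \<in> extensional (V \<times> {..<1})" by (simp add: \<phi>_def)
    fix x assume x: "x \<in> V"
    have VW: "openin (top_of_set S) V" "V \<subseteq> W" using V op by auto
    obtain C where C: "openin (top_of_set S) C" "connected C" "x \<in> C" "C \<subseteq> V" by (rule open_component[OF VW(1) x])
    have "\<phi> V s (y, j) = \<phi> V s (x, j)" if "y \<in> C" "j < 1" for y j
    proof -
      have "g y \<in> paths p C" "g x \<in> paths p C" using gV[of _ C] that C VW by auto
      from ratio[OF s VW(2) C(1,2,4) this] show ?thesis using that C x by (auto simp: \<phi>_def)
    qed
    moreover have "openin ?X C" using op C VW by auto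
    ultimately show "\<exists>N. openin ?X N \<and> x \<in> N \<and> N \<subseteq> V \<and> (\<forall>y\<in>N. \<forall>j<1. \<phi> V s (y, j) = \<phi> V s (x, j))"
      using C by blast
  qed
  have inj: "inj_on (\<phi> V) (sections p V)" if V: "openin ?X V" for V
  proof (rule inj_onI)
    fix s t assume st: "s \<in> sections p V" "t \<in> sections p V" "\<phi> V s = \<phi> V t"
    have VW: "openin (top_of_set S) V" "V \<subseteq> W" using V op by auto
    show "s = t"
    proof (rule extensionalityI[of _ "paths p V"])
      fix \<gamma> assume \<gamma>: "\<gamma> \<in> paths p V"
      let ?y = "f (pathfinish \<gamma>)"
      have y: "?y \<in> V" using pathsD(5)[OF p \<gamma>] .
      obtain C where C: "openin (top_of_set S) C" "connected C" "?y \<in> C" "C \<subseteq> V" by (rule open_component[OF VW(1) y])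
      have m: "\<gamma> \<in> paths p C" "g ?y \<in> paths p C" using paths_change[OF p \<gamma> C(3)] gV[of ?y C] C VW by auto
      have "\<phi> V s (?y, 0) = \<phi> V t (?y, 0)" using st(3) by simp
      then have "s (g ?y) / s0 (g ?y) = t (g ?y) / s0 (g ?y)" using y by (simp add: \<phi>_def)
      then have "s \<gamma> / s0 \<gamma> = t \<gamma> / s0 \<gamma>"
        using ratio[OF st(1) VW(2) C(1,2,4) m] ratio[OF st(2) VW(2) C(1,2,4) m] by simp
      moreover have "s0 \<gamma> \<noteq> 0" using s0(2) \<gamma> paths_mono[OF p VW(2)] by auto
      ultimately show "s \<gamma> = t \<gamma>" by simp
    qed (use sections_ext[OF p] st in auto)
  qed
  have surj: "\<exists>s\<in>sections p V. \<phi> V s = h" if V: "openin ?X V" and h: "h \<in> ?const V" for V h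
  proof
    have VW: "openin (top_of_set S) V" "V \<subseteq> W" using V op by auto
    note P = subsetD[OF paths_mono[OF p VW(2)]]
    define s where "s = (\<lambda>\<gamma>\<in>paths p V. h (f (pathfinish \<gamma>), 0) * s0 \<gamma>)"
    show "s \<in> sections p V"
    proof (rule sectionsI[OF p])
      fix \<gamma> \<gamma>' assume gg: "\<gamma> \<in> paths p V" "\<gamma>' \<in> paths p V" "pathfinish \<gamma> = pathfinish \<gamma>'"
      have "s0 \<gamma> = ev (path_chain \<gamma> - path_chain \<gamma>') * s0 \<gamma>'"
        by (rule sections_eq[OF p s0(1) P[OF gg(1)] P[OF gg(2)] gg(3)])
      then show "s \<gamma> = ev (path_chain \<gamma> - path_chain \<gamma>') * s \<gamma>'" using gg by (simp add: s_def)
    next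
      fix \<gamma> \<delta> assume gg: "\<gamma> \<in> paths p V" "\<gamma> +++ \<delta> \<in> paths p V" "path \<delta>" "path_image \<delta> \<subseteq> preimage V" "pathstart \<delta> = pathfinish \<gamma>"
      have "path_image \<delta> \<subseteq> preimage W" using gg(4) VW(2) by auto
      then have "s0 (\<gamma> +++ \<delta>) = s0 \<gamma>" by (rule sections_prolong[OF p s0(1) P[OF gg(1)] gg(3) _ gg(5)])
      \<comment> \<open>\<open>V\<close> may be disconnected, but \<open>h\<close> is constant along
        the image of \<delta>, which is connected.\<close>
      moreover have "h (f (pathfinish \<delta>), 0) = h (f (pathfinish \<gamma>), 0)"
      proof (rule connected_induction_simple[of "f ` path_image \<delta>" "f (pathfinish \<gamma>)" "f (pathfinish \<delta>)"
            "\<lambda>y. h (y, 0) = h (f (pathfinish \<gamma>), 0)"])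
        show "connected (f ` path_image \<delta>)"
          by (intro connected_continuous_image connected_path_image gg(3) continuous_on_subset[OF f(1)]) (use gg(4) in auto)
        show "f (pathfinish \<gamma>) \<in> f ` path_image \<delta>" unfolding gg(5)[symmetric] by (rule imageI) (rule pathstart_in_path_image)
        fix a assume a: "a \<in> f ` path_image \<delta>"
        then have "a \<in> V" using gg(4) by auto
        then obtain N where N: "openin ?X N" "a \<in> N" "N \<subseteq> V" "\<forall>y\<in>N. \<forall>j<1. h (y, j) = h (a, j)" using h by blast
        have "openin (top_of_set (f ` path_image \<delta>)) (f ` path_image \<delta> \<inter> N)"
        proof -
          obtain Y where Y: "open Y" "N = S \<inter> Y" using N(1) op by (auto simp: openin_open)
          have "f ` path_image \<delta> \<subseteq> S" using gg(4) f(2) by auto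
          then have "f ` path_image \<delta> \<inter> N = f ` path_image \<delta> \<inter> Y" using Y by auto
          then show ?thesis using Y(1) by (simp add: openin_open_Int)
        qed
        then show "\<exists>T. openin (top_of_set (f ` path_image \<delta>)) T \<and> a \<in> T \<and>
          (\<forall>x\<in>T. \<forall>y\<in>T. h (x, 0) = h (f (pathfinish \<gamma>), 0) \<longrightarrow> h (y, 0) = h (f (pathfinish \<gamma>), 0))"
        proof (intro exI[of _ "f ` path_image \<delta> \<inter> N"] conjI ballI impI)
          fix x y assume "x \<in> f ` path_image \<delta> \<inter> N" "y \<in> f ` path_image \<delta> \<inter> N"
          then have "h (x, 0) = h (a, 0)" "h (y, 0) = h (a, 0)" using N(4) zero_less_one by blast+
          then show "h (x, 0) = h (f (pathfinish \<gamma>), 0) \<Longrightarrow> h (y, 0) = h (f (pathfinish \<gamma>), 0)" by simp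
        qed (use a N(2) in auto)
      qed auto
      ultimately show "s (\<gamma> +++ \<delta>) = s \<gamma>" using gg by (simp add: s_def)
    qed (simp add: s_def)
    show "\<phi> V s = h"
    proof (rule extensionalityI[of _ "V \<times> {..<1}"])
      fix yj :: "'b \<times> nat" assume "yj \<in> V \<times> {..<1}"
      then obtain y where y: "yj = (y, 0)" "y \<in> V" by auto
      have "g y \<in> paths p V" "f (pathfinish (g y)) = y" "s0 (g y) \<noteq> 0" using gV[OF y(2) VW(2)] g[of y] s0(2) y VW by auto
      then show "\<phi> V s yj = h yj" using y by (simp add: \<phi>_def s_def)
    qed (use h in \<open>auto simp: \<phi>_def\<close>)
  qed
  have lin: "linear_between (sec (image_sheaf p) V) (sec (constant_sheaf ?X 1) V) (\<phi> V)" if V: "openin ?X V" for V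
    unfolding linear_between_def sec_image_sheaf[OF p] sec_const function_module_simps
  proof (intro conjI ballI allI)
    show "\<phi> V \<in> sections p V \<rightarrow> ?const V" using into[OF V] by blast
    have VW: "V \<subseteq> W" using V op by auto
    fix s t :: "(real \<Rightarrow> 'a) \<Rightarrow> complex" and c
    show "\<phi> V (\<lambda>i\<in>paths p V. s i + t i) = (\<lambda>i\<in>V \<times> {..<1}. \<phi> V s i + \<phi> V t i)"
      "\<phi> V (\<lambda>i\<in>paths p V. c * s i) = (\<lambda>i\<in>V \<times> {..<1}. c * \<phi> V s i)"
      using gV[OF _ VW] by (auto simp: \<phi>_def fun_eq_iff restrict_def add_divide_distrib)
  qed
  show ?thesis
    unfolding sheaf_isomorphic_def
  proof (intro exI[of _ \<phi>] conjI allI impI ballI)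
    fix V assume V: "openin ?X V"
    show "linear_between (sec (image_sheaf p) V) (sec (constant_sheaf ?X 1) V) (\<phi> V)" by (rule lin[OF V])
    show "bij_betw (\<phi> V) (carrier (sec (image_sheaf p) V)) (carrier (sec (constant_sheaf ?X 1) V))"
      unfolding sec_image_sheaf[OF p] sec_const function_module_simps bij_betw_def
    proof
      show "\<phi> V ` sections p V = ?const V"
      proof (intro subset_antisym subsetI)
        fix h assume "h \<in> ?const V"
        from surj[OF V this] show "h \<in> \<phi> V ` sections p V" by blast
      qed (use into[OF V] in blast)
    qed (rule inj[OF V])
  next
    fix V N s assume VN: "openin ?X V \<and> openin ?X N \<and> N \<subseteq> V"
    have N: "N \<subseteq> W" "N \<subseteq> V" using VN op by auto
    have "res (constant_sheaf ?X 1) V N (\<phi> V s) = restrict (\<phi> V s) (N \<times> {..<1})" by (simp add: constant_sheaf_def)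
    also have "\<dots> = \<phi> N (restrict s (paths p N))"
      using gV[OF _ N(1)] N(2) by (auto simp: \<phi>_def fun_eq_iff restrict_def)
    finally show "\<phi> N (res (image_sheaf p) V N s) = res (constant_sheaf ?X 1) V N (\<phi> V s)"
      by (simp add: res_image_sheaf[OF p])
  qed
qed

section \<open>Finite sets outside which the direct image is a local system\<close>

definition regular_outside :: "'b set \<Rightarrow> bool" where
  "regular_outside A \<longleftrightarrow> finite A \<and> A \<subseteq> S \<and> local_system (subtopology (top_of_set S) (S - A)) (image_sheaf p)"

lemma openin_diff: "finite A \<Longrightarrow> openin (subtopology (top_of_set S) (S - A)) V \<longleftrightarrow> openin (top_of_set S) V \<and> V \<subseteq> S - A"
  by (rule openin_open_subtopology[OF openin_diff_finite]) auto

lemma sheaf_outside: "finite A \<Longrightarrow> sheaf (subtopology (top_of_set S) (S - A)) (image_sheaf p)"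
  by (rule sheaf_image_sheaf[OF p]) (simp add: openin_diff)

lemma subtopology_diff:
  assumes "W \<subseteq> S - A"
  shows "subtopology (subtopology (top_of_set S) (S - A)) W = subtopology (top_of_set S) W"
proof -
  have "S \<inter> (S - A) \<inter> W = S \<inter> W" using assms by auto
  then show ?thesis by (simp only: subtopology_subtopology)
qed

lemma good_regular:
  assumes "finite A" "A \<subseteq> S" and cover: "\<And>y. y \<in> S - A \<Longrightarrow> \<exists>W. good W \<and> y \<in> W"
  shows "regular_outside A"
  unfolding regular_outside_def local_system_def
proof (intro conjI ballI assms sheaf_outside)
  fix y assume "y \<in> topspace (subtopology (top_of_set S) (S - A))"
  then have y: "y \<in> S - A" by simp
  then obtain W0 where W0: "good W0" "y \<in> W0" using cover by blast
  have "openin (top_of_set S) (W0 - A)" using W0(1) openin_diff_finite[OF _ assms(1)] by (auto simp: good_def)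
  then have "good (W0 - A)" using good_subset[OF W0(1)] by auto
  then obtain W where W: "good W" "connected W" "y \<in> W" "W \<subseteq> W0 - A"
    using good_connected_neighborhood[of "{y}" "W0 - A"] W0(2) y by auto
  have WS: "W \<subseteq> S - A" "openin (top_of_set S) W"
    using W(1,4) W0(1)[unfolded good_def, THEN conjunct1, THEN openin_imp_subset] by (auto simp: good_def)
  from subtopology_diff[OF WS(1)] show "\<exists>W r. openin (subtopology (top_of_set S) (S - A)) W \<and> y \<in> W \<and>
     sheaf_isomorphic (subtopology (subtopology (top_of_set S) (S - A)) W) (image_sheaf p)
       (constant_sheaf (subtopology (subtopology (top_of_set S) (S - A)) W) r)"
    using image_sheaf_trivial[OF W(1,2)] W(3) WS openin_diff[OF assms(1)] by (intro exI[of _ W] exI[of _ 1]) auto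
qed

text \<open>Local triviality is a condition at each point, and a point outside the intersection lies
  outside one of the two sets, where a trivializing neighbourhood is available.\<close>

lemma regular_outside_Int:
  assumes "regular_outside A" "regular_outside B" shows "regular_outside (A \<inter> B)"
  unfolding regular_outside_def local_system_def
proof (intro conjI ballI)
  show fin: "finite (A \<inter> B)" "A \<inter> B \<subseteq> S" using assms by (auto simp: regular_outside_def)
  show "sheaf (subtopology (top_of_set S) (S - A \<inter> B)) (image_sheaf p)" by (rule sheaf_outside[OF fin(1)])
  fix y assume "y \<in> topspace (subtopology (top_of_set S) (S - A \<inter> B))"
  then obtain D where D: "D = A \<or> D = B" "y \<in> S - D" by auto
  then have regD: "regular_outside D" using assms by auto
  then have "finite D" by (simp add: regular_outside_def)
  let ?X = "subtopology (top_of_set S) (S - D)" and ?Y = "subtopology (top_of_set S) (S - A \<inter> B)"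
  obtain W r where W: "openin ?X W" "y \<in> W" "sheaf_isomorphic (subtopology ?X W) (image_sheaf p) (constant_sheaf (subtopology ?X W) r)"
  proof -
    have "\<forall>y\<in>topspace ?X. \<exists>W r. openin ?X W \<and> y \<in> W \<and>
        sheaf_isomorphic (subtopology ?X W) (image_sheaf p) (constant_sheaf (subtopology ?X W) r)"
      using regD unfolding regular_outside_def local_system_def by blast
    moreover have "y \<in> topspace ?X" using D(2) by simp
    ultimately show ?thesis using that by blast
  qed
  have WS: "openin (top_of_set S) W" "W \<subseteq> S - D" using W(1) openin_diff[OF \<open>finite D\<close>] by auto
  then have "W \<subseteq> S - A \<inter> B" using D(1) by auto
  then have "openin ?Y W" "subtopology ?Y W = subtopology (top_of_set S) W" "subtopology ?X W = subtopology (top_of_set S) W"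
    using openin_diff[OF fin(1)] WS(1) subtopology_diff[OF WS(2)] subtopology_diff[of W "A \<inter> B"] by blast+
  then show "\<exists>W r. openin ?Y W \<and> y \<in> W \<and> sheaf_isomorphic (subtopology ?Y W) (image_sheaf p) (constant_sheaf (subtopology ?Y W) r)"
    using W(2,3) by metis
qed

text \<open>\<open>singular_support\<close> is an unspecified set unless a least admissible set exists.\<close>

lemma singular_support_empty_iff:
  "singular_support (top_of_set S) (image_sheaf p) = {} \<longleftrightarrow> regular_outside {}"
proof -
  have eq: "singular_support (top_of_set S) (image_sheaf p) = (LEAST A. regular_outside A)"
    by (simp add: singular_support_def regular_outside_def)
  have "regular_outside (S - U)"
    using good_near_U[of _ S] U by (intro good_regular) (auto, metis Diff_iff openin_topspace topspace_euclidean_subtopology)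
  then have "\<exists>A. regular_outside A" by blast
  \<comment> \<open>An admissible set of minimal cardinality is the least one, as intersecting it
    with another admissible set cannot make it smaller.\<close>
  then obtain A where A: "regular_outside A" "\<And>B. regular_outside B \<Longrightarrow> card A \<le> card B"
    using ex_has_least_nat[of regular_outside _ card] by metis
  have least: "A \<subseteq> B" if "regular_outside B" for B
  proof -
    have "card A \<le> card (A \<inter> B)" using A regular_outside_Int that by blast
    then have "A \<inter> B = A" using A(1) by (intro card_seteq) (auto simp: regular_outside_def)
    then show ?thesis by blast
  qed
  have "(LEAST A. regular_outside A) = A" by (rule Least_equality) (use A(1) least in auto)
  then show ?thesis using eq A(1) least by auto
qed

text \<open>First the rank is seen to be positive: some point of \<open>U\<close> lies in the
  trivializing set, and near it there is a nowhere vanishing section. Then the section over a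
  connected neighbourhood of \<open>y\<close> that corresponds to the constant 1 is nonzero at some
  path, hence at all of them. Appending a loop multiplies it by the monodromy, which must therefore
  be 1.\<close>

theorem regular_imp_good:
  assumes reg: "regular_outside {}" and y: "y \<in> S"
  shows "\<exists>W. good W \<and> y \<in> W"
proof -
  let ?X = "\<lambda>W. subtopology (top_of_set S) W"
  have "local_system (top_of_set S) (image_sheaf p)"
    using reg by (simp add: regular_outside_def subtopology_subtopology)
  then obtain W r where W: "openin (top_of_set S) W" "y \<in> W"
    "sheaf_isomorphic (?X W) (image_sheaf p) (constant_sheaf (?X W) r)"
    using y unfolding local_system_def by auto
  obtain \<phi> where \<phi>: "\<And>V. openin (?X W) V \<Longrightarrow> linear_between (sec (image_sheaf p) V) (sec (constant_sheaf (?X W) r) V) (\<phi> V)"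
    "\<And>V. openin (?X W) V \<Longrightarrow> bij_betw (\<phi> V) (carrier (sec (image_sheaf p) V)) (carrier (sec (constant_sheaf (?X W) r) V))"
    using W(3) unfolding sheaf_isomorphic_def by blast
  let ?const = "\<lambda>V. {s \<in> extensional (V \<times> {..<r}).
     \<forall>x\<in>V. \<exists>N. openin (?X W) N \<and> x \<in> N \<and> N \<subseteq> V \<and> (\<forall>y\<in>N. \<forall>j<r. s (y, j) = (s (x, j) :: complex))}"
  have sec_const: "sec (constant_sheaf (?X W) r) V = function_module (V \<times> {..<r}) (?const V)" for V
    by (simp add: constant_sheaf_def)
  have op: "openin (?X W) V \<longleftrightarrow> openin (top_of_set S) V \<and> V \<subseteq> W" for V
    by (rule openin_open_subtopology[OF W(1)])
  have bij: "bij_betw (\<phi> V) (sections p V) (?const V)" if "openin (?X W) V" for V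
    using \<phi>(2)[OF that] by (simp add: sec_image_sheaf[OF p] sec_const)
  have hom: "\<phi> V (\<lambda>i\<in>paths p V. c * s i) = (\<lambda>i\<in>V \<times> {..<r}. c * \<phi> V s i)" if "openin (?X W) V" "s \<in> sections p V" for V s c
    using \<phi>(1)[OF that(1)] that(2) unfolding linear_between_def by (simp add: sec_image_sheaf[OF p] sec_const)
  \<comment> \<open>Otherwise the preimage of \<open>W\<close> would be a nonempty open set inside
    finitely many fibres.\<close>
  have WU: "W \<inter> U \<noteq> {}"
  proof
    assume "W \<inter> U = {}"
    then have "preimage W \<subseteq> f -` (S - U)" using f(2) openin_imp_subset[OF W(1)] by auto
    then have "preimage W = {}" using preimage_finite_no_interior[OF U(2) preimage_open[OF W(1)]] by blast
    then show False using W(2) y f(2) by auto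
  qed
  then obtain u where u: "u \<in> W" "u \<in> U" by blast
  obtain D where D: "good D" "u \<in> D" "D \<subseteq> W \<inter> U" "connected D" by (rule good_near_U[OF u(2) W(1) u(1)])
  have oD: "openin (?X W) D" using op D by (auto simp: good_def)
  obtain s0 where s0: "s0 \<in> sections p D" "\<And>\<gamma>. \<gamma> \<in> paths p D \<Longrightarrow> s0 \<gamma> \<noteq> 0"
    using good_generator[OF D(1,4)] D(2) by blast
  have r: "r > 0"
  proof (rule ccontr)
    assume "\<not> r > 0"
    then have "\<phi> D s0 = \<phi> D (\<lambda>i\<in>paths p D. 0 * s0 i)"
      using bij_betwE[OF bij[OF oD]] s0(1) hom[OF oD s0(1), of 0] by (auto simp: extensional_def fun_eq_iff)
    then have "s0 = (\<lambda>i\<in>paths p D. 0 * s0 i)"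
      using bij[OF oD] s0(1) sections_smult[OF p s0(1), of 0] by (auto simp: bij_betw_def dest: inj_onD)
    moreover obtain \<gamma> where "\<gamma> \<in> paths p D"
    proof -
      have "u \<in> S" using D(1,2) openin_imp_subset by (auto simp: good_def)
      then obtain x where "x \<in> preimage D" using D(2) f(2) by blast
      then show ?thesis using paths_exist that by metis
    qed
    ultimately show False using s0(2) by (metis mult_zero_left restrict_apply')
  qed
  obtain C where C: "openin (top_of_set S) C" "connected C" "y \<in> C" "C \<subseteq> W" by (rule open_component[OF W(1,2)])
  have oC: "openin (?X W) C" using op C by auto
  have "(\<lambda>i\<in>C \<times> {..<r}. 1) \<in> ?const C" using oC by auto
  then obtain s where s: "s \<in> sections p C" "\<phi> C s = (\<lambda>i\<in>C \<times> {..<r}. 1)"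
    using bij[OF oC] unfolding bij_betw_def by (metis (no_types, lifting) imageE)
  have "\<exists>\<gamma>\<in>paths p C. s \<gamma> \<noteq> 0"
  proof (rule ccontr)
    assume "\<not> ?thesis"
    then have "s = (\<lambda>i\<in>paths p C. 0 * s i)"
      using sections_ext[OF p s(1)] by (auto simp: extensional_def fun_eq_iff)
    then have "\<phi> C s = (\<lambda>i\<in>C \<times> {..<r}. 0 * \<phi> C s i)" using hom[OF oC s(1), of 0] by simp
    then have "\<phi> C s (y, 0) = 0" using C(3) r by (metis (no_types, lifting) SigmaI lessThan_iff mult_zero_left restrict_apply')
    then show False using s(2) C(3) r by simp
  qed
  then obtain g1 where g1: "g1 \<in> paths p C" "s g1 \<noteq> 0" by blast
  have "trivial_over (preimage C)"
  proof (rule trivial_over_loops[OF preimage_connected(2)[OF C(1,2)]])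
    fix \<gamma> assume \<gamma>: "path \<gamma>" "path_image \<gamma> \<subseteq> preimage C" "pathstart \<gamma> = pathfinish \<gamma>"
    have "pathfinish g1 \<in> preimage C" using pathsD[OF p g1(1)] by auto
    moreover have "pathstart \<gamma> \<in> preimage C" using \<gamma>(2) pathstart_in_path_image by blast
    ultimately obtain \<epsilon> where \<epsilon>: "path \<epsilon>" "path_image \<epsilon> \<subseteq> preimage C" "pathstart \<epsilon> = pathfinish g1" "pathfinish \<epsilon> = pathstart \<gamma>"
      using preimage_connected(2)[OF C(1,2)] unfolding path_connected_def by metis
    let ?g = "g1 +++ \<epsilon>"
    have g: "?g \<in> paths p C" by (rule paths_prolong[OF p g1(1) \<epsilon>(1-3)])
    have sg: "s ?g \<noteq> 0" using sections_prolong[OF p s(1) g1(1) \<epsilon>(1-3)] g1(2) by simp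
    have e: "s ?g = ev (path_chain ?g - (path_chain ?g + path_chain \<gamma>)) * s ?g"
      by (rule sections_transport[OF s(1) g g \<gamma>(1,2)]) (use \<epsilon> \<gamma> in auto)
    have cyc: "is_cycle M (path_chain \<gamma>)"
      using \<gamma> by (auto simp: is_cycle_iff chain_boundary_path intro!: singular_chain_path)
    have "ev (- path_chain \<gamma>) = 1" using e sg by simp
    then have "- path_chain \<gamma> \<in> Ker" using singular_relcycle_minus[of 1 "top_of_set M" "{}" "path_chain \<gamma>"] cyc by (simp add: Ker_def)
    from Ker_diff[OF Ker_zero this] show "ev (path_chain \<gamma>) = 1" by (simp add: Ker_def)
  qed auto
  then show ?thesis using C by (auto simp: good_def)
qed

theorem singular_support_empty_iff_kernel:
  "singular_support (top_of_set S) (image_sheaf p) = {} \<longleftrightarrow> (\<forall>z\<in>H1_kernel M S f. \<rho> z = 1)"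
proof -
  have cont: "continuous_map (top_of_set M) (top_of_set S) f" using f by auto
  have induced: "H1_map M S f (homologous_rel_set 1 (top_of_set M) {} c) = homologous_rel_set 1 (top_of_set S) {} (chain_map 1 f c)"
    if "is_cycle M c" for c
    using hom_induced_chain_map[OF cont _ that, of "{}"] by simp
  have kernel: "homologous_rel_set 1 (top_of_set M) {} c \<in> H1_kernel M S f \<longleftrightarrow> singular_relboundary 1 (top_of_set S) {} (chain_map 1 f c)"
    if "is_cycle M c" for c
    using class_carrier[OF that] induced[OF that] one_relative_homology_group[of 1 "top_of_set S" "{}"]
    by (simp add: H1_kernel_def kernel_def homologous_rel_set_eq_relboundary)
  have cycle: "\<exists>c. is_cycle M c \<and> z = homologous_rel_set 1 (top_of_set M) {} c" if "z \<in> H1_kernel M S f" for z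
    using that carrier_relative_homology_group[of 1 "top_of_set M" "{}"] by (auto simp: H1_kernel_def kernel_def)
  show ?thesis
    unfolding singular_support_empty_iff
  proof
    assume reg: "regular_outside {}"
    show "\<forall>z\<in>H1_kernel M S f. \<rho> z = 1"
    proof
      fix z assume z: "z \<in> H1_kernel M S f"
      then obtain c where c: "is_cycle M c" "z = homologous_rel_set 1 (top_of_set M) {} c" using cycle by blast
      have "ev c = 1"
        by (rule good_cover_trivial_on_kernel[OF regular_imp_good[OF reg] c(1)]) (use kernel c z in auto)
      then show "\<rho> z = 1" by (simp add: cycle_value_def c(2))
    qed
  next
    assume k: "\<forall>z\<in>H1_kernel M S f. \<rho> z = 1"
    show "regular_outside {}"
    proof (rule good_regular)
      fix y assume "y \<in> S - {}"
      then obtain D where D: "openin (top_of_set S) D" "y \<in> D" "disc_like D"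
        using locally_disc_likeE[OF S(1), of S y] by auto
      have "trivial_over (preimage D)"
        unfolding trivial_over_def
      proof (intro conjI allI impI)
        fix c assume c: "is_cycle (preimage D) c"
        have cM: "is_cycle M c" using cycle_mono[OF c] by auto
        have "continuous_map (top_of_set (preimage D)) (top_of_set D) f"
          using f(1) by (auto intro: continuous_on_subset)
        then have "singular_relcycle 1 (top_of_set D) {} (chain_map 1 f c)"
          by (rule singular_relcycle_chain_map[OF c]) auto
        then have "singular_relboundary 1 (top_of_set D) {} (chain_map 1 f c)"
          using D(3) contractible_cycle_boundary[of "top_of_set D"] by (simp only: disc_like_def)
        then have "singular_relboundary 1 (top_of_set S) {} (chain_map 1 f c)"
          using singular_boundary_mono[OF openin_imp_subset[OF D(1)]] by blast
        then show "ev c = 1" using k kernel[OF cM] by (simp add: cycle_value_def)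
      qed auto
      then show "\<exists>W. good W \<and> y \<in> W" using D by (auto simp: good_def)
    qed auto
  qed
qed

end

end

section \<open>Extension of characters\<close>

text \<open>A character of a subgroup, encoded as its graph: extension becomes inclusion, and the
  union of a chain is an upper bound for Zorn's lemma. The uniqueness of the value at \<one> makes
  the relation a function.\<close>

locale partial_character = comm_group G for G (structure) +
  fixes g :: "('a \<times> complex) set"
  assumes dom: "(x, a) \<in> g \<Longrightarrow> x \<in> carrier G"
    and nonzero: "(x, a) \<in> g \<Longrightarrow> a \<noteq> 0"
    and mult_mem: "(x, a) \<in> g \<Longrightarrow> (y, c) \<in> g \<Longrightarrow> (x \<otimes> y, a * c) \<in> g"
    and inv_mem: "(x, a) \<in> g \<Longrightarrow> (inv x, inverse a) \<in> g"
    and one_mem: "(\<one>, 1) \<in> g"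
    and one_unique: "(\<one>, a) \<in> g \<Longrightarrow> a = 1"
begin

lemma unique: "(x, a) \<in> g \<Longrightarrow> (x, c) \<in> g \<Longrightarrow> a = c"
proof -
  assume ac: "(x, a) \<in> g" "(x, c) \<in> g"
  then have "(\<one>, a * inverse c) \<in> g" using mult_mem[OF ac(1) inv_mem[OF ac(2)]] dom by simp
  then have "a * inverse c = 1" by (rule one_unique)
  then show "a = c" using nonzero[OF ac(2)] by (simp add: field_simps)
qed

lemma pow_mem: "(x, a) \<in> g \<Longrightarrow> (x [^] (k::int), a powi k) \<in> g"
proof -
  assume xa: "(x, a) \<in> g"
  then have x: "x \<in> carrier G" by (rule dom)
  have nat: "(x [^] (n::nat), a ^ n) \<in> g" for n
    by (induction n) (use one_mem mult_mem[OF _ xa] in \<open>auto simp: power_Suc2 simp del: power_Suc\<close>)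
  show ?thesis
  proof (cases k)
    case (nonneg n)
    then show ?thesis using nat[of n] by (simp add: int_pow_int)
  next
    case (neg n)
    then have "k = - int (Suc n)" by simp
    then show ?thesis using inv_mem[OF nat[of "Suc n"]]
      by (simp only: int_pow_neg_int[OF x] power_int_minus power_int_of_nat)
  qed
qed

text \<open>Here the divisibility of the multiplicative group of \<open>\<complex>\<close> is used.\<close>

lemma extension_value:
  assumes x: "x \<in> carrier G"
  obtains c where "c \<noteq> 0" "\<And>(k::int) v. (x [^] k, v) \<in> g \<Longrightarrow> v = c powi k"
proof (cases "\<exists>n::nat. n > 0 \<and> (\<exists>v. (x [^] n, v) \<in> g)")
  case False
  then have none: "(x [^] n, v) \<notin> g" if "n > 0" for n :: nat and v using that by blast
  have "k = 0" if kv: "(x [^] k, v) \<in> g" for k :: int and v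
  proof (cases k)
    case (nonneg n)
    then show ?thesis using none[of n v] kv by (cases n) (simp_all add: int_pow_int del: of_nat_Suc)
  next
    case (neg n)
    then have "k = - int (Suc n)" by simp
    then have "(x [^] Suc n, inverse v) \<in> g"
      using inv_mem[OF kv] x by (simp only: int_pow_neg_int inv_inv nat_pow_closed)
    then show ?thesis using none[of "Suc n"] by simp
  qed
  \<comment> \<open>No nonzero power of \<open>x\<close> is in the domain, so the value at
    \<open>x\<close> is free; 1 is chosen.\<close>
  then have "v = 1 powi k" if "(x [^] k, v) \<in> g" for k :: int and v
    using that one_unique x by fastforce
  then show ?thesis using that[of 1] by simp
next
  case True
  define n where "n = (LEAST n::nat. n > 0 \<and> (\<exists>v. (x [^] n, v) \<in> g))"
  have n: "n > 0" "\<exists>v. (x [^] n, v) \<in> g" using LeastI_ex[OF True] by (auto simp: n_def)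
  have least: "n \<le> m" if "m > 0" "(x [^] m, v) \<in> g" for m v
    unfolding n_def by (rule Least_le) (use that in auto)
  obtain w where w: "(x [^] n, w) \<in> g" using n(2) by blast
  have w': "(x [^] (int n), w) \<in> g" using w by (simp add: int_pow_int)
  \<comment> \<open>An \<open>n\<close>-th root of the prescribed value at \<open>x [^] n\<close>.
    By the minimality of \<open>n\<close>, the exponents that occur in the domain are multiples of
    it.\<close>
  define c where "c = exp (Ln w / of_nat n)"
  have c: "c ^ n = w" using n(1) nonzero[OF w] by (simp add: c_def exp_of_nat_mult[symmetric])
  have "v = c powi k" if kv: "(x [^] k, v) \<in> g" for k :: int and v
  proof -
    define q r where "q = k div int n" and "r = k mod int n"
    have k: "k = int n * q + r" "0 \<le> r" "r < int n" using n(1) by (simp_all add: q_def r_def)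
    have nq: "(x [^] (int n * q), w powi q) \<in> g"
      using pow_mem[OF w', of q] x by (simp add: int_pow_pow)
    have "(x [^] k \<otimes> inv (x [^] (int n * q)), v * inverse (w powi q)) \<in> g"
      by (rule mult_mem[OF kv inv_mem[OF nq]])
    moreover have "x [^] k \<otimes> inv (x [^] (int n * q)) = x [^] r"
      using x k(1) by (simp add: int_pow_neg[symmetric] int_pow_mult[symmetric])
    moreover have "x [^] r = x [^] nat r" using k(2) by (metis int_pow_int nat_0_le)
    ultimately have "(x [^] nat r, v * inverse (w powi q)) \<in> g" by (simp only:)
    then have "nat r = 0" using least[of "nat r"] k(3) by fastforce
    then have "k = int n * q" using k by simp
    moreover have "w powi q = c powi (int n * q)" using c by (simp add: power_int_mult)
    ultimately show ?thesis using unique[OF kv] nq by simp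
  qed
  then show ?thesis using that[of c] by (simp add: c_def)
qed

text \<open>Consistency has to be checked at \<one> only: if a product of \<open>y\<close> with a
  power of \<open>x\<close> is \<one>, then that power is the inverse of \<open>y\<close>, hence in
  the domain, and \<open>c\<close> was chosen to agree there.\<close>

lemma extend:
  assumes x: "x \<in> carrier G"
  obtains g' where "partial_character G g'" "g \<subseteq> g'" "\<exists>c. (x, c) \<in> g'"
proof -
  obtain c where c: "c \<noteq> 0" "\<And>(k::int) v. (x [^] k, v) \<in> g \<Longrightarrow> v = c powi k"
    using extension_value[OF x] by blast
  define g' where "g' = {(y \<otimes> x [^] k, a * c powi k) |y a (k::int). (y, a) \<in> g}"
  have g'I: "(y \<otimes> x [^] k, a * c powi k) \<in> g'" if "(y, a) \<in> g" for y a and k :: int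
    using that by (auto simp: g'_def)
  have "partial_character G g'"
  proof (unfold_locales)
    fix z e assume "(z, e) \<in> g'"
    then obtain y a k where y: "(y, a) \<in> g" "z = y \<otimes> x [^] (k::int)" "e = a * c powi k" by (auto simp: g'_def)
    show "z \<in> carrier G" "e \<noteq> 0" using y dom nonzero[OF y(1)] x c(1) by auto
    have "(inv y \<otimes> x [^] (- k), inverse a * c powi (- k)) \<in> g'" by (rule g'I[OF inv_mem[OF y(1)]])
    then show "(inv z, inverse e) \<in> g'"
      using y dom[OF y(1)] x by (simp add: inv_mult int_pow_neg power_int_minus)
    fix z' e' assume "(z', e') \<in> g'"
    then obtain y' a' k' where y': "(y', a') \<in> g" "z' = y' \<otimes> x [^] (k'::int)" "e' = a' * c powi k'" by (auto simp: g'_def)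
    have "((y \<otimes> y') \<otimes> x [^] (k + k'), (a * a') * c powi (k + k')) \<in> g'" by (rule g'I[OF mult_mem[OF y(1) y'(1)]])
    moreover have "(y \<otimes> y') \<otimes> x [^] (k + k') = z \<otimes> z'"
      using y y' dom[OF y(1)] dom[OF y'(1)] x by (simp add: int_pow_mult m_ac)
    moreover have "(a * a') * c powi (k + k') = e * e'"
      using y y' c(1) by (simp add: power_int_add)
    ultimately show "(z \<otimes> z', e * e') \<in> g'" by simp
  next
    show "(\<one>, 1) \<in> g'" using g'I[OF one_mem, of 0] by simp
    fix e assume "(\<one>, e) \<in> g'"
    then obtain y a k where y: "(y, a) \<in> g" "\<one> = y \<otimes> x [^] (k::int)" "e = a * c powi k" by (auto simp: g'_def)
    have "x [^] k = inv y" using y dom[OF y(1)] x by (metis inv_equality int_pow_closed inv_inv m_comm)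
    then have "inverse a = c powi k" using c(2)[of k "inverse a"] inv_mem[OF y(1)] by simp
    then show "e = 1" using y nonzero[OF y(1)] by (metis right_inverse)
  qed
  moreover have "g \<subseteq> g'" using g'I[of _ _ 0] dom by fastforce
  moreover have "(x, c) \<in> g'" using g'I[OF one_mem, of 1] x by (simp add: int_pow_1)
  ultimately show ?thesis using that by blast
qed

end

text \<open>Zorn's lemma on graphs: a maximal one is defined everywhere, since \<open>extend\<close>
  reaches any given element.\<close>

theorem (in comm_group) character_extension:
  assumes H: "subgroup H G" and \<sigma>: "\<sigma> \<in> hom (G\<lparr>carrier := H\<rparr>) complex_units"
  obtains \<rho> where "\<rho> \<in> hom G complex_units" "\<And>h. h \<in> H \<Longrightarrow> \<rho> h = \<sigma> h"
proof -
  have \<sigma>_mult: "\<sigma> (x \<otimes> y) = \<sigma> x * \<sigma> y" "\<sigma> x \<noteq> 0" if "x \<in> H" "y \<in> H" for x y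
    using \<sigma> that by (auto simp: hom_def mult_complex_units carrier_complex_units)
  have "\<sigma> \<one> * \<sigma> \<one> = \<sigma> \<one>" using \<sigma>_mult(1)[of \<one> \<one>] subgroup.one_closed[OF H] by simp
  then have \<sigma>_one: "\<sigma> \<one> = 1" using \<sigma>_mult(2) subgroup.one_closed[OF H] by simp
  define g0 where "g0 = (\<lambda>h. (h, \<sigma> h)) ` H"
  have g0: "partial_character G g0"
  proof (unfold_locales)
    fix x a assume "(x, a) \<in> g0"
    then have xa: "x \<in> H" "a = \<sigma> x" by (auto simp: g0_def)
    show "x \<in> carrier G" "a \<noteq> 0" using xa subgroup.mem_carrier[OF H] \<sigma>_mult by auto
    have "inv x \<in> H" using subgroup.m_inv_closed[OF H xa(1)] .
    moreover have "\<sigma> x * \<sigma> (inv x) = 1"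
      using \<sigma>_mult(1)[OF xa(1) calculation] \<sigma>_one subgroup.mem_carrier[OF H xa(1)] by simp
    then have "\<sigma> (inv x) = inverse a" using xa by (metis inverse_unique)
    ultimately show "(inv x, inverse a) \<in> g0" by (force simp: g0_def)
    fix y c assume "(y, c) \<in> g0"
    then show "(x \<otimes> y, a * c) \<in> g0" using xa \<sigma>_mult subgroup.m_closed[OF H] by (auto simp: g0_def image_iff)
  next
    show "(\<one>, 1) \<in> g0" "\<And>a. (\<one>, a) \<in> g0 \<Longrightarrow> a = 1"
      using \<sigma>_one subgroup.one_closed[OF H] by (auto simp: g0_def image_iff)
  qed
  define \<A> where "\<A> = {g. partial_character G g \<and> g0 \<subseteq> g}"
  have "\<exists>g\<in>\<A>. \<forall>g'\<in>\<A>. g \<subseteq> g' \<longrightarrow> g' = g"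
  proof (rule subset_Zorn_nonempty)
    show "\<A> \<noteq> {}" using g0 by (auto simp: \<A>_def)
    fix \<C> assume ne: "\<C> \<noteq> {}" and ch: "subset.chain \<A> \<C>"
    have pc: "partial_character G g" "g0 \<subseteq> g" if "g \<in> \<C>" for g
      using ch that by (auto simp: subset.chain_def \<A>_def)
    have two: "\<exists>g\<in>\<C>. u \<in> g \<and> v \<in> g" if "u \<in> \<Union>\<C>" "v \<in> \<Union>\<C>" for u v
      using that ch unfolding subset.chain_def by blast
    have "partial_character G (\<Union>\<C>)"
    proof (unfold_locales)
      fix x a assume xa: "(x, a) \<in> \<Union>\<C>"
      then obtain g where g: "g \<in> \<C>" "(x, a) \<in> g" by blast
      interpret partial_character G g by (rule pc(1)[OF g(1)])
      show "x \<in> carrier G" "a \<noteq> 0" "(inv x, inverse a) \<in> \<Union>\<C>" using dom nonzero inv_mem g by blast+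
      fix y c assume "(y, c) \<in> \<Union>\<C>"
      then obtain g' where g': "g' \<in> \<C>" "(x, a) \<in> g'" "(y, c) \<in> g'" using two[OF xa] by blast
      then show "(x \<otimes> y, a * c) \<in> \<Union>\<C>" using partial_character.mult_mem[OF pc(1)[OF g'(1)]] by blast
    next
      show "(\<one>, 1) \<in> \<Union>\<C>" using ne pc(1) partial_character.one_mem by blast
      show "a = 1" if "(\<one>, a) \<in> \<Union>\<C>" for a using that pc(1) partial_character.one_unique by blast
    qed
    then show "\<Union>\<C> \<in> \<A>" using ne pc(2) by (auto simp: \<A>_def)
  qed
  then obtain g where g: "g \<in> \<A>" and max': "\<And>g'. g' \<in> \<A> \<Longrightarrow> g \<subseteq> g' \<Longrightarrow> g' = g"
    by blast
  have g: "partial_character G g" "g0 \<subseteq> g" using g by (simp_all add: \<A>_def)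
  have max: "g' = g" if "partial_character G g'" "g \<subseteq> g'" for g'
    by (rule max'[OF _ that(2)]) (use that g(2) in \<open>auto simp: \<A>_def\<close>)
  interpret pg: partial_character G g by (rule g(1))
  have total: "\<exists>c. (x, c) \<in> g" if "x \<in> carrier G" for x
    using pg.extend[OF that] max by metis
  define \<rho> where "\<rho> x = (THE c. (x, c) \<in> g)" for x
  have \<rho>: "\<rho> x = c" if "(x, c) \<in> g" for x c
    unfolding \<rho>_def using that pg.unique by blast
  have "\<rho> \<in> hom G complex_units"
  proof (rule homI)
    fix x assume "x \<in> carrier G"
    then obtain c where c: "(x, c) \<in> g" using total by blast
    then show "\<rho> x \<in> carrier complex_units" using \<rho> pg.nonzero by (auto simp: carrier_complex_units)
    fix y assume "y \<in> carrier G"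
    then obtain e where e: "(y, e) \<in> g" using total by blast
    show "\<rho> (x \<otimes> y) = \<rho> x \<otimes>\<^bsub>complex_units\<^esub> \<rho> y"
      using \<rho>[OF pg.mult_mem[OF c e]] \<rho>[OF c] \<rho>[OF e] by (simp add: mult_complex_units)
  qed
  moreover have "\<rho> h = \<sigma> h" if "h \<in> H" for h by (rule \<rho>) (use g(2) that in \<open>auto simp: g0_def\<close>)
  ultimately show ?thesis using that by blast
qed

section \<open>Existence of a representative\<close>

lemma class_inclusion:
  assumes "X \<subseteq> Y" "is_cycle X c"
  shows "H1_map X Y id (homologous_rel_set 1 (top_of_set X) {} c) = homologous_rel_set 1 (top_of_set Y) {} c"
proof -
  have cont: "continuous_map (top_of_set X) (top_of_set Y) id" using assms(1) by (auto simp: continuous_map_in_subtopology)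
  have "chain_map 1 id c = c" using assms(2) is_cycle_iff chain_map_ident by blast
  then show ?thesis using hom_induced_chain_map[OF cont _ assms(2), of "{}"] by simp
qed

lemma H1_element_cycle:
  assumes "z \<in> carrier (H1 X)"
  obtains c where "is_cycle X c" "z = homologous_rel_set 1 (top_of_set X) {} c"
  using assms carrier_relative_homology_group[of 1 "top_of_set X" "{}"] by auto

text \<open>On a fibre \<open>f\<close> is constant, and a cycle in a single point bounds.\<close>

lemma H1_fiber_image_subset_kernel:
  fixes f :: "'a::topological_space \<Rightarrow> 'b::topological_space"
  assumes f: "continuous_on M f" "f ` M \<subseteq> S"
  shows "H1_fiber_image M (fiber M f b) \<subseteq> H1_kernel M S f"
proof
  let ?F = "fiber M f b"
  have FM: "?F \<subseteq> M" by (auto simp: fiber_def)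
  fix z assume "z \<in> H1_fiber_image M ?F"
  then obtain z' where z': "z' \<in> carrier (H1 ?F)" "z = H1_map ?F M id z'"
    by (auto simp: H1_fiber_image_def)
  obtain c where c: "is_cycle ?F c" "z' = homologous_rel_set 1 (top_of_set ?F) {} c"
    by (rule H1_element_cycle[OF z'(1)])
  have z: "z = homologous_rel_set 1 (top_of_set M) {} c"
    using z'(2) c(2) class_inclusion[OF FM c(1)] by simp
  have cM: "is_cycle M c" using c(1) FM by (rule singular_cycle_mono)
  \<comment> \<open>The intersection with \<open>S\<close> covers also a point outside
    \<open>S\<close>, whose fibre is empty.\<close>
  have "continuous_map (top_of_set ?F) (top_of_set ({b} \<inter> S)) f"
    using continuous_on_subset[OF f(1) FM] f(2) by (auto simp: fiber_def)
  then have "singular_relcycle 1 (top_of_set ({b} \<inter> S)) {} (chain_map 1 f c)"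
    by (rule singular_relcycle_chain_map[OF c(1)]) auto
  moreover have "contractible_space (top_of_set ({b} \<inter> S))"
    by (cases "b \<in> S") (simp_all add: contractible_space_subtopology_singleton contractible_space_empty del: contractible_space_top_of_set)
  ultimately have "singular_relboundary 1 (top_of_set ({b} \<inter> S)) {} (chain_map 1 f c)"
    using contractible_cycle_boundary by blast
  then have bd: "singular_relboundary 1 (top_of_set S) {} (chain_map 1 f c)"
    using singular_boundary_mono[of "{b} \<inter> S" S] by blast
  have cont: "continuous_map (top_of_set M) (top_of_set S) f" using f by auto
  have "H1_map M S f z = homologous_rel_set 1 (top_of_set S) {} (chain_map 1 f c)"
    unfolding z using hom_induced_chain_map[OF cont _ cM, of "{}"] by simp
  moreover have "one (H1 S) = singular_relboundary_set 1 (top_of_set S) {}"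
    using one_relative_homology_group[of 1 "top_of_set S" "{}"] by simp
  ultimately have "H1_map M S f z = one (H1 S)"
    using bd homologous_rel_set_eq_relboundary[of 1 "top_of_set S" "{}"] by simp
  moreover have "z \<in> carrier (H1 M)"
    using z cM carrier_relative_homology_group[of 1 "top_of_set M" "{}"] by auto
  ultimately show "z \<in> H1_kernel M S f" by (simp add: H1_kernel_def kernel_def)
qed

text \<open>Pulled back along the quotient map, \<tau> is a character of the kernel of
  \<open>H1_map M S f\<close>, and this extends to all of \<open>H1 M\<close>. The extension is
  trivial on the fibre because classes of the fibre belong to the kernel and have the trivial
  coset.\<close>

lemma representative_exists:
  fixes M :: "'a::topological_space set" and S :: "'b::topological_space set"
    and f :: "'a \<Rightarrow> 'b" and b :: 'b
  defines "F \<equiv> fiber M f b"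
  assumes f: "continuous_on M f" "f ` M \<subseteq> S" and tau: "\<tau> \<in> hom (T_group M S f F) complex_units"
  shows "\<exists>\<rho>. representative M S f F \<tau> \<rho>"
proof -
  let ?G = "H1 M" and ?K = "H1_kernel M S f" and ?N = "H1_fiber_image M F"
  let ?GK = "?G\<lparr>carrier := ?K\<rparr>"
  interpret G: comm_group ?G by (rule abelian_homology_group)
  have hom: "group_hom ?G (H1 S) (H1_map M S f)"
    by (intro group_hom.intro group_hom_axioms.intro hom_induced_hom group_relative_homology_group)
  have K: "subgroup ?K ?G" unfolding H1_kernel_def by (rule group_hom.subgroup_kernel[OF hom])
  have homF: "group_hom (H1 F) ?G (H1_map F M id)"
    by (intro group_hom.intro group_hom_axioms.intro hom_induced_hom group_relative_homology_group)
  have N: "subgroup ?N ?G"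
    unfolding H1_fiber_image_def by (rule group_hom.img_is_subgroup[OF homF])
  have NK: "?N \<subseteq> ?K" unfolding F_def by (rule H1_fiber_image_subset_kernel[OF f])
  interpret GK: comm_group ?GK
    by (rule group.group_comm_groupI[OF G.subgroup_imp_group[OF K]])
       (use subgroup.mem_carrier[OF K] in \<open>simp add: G.m_comm\<close>)
  have "subgroup ?N ?GK" by (rule G.subgroup_incl[OF N K NK])
  then interpret N: normal ?N ?GK by (rule GK.normal_iff_subgroup[THEN iffD2])
  have coset: "?N #>\<^bsub>?GK\<^esub> z = ?N #>\<^bsub>?G\<^esub> z" for z by (simp add: r_coset_def)
  have carrierT: "carrier (T_group M S f F) = (\<lambda>z. ?N #>\<^bsub>?G\<^esub> z) ` ?K"
    by (auto simp: T_group_def FactGroup_def RCOSETS_def r_coset_def)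
  have \<sigma>: "(\<lambda>z. \<tau> (?N #>\<^bsub>?G\<^esub> z)) \<in> hom ?GK complex_units"
  proof (rule homI)
    fix z assume z: "z \<in> carrier ?GK"
    then have zT: "?N #>\<^bsub>?G\<^esub> z \<in> carrier (T_group M S f F)" using carrierT by auto
    then show "\<tau> (?N #>\<^bsub>?G\<^esub> z) \<in> carrier complex_units" using tau by (auto simp: hom_def)
    fix w assume w: "w \<in> carrier ?GK"
    then have wT: "?N #>\<^bsub>?G\<^esub> w \<in> carrier (T_group M S f F)" using carrierT by auto
    have "(?N #>\<^bsub>?G\<^esub> z) \<otimes>\<^bsub>T_group M S f F\<^esub> (?N #>\<^bsub>?G\<^esub> w) = ?N #>\<^bsub>?G\<^esub> (z \<otimes>\<^bsub>?GK\<^esub> w)"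
      using N.rcos_sum[OF z w] by (simp add: T_group_def FactGroup_def coset)
    then show "\<tau> (?N #>\<^bsub>?G\<^esub> (z \<otimes>\<^bsub>?GK\<^esub> w)) = \<tau> (?N #>\<^bsub>?G\<^esub> z) \<otimes>\<^bsub>complex_units\<^esub> \<tau> (?N #>\<^bsub>?G\<^esub> w)"
      using hom_mult[OF tau zT wT] by simp
  qed
  obtain \<rho> where \<rho>: "\<rho> \<in> hom ?G complex_units" "\<And>z. z \<in> ?K \<Longrightarrow> \<rho> z = \<tau> (?N #>\<^bsub>?G\<^esub> z)"
    using G.character_extension[OF K \<sigma>] by metis
  have "\<rho> (H1_map F M id c) = 1" if "c \<in> carrier (H1 F)" for c
  proof -
    let ?z = "H1_map F M id c"
    have zN: "?z \<in> ?N" using that by (auto simp: H1_fiber_image_def)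
    have "?N #>\<^bsub>?G\<^esub> ?z = ?N" using G.coset_join2[OF _ N zN] subgroup.mem_carrier[OF N zN] by simp
    moreover have "?N #>\<^bsub>?G\<^esub> \<one>\<^bsub>?G\<^esub> = ?N" using G.coset_mult_one subgroup.subset[OF N] by blast
    ultimately have "\<rho> ?z = \<rho> \<one>\<^bsub>?G\<^esub>"
      using \<rho>(2)[of ?z] \<rho>(2)[of "\<one>\<^bsub>?G\<^esub>"] NK zN subgroup.one_closed[OF K] by auto
    also have "\<dots> = 1"
    proof -
      have "\<rho> \<one>\<^bsub>?G\<^esub> * \<rho> \<one>\<^bsub>?G\<^esub> = \<rho> \<one>\<^bsub>?G\<^esub>" "\<rho> \<one>\<^bsub>?G\<^esub> \<noteq> 0"
        using hom_mult[OF \<rho>(1), of "\<one>\<^bsub>?G\<^esub>" "\<one>\<^bsub>?G\<^esub>"] hom_in_carrier[OF \<rho>(1), of "\<one>\<^bsub>?G\<^esub>"]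
        by (auto simp: mult_complex_units carrier_complex_units simp del: one_relative_homology_group)
      then show ?thesis by simp
    qed
    finally show ?thesis .
  qed
  then show ?thesis using \<rho> by (auto simp: representative_def characters_trivial_on_fiber_def)
qed

lemma T_group_carrier: "carrier (T_group M S f F) = (\<lambda>z. H1_fiber_image M F #>\<^bsub>H1 M\<^esub> z) ` H1_kernel M S f"
  by (auto simp: T_group_def FactGroup_def RCOSETS_def r_coset_def)

theorem theorem5p7:
  fixes M :: "'n::finite cproj set" and S :: "'m::finite cproj set"
    and f :: "'n cproj \<Rightarrow> 'm cproj" and U :: "'m cproj set" and b :: "'m cproj"
    and F :: "'n cproj set" and p :: "'n cproj"
    and \<tau> :: "'n cproj chain set set \<Rightarrow> complex"
  assumes M: "quasi_projective M" "smooth_of_dim 2 M" "connected M"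
    and S: "quasi_projective S" "smooth_of_dim 1 S" "connected S"
    and f: "morphism M S f" "f ` M = S"
    and U: "zariski_openin S U" "U \<noteq> {}" "locally_trivial_over M f U"
    and F: "b \<in> U" "F = fiber M f b" "connected F"
    and p: "p \<in> M"
    and tau: "\<tau> \<in> hom (T_group M S f F) complex_units"
  shows "character_support M S f F p \<tau> = {} \<longleftrightarrow> (\<forall>t\<in>carrier (T_group M S f F). \<tau> t = 1)"
proof -
  define \<rho> where "\<rho> = (SOME \<rho>. representative M S f F \<tau> \<rho>)"
  have cont: "continuous_on M f" by (rule morphism_continuous_on[OF f(1)])
  \<comment> \<open>The support is defined through a choice operator, which is meaningful once a
    representative exists.\<close>
  have "\<exists>\<rho>. representative M S f F \<tau> \<rho>"
    by (rule representative_exists[OF cont, of S \<tau> b, folded F(2)]) (use f(2) tau in auto)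
  then have rep: "representative M S f F \<tau> \<rho>" unfolding \<rho>_def by (rule someI_ex)
  have discS: "locally_disc_like S" by (rule smooth_locally_disc_like[OF S(2)]) simp
  have discM: "locally_disc_like M" by (rule smooth_locally_disc_like[OF M(2)]) simp
  have "U \<subseteq> S" using U(1) by (auto simp: zariski_openin_def)
  then have "b \<in> S" using F(1) by blast
  then obtain D where "D \<subseteq> S" "disc_like D" using locally_disc_likeE[OF discS, of S b] by auto
  then have "infinite S" using finite_subset by (auto simp: disc_like_def)
  interpret generic_fibration M S f U b
  proof unfold_locales
    show "finite (S - U)" by (rule curve_zariski_open_cofinite[OF S U(1,2)])
    show "T = {}" if "openin (top_of_set M) T" "T \<subseteq> f -` {s}" for T s
      by (rule morphism_fiber_no_interior[OF M(2,3) f \<open>infinite S\<close> that])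
  qed (use discM discS M S f U F cont \<open>U \<subseteq> S\<close> in auto)
  interpret fibration_character M S f U b \<rho>
  proof unfold_locales
    show "\<rho> \<in> hom (H1 M) complex_units"
      using rep by (auto simp: representative_def characters_trivial_on_fiber_def)
    fix c assume c: "is_cycle (fiber M f b) c"
    have "homologous_rel_set 1 (top_of_set F) {} c \<in> carrier (H1 F)"
      using c F(2) carrier_relative_homology_group[of 1 "top_of_set F" "{}"] by auto
    then have "\<rho> (H1_map F M id (homologous_rel_set 1 (top_of_set F) {} c)) = 1"
      using rep by (auto simp: representative_def characters_trivial_on_fiber_def)
    then show "cycle_value M \<rho> c = 1"
      using class_inclusion[of F M c] c F(2) by (auto simp: cycle_value_def fiber_def)
  qed
  have "character_support M S f F p \<tau> = {} \<longleftrightarrow> (\<forall>z\<in>H1_kernel M S f. \<rho> z = 1)"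
    using singular_support_empty_iff_kernel[OF p] by (simp add: character_support_def \<rho>_def)
  also have "\<dots> \<longleftrightarrow> (\<forall>t\<in>carrier (T_group M S f F). \<tau> t = 1)"
    using rep unfolding T_group_carrier representative_def by auto
  finally show ?thesis .
qed

end
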